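(* Let $\Omega\subset\mathbb{R}^1$ be a bounded domain (interval), $\alpha\in(1,2)$, $\nu=\alpha/2$, $T>0$, $r\ge 1$, and consider the graded mesh $t_n=T(n/N)^r$, $0\le n\le N$. Let $a_0=0$, $f=0$, and $a_1\in D((-\Delta)^{\gamma+\epsilon})$ with $\gamma\in(\frac14,1]$ and $0<\epsilon\ll 1$. Let $u$ be the solution of the fractional wave equation, $v=\partial_t^\nu u$, let $(U^n,V^n)$ be the solution of the L1 time semi-discrete scheme (all defined in the context), and set $\bar u^n=u(t_n)-U^n$, $\bar v^n=v(t_n)-V^n$. Then there is a constant $C>0$, independent of $n$, $N$ and $a_1$, such that $$\|\bar v^n\|_{L^2}+\|\nabla \bar u^n\|_{L^2}\le C\,(N^{-q_1}+N^{-q_3})\,\|(-\Delta)^{\gamma+\epsilon}a_1\|_{L^2},\qquad 1\le n\le N,$$ where $q_1=\min\{r(1-\nu),\,2-\nu\}$ and $q_3=\min\{r(1-\nu/2),\,2-\nu\}$.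
   Context: The Caputo derivative of order $\alpha\in(1,2)$ is $\partial_t^\alpha\psi(t)=\frac{1}{\Gamma(2-\alpha)}\int_0^t(t-s)^{1-\alpha}\psi''(s)\,ds$, and of order $\nu\in(0,1)$ is $\partial_t^\nu\psi(t)=\frac{1}{\Gamma(1-\nu)}\int_0^t(t-s)^{-\nu}\psi'(s)\,ds$. The fractional wave equation is $\partial_t^\alpha u-\Delta u=f$ in $\Omega\times(0,T)$, $u(\cdot,0)=a_0$, $\partial_tu(\cdot,0)=a_1$, $u=0$ on $\partial\Omega\times(0,T)$. Let $\omega_p(t)=t^{p-1}/\Gamma(p)$. Let $\{(\lambda_k,\varphi_k)\}$ be the Dirichlet eigensystem of $-\Delta$ on $\Omega$, with $\{\varphi_k\}$ orthonormal in $L^2(\Omega)$; $(-\Delta)^\gamma\psi=\sum_k\lambda_k^\gamma(\psi,\varphi_k)\varphi_k$, and $D((-\Delta)^\gamma)$ is the space of $\psi$ with $\sum_k|\lambda_k^\gamma(\psi,\varphi_k)|^2<\infty$. With $\tau_k=t_k-t_{k-1}$, the L1 approximation is $\bar\partial_t^\nu w^n=\sum_{k=1}^nA_{n-k}^{(n)}(w^k-w^{k-1})$, where $A_{n-k}^{(n)}=\int_{t_{k-1}}^{t_k}\frac{\omega_{1-\nu}(t_n-s)}{\tau_k}ds$. The time semi-discrete scheme is: $U^0=V^0=0$ and, for $1\le n\le N$, $\bar\partial_t^\nu V^n-\Delta U^n=a_1\,\omega_{2-\alpha}(t_n)$, $V^n=\bar\partial_t^\nu U^n$ in $\Omega$,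 with $U^n=V^n=0$ on $\partial\Omega$. *)

theory Defs
  imports "HOL-Analysis.Analysis"
begin

section \<open>The space L2 and calculus of L2-valued functions of time\<close>

text \<open>Elements of L2 are represented by functions; equality in L2 is equality almost everywhere.\<close>

definition L2_space :: "real measure \<Rightarrow> (real \<Rightarrow> real) set" where
  "L2_space M = {f \<in> borel_measurable M. integrable M (\<lambda>x. (f x)\<^sup>2)}"

definition L2_inner :: "real measure \<Rightarrow> (real \<Rightarrow> real) \<Rightarrow> (real \<Rightarrow> real) \<Rightarrow> real" where
  "L2_inner M f g = (\<integral>x. f x * g x \<partial>M)"

definition L2_norm :: "real measure \<Rightarrow> (real \<Rightarrow> real) \<Rightarrow> real" where
  "L2_norm M f = sqrt (\<integral>x. (f x)\<^sup>2 \<partial>M)"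

definition L2_continuous_on :: "real measure \<Rightarrow> real set \<Rightarrow> (real \<Rightarrow> real \<Rightarrow> real) \<Rightarrow> bool" where
  "L2_continuous_on M S u \<longleftrightarrow>
     (\<forall>t\<in>S. u t \<in> L2_space M) \<and>
     (\<forall>t\<in>S. ((\<lambda>s. L2_norm M (\<lambda>x. u s x - u t x)) \<longlongrightarrow> 0) (at t within S))"

definition has_L2_derivative ::
  "real measure \<Rightarrow> (real \<Rightarrow> real \<Rightarrow> real) \<Rightarrow> (real \<Rightarrow> real) \<Rightarrow> real \<Rightarrow> real set \<Rightarrow> bool" where
  "has_L2_derivative M u d t S \<longleftrightarrow>
     d \<in> L2_space M \<and> (\<forall>s\<in>S. u s \<in> L2_space M) \<and>
     ((\<lambda>s. L2_norm M (\<lambda>x. (u s x - u t x) / (s - t) - d x)) \<longlongrightarrow> 0) (at t within S)"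

text \<open>The Bochner integral of an L2-valued function. Since L2 is separable, weak measurability
  together with integrability of the norm is Bochner integrability (Pettis), and the integral is
  determined by its inner products.\<close>

definition has_L2_integral ::
  "real measure \<Rightarrow> (real \<Rightarrow> real \<Rightarrow> real) \<Rightarrow> (real \<Rightarrow> real) \<Rightarrow> real set \<Rightarrow> bool" where
  "has_L2_integral M g w S \<longleftrightarrow>
     w \<in> L2_space M \<and> (\<forall>s\<in>S. g s \<in> L2_space M) \<and>
     integrable (lebesgue_on S) (\<lambda>s. L2_norm M (g s)) \<and>
     (\<forall>\<psi>\<in>L2_space M.
        has_bochner_integral (lebesgue_on S) (\<lambda>s. L2_inner M (g s) \<psi>) (L2_inner M w \<psi>))"


section \<open>Caputo derivatives\<close>

text \<open>\<open>w\<close> is the Caputo derivative at time \<open>t\<close> of order \<open>\<nu>\<close> in (0,1), respectively of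
  order \<open>\<alpha>\<close> in (1,2). The continuity conditions exclude jumps of \<open>u\<close> (respectively of its
  first derivative) at the endpoints, which the integral alone would not see.\<close>

definition has_caputo_low ::
  "real measure \<Rightarrow> real \<Rightarrow> (real \<Rightarrow> real \<Rightarrow> real) \<Rightarrow> real \<Rightarrow> (real \<Rightarrow> real) \<Rightarrow> bool" where
  "has_caputo_low M \<nu> u t w \<longleftrightarrow>
     L2_continuous_on M {0..t} u \<and>
     (\<exists>u'. (\<forall>s\<in>{0<..<t}. has_L2_derivative M u (u' s) s {0..t}) \<and>
           has_L2_integral M (\<lambda>s x. 1 / Gamma (1 - \<nu>) * (t - s) powr (- \<nu>) * u' s x) w {0<..<t})"

definition has_caputo_high ::
  "real measure \<Rightarrow> real \<Rightarrow> (real \<Rightarrow> real \<Rightarrow> real) \<Rightarrow> real \<Rightarrow> (real \<Rightarrow> real) \<Rightarrow> bool" where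
  "has_caputo_high M \<alpha> u t w \<longleftrightarrow>
     (\<exists>u' u''. (\<forall>s\<in>{0..t}. has_L2_derivative M u (u' s) s {0..t}) \<and>
           L2_continuous_on M {0..t} u' \<and>
           (\<forall>s\<in>{0<..<t}. has_L2_derivative M u' (u'' s) s {0..t}) \<and>
           has_L2_integral M (\<lambda>s x. 1 / Gamma (2 - \<alpha>) * (t - s) powr (1 - \<alpha>) * u'' s x) w {0<..<t})"


section \<open>The Dirichlet Laplacian on an interval\<close>

abbreviation interval_measure_on :: "real \<Rightarrow> real \<Rightarrow> real measure" where
  "interval_measure_on a b \<equiv> lebesgue_on {a<..<b}"

text \<open>\<open>w\<close> lies in \<open>H\<^sup>2 \<inter> H\<^sub>0\<^sup>1\<close> of (a,b) and its Laplacian is \<open>z\<close>. In one dimension such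
  functions are continuously differentiable on [a,b], with an absolutely continuous derivative
  whose density is \<open>z\<close>; \<open>w\<close> denotes this representative.\<close>

definition dirichlet_laplacian ::
  "real \<Rightarrow> real \<Rightarrow> (real \<Rightarrow> real) \<Rightarrow> (real \<Rightarrow> real) \<Rightarrow> bool" where
  "dirichlet_laplacian a b w z \<longleftrightarrow>
     z \<in> L2_space (interval_measure_on a b) \<and> w a = 0 \<and> w b = 0 \<and>
     (\<exists>w'. \<forall>x\<in>{a..b}. (w has_real_derivative w' x) (at x within {a..b}) \<and>
                     (z has_integral (w' x - w' a)) {a..x})"

definition dirichlet_eigensystem ::
  "real \<Rightarrow> real \<Rightarrow> (nat \<Rightarrow> real) \<Rightarrow> (nat \<Rightarrow> real \<Rightarrow> real) \<Rightarrow> bool" where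
  "dirichlet_eigensystem a b lam \<phi> \<longleftrightarrow>
     (let M = interval_measure_on a b in
     (\<forall>k. dirichlet_laplacian a b (\<phi> k) (\<lambda>x. - lam k * \<phi> k x)) \<and>
     (\<forall>j k. L2_inner M (\<phi> j) (\<phi> k) = (if j = k then 1 else 0)) \<and>
     (\<forall>f\<in>L2_space M.
        (\<lambda>n. L2_norm M (\<lambda>x. f x - (\<Sum>k<n. L2_inner M f (\<phi> k) * \<phi> k x))) \<longlonglongrightarrow> 0))"

definition frac_laplacian_domain ::
  "real \<Rightarrow> real \<Rightarrow> (nat \<Rightarrow> real) \<Rightarrow> (nat \<Rightarrow> real \<Rightarrow> real) \<Rightarrow> real \<Rightarrow> (real \<Rightarrow> real) set" where
  "frac_laplacian_domain a b lam \<phi> \<gamma> =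
     {\<psi> \<in> L2_space (interval_measure_on a b).
        summable (\<lambda>k. \<bar>lam k powr \<gamma> * L2_inner (interval_measure_on a b) \<psi> (\<phi> k)\<bar>\<^sup>2)}"

text \<open>\<open>w\<close> is the sum in L2 of the series defining \<open>(-\<Delta>)\<^sup>\<gamma> \<psi>\<close>.\<close>

definition frac_laplacian ::
  "real \<Rightarrow> real \<Rightarrow> (nat \<Rightarrow> real) \<Rightarrow> (nat \<Rightarrow> real \<Rightarrow> real) \<Rightarrow> real
     \<Rightarrow> (real \<Rightarrow> real) \<Rightarrow> (real \<Rightarrow> real) \<Rightarrow> bool" where
  "frac_laplacian a b lam \<phi> \<gamma> \<psi> w \<longleftrightarrow>
     (let M = interval_measure_on a b in
     w \<in> L2_space M \<and>
     (\<lambda>n. L2_norm M (\<lambda>x. w x - (\<Sum>k<n. lam k powr \<gamma> * L2_inner M \<psi> (\<phi> k) * \<phi> k x)))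
       \<longlonglongrightarrow> 0)"


section \<open>The fractional wave equation\<close>

text \<open>Strong solutions: \<open>u t\<close> is the spatial profile at time \<open>t\<close>, and the equation holds in
  L2 at every time in (0,T). The spatial regularity is required up to \<open>T\<close> so that the gradient
  at the final time is defined.\<close>

definition frac_wave_solution ::
  "real \<Rightarrow> real \<Rightarrow> real \<Rightarrow> real \<Rightarrow> (real \<Rightarrow> real \<Rightarrow> real) \<Rightarrow> (real \<Rightarrow> real) \<Rightarrow> (real \<Rightarrow> real)
     \<Rightarrow> (real \<Rightarrow> real \<Rightarrow> real) \<Rightarrow> bool" where
  "frac_wave_solution a b \<alpha> T f a0 a1 u \<longleftrightarrow>
     (let M = interval_measure_on a b in
     L2_continuous_on M {0..T} u \<and>
     (AE x in M. u 0 x = a0 x) \<and>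
     has_L2_derivative M u a1 0 {0..T} \<and>
     (\<forall>t\<in>{0<..T}. \<exists>z. dirichlet_laplacian a b (u t) z) \<and>
     (\<forall>t\<in>{0<..<T}. \<exists>w z. has_caputo_high M \<alpha> u t w \<and> dirichlet_laplacian a b (u t) z \<and>
                       (AE x in M. w x - z x = f t x)))"


section \<open>The L1 time semi-discrete scheme\<close>

definition omega :: "real \<Rightarrow> real \<Rightarrow> real" where
  "omega p t = t powr (p - 1) / Gamma p"

definition graded_mesh :: "real \<Rightarrow> nat \<Rightarrow> real \<Rightarrow> nat \<Rightarrow> real" where
  "graded_mesh T N r n = T * (real n / real N) powr r"

text \<open>\<open>L1_weight \<nu> t n j\<close> is \<open>A\<^sub>j\<close> at level \<open>n\<close>; it belongs to the subinterval with index
  \<open>k = n - j\<close>.\<close>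

definition L1_weight :: "real \<Rightarrow> (nat \<Rightarrow> real) \<Rightarrow> nat \<Rightarrow> nat \<Rightarrow> real" where
  "L1_weight \<nu> t n j =
     (let k = n - j in
      integral {t (k - 1)..t k} (\<lambda>s. omega (1 - \<nu>) (t n - s) / (t k - t (k - 1))))"

definition L1_derivative ::
  "real \<Rightarrow> (nat \<Rightarrow> real) \<Rightarrow> (nat \<Rightarrow> real \<Rightarrow> real) \<Rightarrow> nat \<Rightarrow> real \<Rightarrow> real" where
  "L1_derivative \<nu> t w n x = (\<Sum>k=1..n. L1_weight \<nu> t n (n - k) * (w k x - w (k - 1) x))"

definition L1_scheme ::
  "real \<Rightarrow> real \<Rightarrow> real \<Rightarrow> real \<Rightarrow> nat \<Rightarrow> (nat \<Rightarrow> real) \<Rightarrow> (real \<Rightarrow> real)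
     \<Rightarrow> (nat \<Rightarrow> real \<Rightarrow> real) \<Rightarrow> (nat \<Rightarrow> real \<Rightarrow> real) \<Rightarrow> bool" where
  "L1_scheme a b \<alpha> \<nu> N t a1 U V \<longleftrightarrow>
     (\<forall>x\<in>{a..b}. U 0 x = 0 \<and> V 0 x = 0) \<and>
     (\<forall>n\<in>{1..N}.
        (\<exists>z. dirichlet_laplacian a b (U n) z \<and>
             (AE x in interval_measure_on a b.
                L1_derivative \<nu> t V n x - z x = a1 x * omega (2 - \<alpha>) (t n))) \<and>
        (\<forall>x\<in>{a<..<b}. V n x = L1_derivative \<nu> t U n x) \<and>
        V n a = 0 \<and> V n b = 0)"

end

theory Submission
  imports Defs "HOL-Complex_Analysis.Complex_Analysis"
begin

text \<open>Everything is linear and diagonal in the eigenbasis \<open>\<phi>\<close>. If \<open>a_k\<close> is the \<open>k\<close>-th coefficient of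
  \<open>a1\<close>, the coefficients of \<open>u\<close> and \<open>v\<close> are \<open>a_k * y\<close> and \<open>a_k * v_k\<close>, where \<open>y\<close> is the solution of
  the fractional oscillator: its Caputo derivative of order \<open>2 * \<nu>\<close> is \<open>- lam k * y\<close>, with \<open>y 0 = 0\<close> and
  \<open>y' 0 = 1\<close>, and \<open>v_k\<close> is its Caputo derivative of order \<open>\<nu>\<close>. The coefficients of \<open>U\<close> and \<open>V\<close> solve the
  L1 scheme for the same scalar system. The theorem is therefore a bound for one mode with explicit
  dependence on \<open>lam k\<close>, summed over \<open>k\<close>.

  Regularity of one mode (\<open>oscillator_modes\<close>). Up to sign, and for \<open>v_k''\<close> up to an explicit
  power of \<open>t\<close>, the Laplace transforms of \<open>y''\<close> and \<open>v_k''\<close> are \<open>lam / (p powr (2 * \<nu>) + lam)\<close> and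
  \<open>lam * p powr \<nu> / (p powr (2 * \<nu>) + lam)\<close>. Because \<open>2 * \<nu> < 2\<close>, these functions extend
  holomorphically beyond the imaginary axis, so they can be inverted by integrals along a pair of rays in the
  left half plane, where the exponential decays. Estimating these integrals gives
  \<open>\<bar>y'' t\<bar> \<le> C * lam powr (- 1 / 4) * t powr (- 1 - \<nu> / 2)\<close> and \<open>\<bar>v_k'' t\<bar> \<le> C * t powr (- 1 - \<nu>)\<close>
  with \<open>C\<close> independent of \<open>lam\<close>. That the functions built in this way solve the oscillator equation
  is checked on Laplace transforms (\<open>has_laplace_unique\<close>); that they are the coefficients of \<open>u\<close> follows
  because a strong solution satisfies a Volterra equation mode by mode (\<open>caputo_volterra\<close>), which has only
  one solution (\<open>volterra_unique\<close>).

  Truncation (\<open>L1_truncation\<close>). If \<open>y'' t\<close> is of size \<open>t powr (\<sigma> - 2)\<close>, the L1 formula at level \<open>n\<close>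
  of the graded mesh has error of size \<open>t n powr (- \<nu>) * N powr (- min (r * \<sigma>) (2 - \<nu>))\<close>. The
  exponents \<open>\<sigma> = 1 - \<nu>\<close> for \<open>v_k\<close> and \<open>\<sigma> = 1 - \<nu> / 2\<close> for \<open>y\<close> produce \<open>q1\<close> and \<open>q3\<close>.

  Stability (\<open>L1_stability\<close>). The errors of one mode form a vector \<open>(v, sqrt lam * u)\<close>, on which the
  coupling of the two equations acts by a skew matrix and so disappears from the energy. The L1 weights
  increase with the index of the cell and the first is at least \<open>omega (1 - \<nu>) (t n)\<close>, so truncation errors of
  size \<open>M * t n powr (- \<nu>)\<close> produce an error of at most \<open>M * Gamma (1 - \<nu>)\<close>, uniformly in \<open>n\<close>.

  In the energy the factor \<open>lam powr (- 1 / 4)\<close> in the bound for \<open>y''\<close> turns into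
  \<open>lam powr (1 / 4)\<close>. Since \<open>\<gamma> + \<epsilon> > 1 / 4\<close> and the eigenvalues are bounded below, it is
  dominated by \<open>lam powr (\<gamma> + \<epsilon>)\<close>, and the sum over all modes is controlled by the norm of
  \<open>(-\<Delta>) powr (\<gamma> + \<epsilon>)\<close> applied to \<open>a1\<close>. Parseval's identities for the function and for its
  gradient turn the sums into the two norms of the theorem.\<close>

section \<open>Fractional integrals and Laplace transforms\<close>

text \<open>The kernel vanishes on the negative half line, so that fractional integrals from 0 become
  convolutions over the whole line for functions that vanish there.\<close>

definition frac_kernel :: "real \<Rightarrow> real \<Rightarrow> real" where
  "frac_kernel b t = (if 0 < t then omega b t else 0)"

definition frac_int :: "real \<Rightarrow> (real \<Rightarrow> real) \<Rightarrow> real \<Rightarrow> real" where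
  "frac_int b f t = (\<integral>s. frac_kernel b (t - s) * f s \<partial>lborel)"

lemma frac_kernel_measurable [measurable]: "frac_kernel b \<in> borel_measurable borel"
  unfolding frac_kernel_def omega_def by measurable

lemma frac_kernel_nonneg: "0 < b \<Longrightarrow> 0 \<le> frac_kernel b t"
  by (simp add: frac_kernel_def omega_def Gamma_real_pos less_imp_le)

lemma frac_int_measurable [measurable]:
  assumes [measurable]: "f \<in> borel_measurable borel"
  shows "frac_int b f \<in> borel_measurable borel"
  unfolding frac_int_def by measurable

text \<open>Scaling \<open>r = t * x\<close> turns the convolution into Euler's Beta integral.\<close>

lemma frac_kernel_convolution_nn:
  assumes a: "0 < a" and b: "0 < b"
  shows "(\<integral>\<^sup>+r. ennreal (frac_kernel a (t - r) * frac_kernel b r) \<partial>lborel) = ennreal (frac_kernel (a + b) t)"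
proof (cases "0 < t")
  case False
  then have zero: "frac_kernel a (t - r) * frac_kernel b r = 0" for r
    by (auto simp: frac_kernel_def)
  show ?thesis unfolding zero using False by (simp add: frac_kernel_def)
next
  case t: True
  define c where "c = t powr (a + b - 2) / (Gamma a * Gamma b)"
  define k where "k = (\<lambda>x::real. x powr (b - 1) * (1 - x) powr (a - 1))"
  have c0: "0 \<le> c" unfolding c_def using a b by (simp add: Gamma_real_pos less_imp_le)
  have k0: "0 \<le> k x" for x by (simp add: k_def)
  have eq: "frac_kernel a (t - (0 + t * x)) * frac_kernel b (0 + t * x) = c * (indicator {0<..<1} x * k x)" for x
  proof (cases "x \<in> {0<..<1}")
    case True
    then have "t - t * x = t * (1 - x)" "0 < t * (1 - x)" "0 < t * x"
      using t by (auto simp: algebra_simps)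
    moreover have "t powr (a + b - 2) = t powr (a - 1) * t powr (b - 1)"
      by (simp flip: powr_add)
    ultimately show ?thesis
      using True t by (simp add: frac_kernel_def omega_def c_def k_def powr_mult)
  next
    case False
    then have "\<not> (0 < t - t * x \<and> 0 < t * x)" using t
      by (auto simp: zero_less_mult_iff) 
    then show ?thesis using False by (auto simp: frac_kernel_def)
  qed
  have "(\<integral>\<^sup>+x. ennreal (indicator {0..1} x * k x) \<partial>lborel) = ennreal (Beta b a)"
    using nn_integral_has_integral_lebesgue[OF _ has_integral_Beta_real[OF b a]] k0
    by (simp add: k_def)
  moreover have "(\<integral>\<^sup>+x. ennreal (indicator {0<..<1} x * k x) \<partial>lborel) = (\<integral>\<^sup>+x. ennreal (indicator {0..1} x * k x) \<partial>lborel)"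
    by (intro nn_integral_cong) (auto simp: k_def indicator_def)
  ultimately have beta: "(\<integral>\<^sup>+x. ennreal (indicator {0<..<1} x * k x) \<partial>lborel) = ennreal (Beta b a)"
    by simp
  have "(\<integral>\<^sup>+r. ennreal (frac_kernel a (t - r) * frac_kernel b r) \<partial>lborel)
      = ennreal t * (\<integral>\<^sup>+x. ennreal (c * (indicator {0<..<1} x * k x)) \<partial>lborel)"
    using t by (subst nn_integral_real_affine[where c = t and t = 0]) (simp_all only: eq abs_of_pos, simp_all)
  also have "\<dots> = ennreal t * (ennreal c * ennreal (Beta b a))"
    using beta c0 k0 by (subst ennreal_mult) (auto simp: nn_integral_cmult k_def)
  also have "\<dots> = ennreal (t * (c * Beta b a))"
  proof -
    have "0 \<le> Beta b a" using a b by (simp add: Beta_def Gamma_real_pos less_imp_le)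
    then show ?thesis using t c0 by (simp add: ennreal_mult)
  qed
  also have "t * (c * Beta b a) = frac_kernel (a + b) t"
  proof -
    have "t powr (a + b - 1) = t * t powr (a + b - 2)"
      using t by (simp add: powr_mult_base)
    moreover have "Gamma a > 0" "Gamma b > 0" using a b by (auto intro: Gamma_real_pos)
    ultimately show ?thesis
      using t by (simp add: frac_kernel_def omega_def c_def Beta_def add.commute)
  qed
  finally show ?thesis .
qed

lemma frac_kernel_convolution:
  assumes "0 < a" "0 < b"
  shows "has_bochner_integral lborel (\<lambda>r. frac_kernel a (t - r) * frac_kernel b (r - s)) (frac_kernel (a + b) (t - s))"
proof -
  have "(\<integral>\<^sup>+r. ennreal (frac_kernel a (t - r) * frac_kernel b (r - s)) \<partial>lborel) =
    (\<integral>\<^sup>+r. ennreal (frac_kernel a (t - s - r) * frac_kernel b r) \<partial>lborel)"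
    by (subst nn_integral_real_affine[where c = 1 and t = s]) (auto simp: algebra_simps)
  also have "\<dots> = ennreal (frac_kernel (a + b) (t - s))"
    by (rule frac_kernel_convolution_nn[OF assms])
  finally show ?thesis
    using assms by (intro has_bochner_integral_nn_integral) (auto simp: frac_kernel_nonneg)
qed

lemma frac_int_kernel:
  assumes "0 < a" "0 < b"
  shows "frac_int a (frac_kernel b) t = frac_kernel (a + b) t"
  using frac_kernel_convolution[OF assms, of t 0]
  by (simp add: frac_int_def has_bochner_integral_iff)

text \<open>Fubini reduces this to the convolution of the two kernels. The integrability assumption
  concerns only the composed kernel, whose order may be large enough to make it bounded.\<close>

lemma frac_int_semigroup:
  assumes a: "0 < a" and b: "0 < b" and f [measurable]: "f \<in> borel_measurable borel"
    and int: "integrable lborel (\<lambda>s. frac_kernel (a + b) (t - s) * f s)"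
  shows "frac_int a (frac_int b f) t = frac_int (a + b) f t"
    and "integrable lborel (\<lambda>r. frac_kernel a (t - r) * frac_int b f r)"
proof -
  define F where "F = (\<lambda>s r. frac_kernel a (t - r) * (frac_kernel b (r - s) * f s))"
  have inner: "has_bochner_integral lborel (F s) (frac_kernel (a + b) (t - s) * f s)" for s
    using has_bochner_integral_mult_left[OF frac_kernel_convolution[OF a b, of t s], of "f s"]
    by (simp add: F_def mult_ac)
  have inner': "(\<integral>r. norm (F s r) \<partial>lborel) = \<bar>frac_kernel (a + b) (t - s) * f s\<bar>" for s
    using has_bochner_integral_mult_left[OF frac_kernel_convolution[OF a b, of t s], of "\<bar>f s\<bar>"]
      frac_kernel_nonneg[OF a] frac_kernel_nonneg[OF b] frac_kernel_nonneg[of "a + b"] a b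
    by (simp add: F_def abs_mult mult_ac has_bochner_integral_iff)
  have "integrable (lborel \<Otimes>\<^sub>M lborel) (\<lambda>(s, r). F s r)"
  proof (rule lborel_pair.Fubini_integrable)
    show "(\<lambda>(s, r). F s r) \<in> borel_measurable (lborel \<Otimes>\<^sub>M lborel)"
      unfolding F_def by measurable
    show "integrable lborel (\<lambda>s. LINT r|lborel. norm (case (s, r) of (s, r) \<Rightarrow> F s r))"
      using integrable_abs[OF int] by (simp only: prod.case inner')
  qed (use inner in \<open>auto simp: has_bochner_integral_iff\<close>)
  from lborel_pair.Fubini_integral[OF this] lborel_pair.integrable_snd[OF this]
  have eq: "(\<integral>r. (\<integral>s. F s r \<partial>lborel) \<partial>lborel) = (\<integral>s. (\<integral>r. F s r \<partial>lborel) \<partial>lborel)"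
    and int2: "integrable lborel (\<lambda>r. \<integral>s. F s r \<partial>lborel)" by auto
  have F1: "(\<integral>s. F s r \<partial>lborel) = frac_kernel a (t - r) * frac_int b f r" for r
    by (simp add: F_def frac_int_def)
  show "frac_int a (frac_int b f) t = frac_int (a + b) f t"
    using eq inner by (simp add: F1 frac_int_def[of a] frac_int_def[of "a + b"] has_bochner_integral_iff)
  show "integrable lborel (\<lambda>r. frac_kernel a (t - r) * frac_int b f r)"
    using int2 by (simp add: F1)
qed

lemma laplace_frac_kernel:
  assumes p: "0 < p" and b: "0 < b"
  shows "has_bochner_integral lborel (\<lambda>t. exp (- p * t) * frac_kernel b t) (p powr (- b))"
proof -
  have "(\<integral>\<^sup>+t. ennreal (exp (- p * t) * frac_kernel b t) \<partial>lborel)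
      = ennreal (1 / p) * (\<integral>\<^sup>+t. ennreal (exp (- p * (0 + 1 / p * t)) * frac_kernel b (0 + 1 / p * t)) \<partial>lborel)"
    using p by (subst nn_integral_real_affine[where c = "1 / p" and t = 0]) auto
  also have "(\<integral>\<^sup>+t. ennreal (exp (- p * (0 + 1 / p * t)) * frac_kernel b (0 + 1 / p * t)) \<partial>lborel)
      = (\<integral>\<^sup>+t. ennreal (p powr (1 - b) / Gamma b) * ennreal (indicator {0..} t * t powr (b - 1) / exp t) \<partial>lborel)"
  proof (intro nn_integral_cong)
    fix t :: real
    have "exp (- p * (0 + 1 / p * t)) * frac_kernel b (0 + 1 / p * t)
        = p powr (1 - b) / Gamma b * (indicator {0..} t * t powr (b - 1) / exp t)"
    proof (cases "0 < t")
      case True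
      have "p powr (1 - b) = 1 / p powr (b - 1)"
        using powr_minus_divide[of p "b - 1"] by simp
      then show ?thesis
        using True p b by (simp add: frac_kernel_def omega_def powr_divide exp_minus inverse_eq_divide)
    qed (use p in \<open>auto simp: frac_kernel_def indicator_def zero_less_divide_iff\<close>)
    then show "ennreal (exp (- p * (0 + 1 / p * t)) * frac_kernel b (0 + 1 / p * t)) =
       ennreal (p powr (1 - b) / Gamma b) * ennreal (indicator {0..} t * t powr (b - 1) / exp t)"
      using b by (simp flip: ennreal_mult' add: Gamma_real_pos less_imp_le)
  qed
  also have "\<dots> = ennreal (p powr (1 - b) / Gamma b) * ennreal (Gamma b)"
    using b by (simp add: nn_integral_cmult Gamma_conv_nn_integral_real)
  also have "ennreal (1 / p) * \<dots> = ennreal (p powr (- b))"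
  proof -
    have "Gamma b > 0" using b by (simp add: Gamma_real_pos)
    moreover have "p powr (1 - b) = p * p powr (- b)" using p by (simp add: powr_mult_base)
    ultimately show ?thesis using p by (simp flip: ennreal_mult')
  qed
  finally show ?thesis
    using b by (intro has_bochner_integral_nn_integral) (auto simp: frac_kernel_nonneg)
qed

text \<open>A convolution has the product of the transforms as its transform; the kernel contributes
  \<open>p powr (- b)\<close>.\<close>

lemma laplace_frac_int:
  assumes p: "0 < p" and b: "0 < b"
    and f: "has_bochner_integral lborel (\<lambda>t. exp (- p * t) * f t) L"
    and [measurable]: "f \<in> borel_measurable borel"
  shows "has_bochner_integral lborel (\<lambda>t. exp (- p * t) * frac_int b f t) (p powr (- b) * L)"
proof -
  define F where "F = (\<lambda>s t. exp (- p * t) * (frac_kernel b (t - s) * f s))"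
  have shift: "has_bochner_integral lborel (\<lambda>t. exp (- p * t) * frac_kernel b (t - s)) (exp (- p * s) * p powr (- b))" for s
  proof -
    have "has_bochner_integral lborel (\<lambda>t. exp (- p * (- s + 1 * t)) * frac_kernel b (- s + 1 * t)) (p powr (- b))"
      using lborel_has_bochner_integral_real_affine_iff[of 1 "\<lambda>t. exp (- p * t) * frac_kernel b t" "p powr (- b)" "- s"]
        laplace_frac_kernel[OF p b] by simp
    from has_bochner_integral_mult_right[OF this, of "exp (- p * s)"]
    show ?thesis by (simp add: algebra_simps exp_add[symmetric] flip: mult.assoc)
  qed
  have inner: "has_bochner_integral lborel (F s) (p powr (- b) * (exp (- p * s) * f s))" for s
    using has_bochner_integral_mult_left[OF shift[of s], of "f s"] by (simp add: F_def mult_ac)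
  have inner': "(\<integral>t. norm (F s t) \<partial>lborel) = p powr (- b) * \<bar>exp (- p * s) * f s\<bar>" for s
    using has_bochner_integral_mult_left[OF shift[of s], of "\<bar>f s\<bar>"] frac_kernel_nonneg[OF b]
    by (simp add: F_def abs_mult mult_ac has_bochner_integral_iff)
  have "integrable (lborel \<Otimes>\<^sub>M lborel) (\<lambda>(s, t). F s t)"
  proof (rule lborel_pair.Fubini_integrable)
    show "(\<lambda>(s, t). F s t) \<in> borel_measurable (lborel \<Otimes>\<^sub>M lborel)"
      unfolding F_def by measurable
    show "integrable lborel (\<lambda>s. LINT t|lborel. norm (case (s, t) of (s, t) \<Rightarrow> F s t))"
      using f integrable_abs unfolding prod.case inner' has_bochner_integral_iff by auto
  qed (use inner in \<open>auto simp: has_bochner_integral_iff\<close>)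
  from lborel_pair.Fubini_integral[OF this] lborel_pair.integrable_snd[OF this]
  have eq: "(\<integral>t. (\<integral>s. F s t \<partial>lborel) \<partial>lborel) = (\<integral>s. (\<integral>t. F s t \<partial>lborel) \<partial>lborel)"
    and int2: "integrable lborel (\<lambda>t. \<integral>s. F s t \<partial>lborel)" by auto
  have F1: "(\<integral>s. F s t \<partial>lborel) = exp (- p * t) * frac_int b f t" for t
    by (simp add: F_def frac_int_def)
  show ?thesis
    using eq int2 inner f by (simp add: F1 has_bochner_integral_iff)
qed

text \<open>The majorant \<open>B * frac_kernel 1\<close> expresses a bound by \<open>B\<close> on the
  positive half line, and it can be integrated exactly.\<close>

lemma frac_int_bound:
  assumes b: "0 < b" and B: "\<And>s. \<bar>f s\<bar> \<le> B * frac_kernel 1 s" and [measurable]: "f \<in> borel_measurable borel"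
  shows "\<bar>frac_int b f t\<bar> \<le> B * frac_kernel (b + 1) t"
    and "integrable lborel (\<lambda>s. frac_kernel b (t - s) * f s)"
proof -
  have k: "has_bochner_integral lborel (\<lambda>s. B * (frac_kernel b (t - s) * frac_kernel 1 s)) (B * frac_kernel (b + 1) t)"
    using has_bochner_integral_mult_right[OF frac_kernel_convolution[OF b zero_less_one, of t 0], of B] by simp
  have le: "norm (frac_kernel b (t - s) * f s) \<le> B * (frac_kernel b (t - s) * frac_kernel 1 s)" for s
    using mult_left_mono[OF B[of s] frac_kernel_nonneg[OF b, of "t - s"]] frac_kernel_nonneg[OF b, of "t - s"]
    by (simp add: abs_mult mult_ac)
  show int: "integrable lborel (\<lambda>s. frac_kernel b (t - s) * f s)"
  proof (rule Bochner_Integration.integrable_bound)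
    show "integrable lborel (\<lambda>s. B * (frac_kernel b (t - s) * frac_kernel 1 s))"
      using k by (simp only: has_bochner_integral_iff)
    show "AE s in lborel. norm (frac_kernel b (t - s) * f s)
        \<le> norm (B * (frac_kernel b (t - s) * frac_kernel 1 s))"
      using le by (intro AE_I2) (metis abs_ge_self order_trans real_norm_def)
  qed measurable
  have "\<bar>frac_int b f t\<bar> \<le> (\<integral>s. norm (frac_kernel b (t - s) * f s) \<partial>lborel)"
    unfolding frac_int_def using integral_norm_bound[of lborel "\<lambda>s. frac_kernel b (t - s) * f s"] by simp
  also have "\<dots> \<le> (\<integral>s. B * (frac_kernel b (t - s) * frac_kernel 1 s) \<partial>lborel)"
    using le int k by (intro integral_mono integrable_norm) (auto simp: has_bochner_integral_iff)
  also have "\<dots> = B * frac_kernel (b + 1) t"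
    using k by (simp only: has_bochner_integral_iff)
  finally show "\<bar>frac_int b f t\<bar> \<le> B * frac_kernel (b + 1) t" .
qed

lemma continuous_on_atLeast_if_Icc:
  fixes f :: "real \<Rightarrow> real"
  assumes "\<And>T. 0 < T \<Longrightarrow> continuous_on {0..T} f"
  shows "continuous_on {0..} f"
proof (subst continuous_on_eq_continuous_within, intro ballI)
  fix x :: real assume x: "x \<in> {0..}"
  have "continuous (at x within {0..x + 1}) f"
    using assms[of "x + 1"] x by (auto simp: continuous_on_eq_continuous_within)
  moreover have "at x within {0..x + 1} = at x within {0..}"
    by (rule at_within_nhd[of _ "{..<x + 1}"]) auto
  ultimately show "continuous (at x within {0..}) f" by simp
qed

text \<open>After the substitution \<open>s = t * x\<close> the kernel no longer depends on
  \<open>t\<close>, and dominated convergence applies.\<close>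

lemma frac_int_continuous:
  assumes b: "0 < b" and f [measurable]: "f \<in> borel_measurable borel"
    and cont: "continuous_on {0..} f" and zero: "\<And>s. s < 0 \<Longrightarrow> f s = 0"
  shows "continuous_on {0..} (frac_int b f)"
proof -
  define g where "g = (\<lambda>t x. frac_kernel b (1 - x) * (indicator {0..} x * f (t * x)))"
  have eq: "frac_int b f t = t powr b * (\<integral>x. g t x \<partial>lborel)" if t: "0 \<le> t" for t
  proof (cases "t = 0")
    case True
    have z: "frac_kernel b (0 - s) * f s = 0" for s
      using zero[of s] by (simp add: frac_kernel_def)
    have "frac_int b f 0 = 0" unfolding frac_int_def z by simp
    then show ?thesis using True by simp
  next
    case False
    with t have t: "0 < t" by simp
    have "frac_int b f t = \<bar>t\<bar> *\<^sub>R (\<integral>x. frac_kernel b (t - (0 + t * x)) * f (0 + t * x) \<partial>lborel)"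
      unfolding frac_int_def using t by (intro lborel_integral_real_affine) auto
    also have "(\<lambda>x. frac_kernel b (t - (0 + t * x)) * f (0 + t * x)) = (\<lambda>x. t powr (b - 1) * g t x)"
    proof
      fix x
      have "t - t * x = t * (1 - x)" by (simp add: algebra_simps)
      then have "frac_kernel b (t - t * x) = t powr (b - 1) * frac_kernel b (1 - x)"
        using t by (auto simp: frac_kernel_def omega_def powr_mult zero_less_mult_iff)
      moreover have "f (t * x) = indicator {0..} x * f (t * x)"
        using zero[of "t * x"] t by (auto simp: indicator_def mult_less_0_iff)
      ultimately show "frac_kernel b (t - (0 + t * x)) * f (0 + t * x) = t powr (b - 1) * g t x"
        by (simp add: g_def)
    qed
    finally show ?thesis using t powr_mult_base[of t "b - 1"] by simp
  qed
  have "continuous_on {0..R} (\<lambda>t. \<integral>x. g t x \<partial>lborel)" if R: "0 \<le> R" for R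
  proof -
    have "compact (f ` {0..R})"
      by (intro compact_continuous_image continuous_on_subset[OF cont]) auto
    then obtain B where B: "\<And>s. s \<in> {0..R} \<Longrightarrow> \<bar>f s\<bar> \<le> B"
      using compact_imp_bounded bounded_iff by (metis imageI real_norm_def)
    have B0: "0 \<le> B" using B[of 0] R by fastforce
    show ?thesis
      unfolding continuous_on_sequentially
    proof (intro allI ballI impI)
      fix t u assume t: "t \<in> {0..R}" and u: "(\<forall>n. u n \<in> {0..R}) \<and> u \<longlonglongrightarrow> t"
      have "(\<lambda>n. \<integral>x. g (u n) x \<partial>lborel) \<longlonglongrightarrow> (\<integral>x. g t x \<partial>lborel)"
      proof (rule integral_dominated_convergence[where w = "\<lambda>x. B * (frac_kernel b (1 - x) * frac_kernel 1 x)"])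
        show "integrable lborel (\<lambda>x. B * (frac_kernel b (1 - x) * frac_kernel 1 x))"
          using frac_kernel_convolution[OF b zero_less_one, of 1 0]
          by (simp add: has_bochner_integral_iff)
        show "AE x in lborel. (\<lambda>n. g (u n) x) \<longlonglongrightarrow> g t x"
        proof (intro AE_I2)
          fix x
          have "(\<lambda>n. f (u n * x)) \<longlonglongrightarrow> f (t * x)" if "0 \<le> x"
            using u t that by (intro continuous_on_tendsto_compose[OF cont] tendsto_intros) auto
          then show "(\<lambda>n. g (u n) x) \<longlonglongrightarrow> g t x"
            unfolding g_def by (cases "0 \<le> x") (auto intro!: tendsto_intros)
        qed
        show "AE x in lborel. norm (g (u n) x) \<le> B * (frac_kernel b (1 - x) * frac_kernel 1 x)" for n
        proof -
          have "AE x in lborel. x \<noteq> (0::real)" by (rule AE_lborel_singleton)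
          then show ?thesis
          proof eventually_elim
            case (elim x)
            show ?case
            proof (cases "0 < x \<and> x < 1")
              case True
              have "0 \<le> u n" "u n \<le> R" using u by auto
              with True have "u n * x \<le> R" "0 \<le> u n * x"
                using mult_left_mono[of x 1 "u n"] by auto
              then have "\<bar>f (u n * x)\<bar> \<le> B" by (intro B) auto
              from mult_left_mono[OF this frac_kernel_nonneg[OF b, of "1 - x"]] show ?thesis
                using True frac_kernel_nonneg[OF b, of "1 - x"]
                by (simp add: g_def abs_mult mult_ac frac_kernel_def[of 1] omega_def)
            qed (use elim in \<open>auto simp: g_def frac_kernel_def indicator_def\<close>)
          qed
        qed
      qed (unfold g_def, measurable)
      then show "((\<lambda>t. \<integral>x. g t x \<partial>lborel) \<circ> u) \<longlonglongrightarrow> (\<integral>x. g t x \<partial>lborel)"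
        by (simp add: o_def)
    qed
  qed
  then have "continuous_on {0..R} (frac_int b f)" if "0 \<le> R" for R
    using that b by (subst continuous_on_cong[OF refl eq]) (auto intro!: continuous_on_mult continuous_on_powr' continuous_on_const continuous_on_id)
  then show ?thesis by (intro continuous_on_atLeast_if_Icc) auto
qed

lemma frac_int_one_eq_integral:
  assumes zero: "\<And>s. s \<le> 0 \<Longrightarrow> f s = 0" and f: "set_integrable lborel {0..T} f" and t: "0 \<le> t" "t \<le> T"
  shows "frac_int 1 f t = integral {0..t} f"
proof -
  have "frac_int 1 f t = (LBINT s:{0..t}. f s)"
    unfolding frac_int_def set_lebesgue_integral_def
  proof (rule integral_cong_AE)
    have ae: "AE s in lborel. s \<noteq> t" by (rule AE_lborel_singleton)
    have "frac_kernel 1 (t - s) * f s = indicator {0..t} s *\<^sub>R f s" if "s \<noteq> t" for s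
      using zero[of s] that by (auto simp: frac_kernel_def omega_def indicator_def)
    with ae show "AE s in lborel. frac_kernel 1 (t - s) * f s = indicator {0..t} s *\<^sub>R f s"
      by (auto elim: eventually_mono)
    have "set_integrable lborel {0..t} f"
      by (rule set_integrable_subset[OF f]) (use t in auto)
    then show m: "(\<lambda>s. indicator {0..t} s *\<^sub>R f s) \<in> borel_measurable lborel"
      unfolding set_integrable_def by (rule borel_measurable_integrable)
    have eq: "frac_kernel 1 (t - s) * f s = (if s < t then indicator {0..t} s *\<^sub>R f s else 0)" for s
      using zero[of s] by (auto simp: frac_kernel_def omega_def indicator_def)
    show "(\<lambda>s. frac_kernel 1 (t - s) * f s) \<in> borel_measurable lborel"
      unfolding eq using m by measurable
  qed
  also have "\<dots> = integral {0..t} f"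
    by (rule set_borel_integral_eq_integral(2)[OF set_integrable_subset[OF f]]) (use t in auto)
  finally show ?thesis .
qed

lemma frac_int_one_deriv:
  assumes zero: "\<And>s. s \<le> 0 \<Longrightarrow> f s = 0" and f: "set_integrable lborel {0..T} f" and t: "0 < t" "t < T"
    and cont: "isCont f t"
  shows "(frac_int 1 f has_real_derivative f t) (at t)"
proof -
  have "f integrable_on {0..T}" by (rule set_borel_integral_eq_integral(1)[OF f])
  then have "((\<lambda>u. integral {0..u} f) has_vector_derivative f t) (at t within {0..T})"
    using t integral_has_vector_derivative_continuous_at[of f 0 T t "{}"] cont
    by (auto intro: continuous_at_imp_continuous_at_within)
  then have "((\<lambda>u. integral {0..u} f) has_vector_derivative f t) (at t within {0<..<T})"
    by (rule has_vector_derivative_within_subset) auto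
  then have "((\<lambda>u. integral {0..u} f) has_real_derivative f t) (at t)"
    using t at_within_open[of t "{0<..<T}"] by (simp add: has_real_derivative_iff_has_vector_derivative)
  then show ?thesis
  proof (rule has_field_derivative_transform_within_open)
    show "integral {0..u} f = frac_int 1 f u" if "u \<in> {0<..<T}" for u
      using frac_int_one_eq_integral[OF zero f, of u] that by simp
  qed (use t in auto)
qed

lemma frac_int_one_continuous:
  assumes zero: "\<And>s. s \<le> 0 \<Longrightarrow> f s = 0" and f: "set_integrable lborel {0..T} f"
  shows "continuous_on {0..T} (frac_int 1 f)"
proof -
  have "f integrable_on {0..T}" by (rule set_borel_integral_eq_integral(1)[OF f])
  then have "continuous_on {0..T} (\<lambda>u. integral {0..u} f)"
    by (rule indefinite_integral_continuous_1)
  then show ?thesis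
    using frac_int_one_eq_integral[OF zero f] by (subst continuous_on_cong[OF refl]) auto
qed

text \<open>Lerch's theorem. With \<open>x = exp (- t)\<close>, the transforms at integer points are
  moments of the continuous function \<open>g x = x * f (- ln x)\<close> on [0,1]. All moments vanish, so
  \<open>g\<close> is orthogonal to all polynomials, and by the Weierstrass theorem to itself.\<close>

lemma laplace_unique:
  fixes f :: "real \<Rightarrow> real"
  assumes cont: "continuous_on {0..} f" and zero: "\<And>t. t < 0 \<Longrightarrow> f t = 0"
    and lim: "((\<lambda>t. exp (- t) * f t) \<longlongrightarrow> 0) at_top"
    and lap: "\<And>p. 0 < p \<Longrightarrow> has_bochner_integral lborel (\<lambda>t. exp (- p * t) * f t) 0"
    and t: "0 \<le> t"
  shows "f t = 0"
proof -
  \<comment> \<open>The growth hypothesis makes this continuous at 0.\<close>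
  define g where "g = (\<lambda>x. if x = 0 then 0 else x * f (- ln x))"
  have g_exp: "g (exp (- t)) = exp (- t) * f t" for t by (simp add: g_def)
  have "continuous_on {0..1} g"
  proof (subst continuous_on_eq_continuous_within, intro ballI)
    fix x :: real assume x: "x \<in> {0..1}"
    show "continuous (at x within {0..1}) g"
    proof (cases "x = 0")
      case True
      have "LIM x at_right (0::real). - ln x :> at_top"
        using ln_at_0 by (simp add: filterlim_uminus_at_top)
      from filterlim_compose[OF lim this]
      have "((\<lambda>x. exp (- (- ln x)) * f (- ln x)) \<longlongrightarrow> 0) (at_right 0)" .
      moreover have "\<forall>\<^sub>F x in at_right 0. exp (- (- ln x)) * f (- ln x) = g x"
        using eventually_at_right_less[of 0] by eventually_elim (simp add: g_def)
      ultimately have "(g \<longlongrightarrow> 0) (at_right 0)"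
        by (rule Lim_transform_eventually)
      moreover have "at (0::real) within {0..1} = at_right 0"
        by (simp add: at_within_Icc_at_right)
      ultimately show ?thesis using True by (simp add: continuous_within g_def)
    next
      case False
      then have x0: "0 < x" "x \<le> 1" using x by auto
      have "continuous_on {0<..1} (\<lambda>x. x * f (- ln x))"
        by (intro continuous_intros continuous_on_compose2[OF cont]) auto
      then have "continuous_on {0<..1} g"
        by (subst continuous_on_cong[OF refl]) (auto simp: g_def)
      then have "continuous (at x within {0<..1}) g"
        using x0 by (auto simp: continuous_on_eq_continuous_within)
      moreover have "at x within {0<..1} = at x within {0..1}"
        by (rule at_within_nhd[of _ "{0<..}"]) (use x0 in auto)
      ultimately show ?thesis by simp
    qed
  qed
  note contg = this
  \<comment> \<open>Of the two factors \<open>exp (- t)\<close>, one is the Jacobian and the other is the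
    factor \<open>x\<close> of \<open>g\<close>.\<close>
  have int2: "integrable lborel (\<lambda>t. exp (- 2 * t) * f t)"
    using lap[of 2] by (simp add: has_bochner_integral_iff)
  define J where "J = (\<integral>t. \<bar>exp (- 2 * t) * f t\<bar> \<partial>lborel)"
  have J0: "0 \<le> J" unfolding J_def by simp
  have g_int: "integrable lborel (\<lambda>t. exp (- 2 * t) * f t * g (exp (- t)))"
    and sq_le: "(\<integral>t. exp (- 2 * t) * f t * g (exp (- t)) \<partial>lborel) \<le> e * J" if e: "0 < e" for e
  proof -
    obtain P where P: "real_polynomial_function P" "\<And>x. x \<in> {0..1} \<Longrightarrow> \<bar>g x - P x\<bar> < e"
      using Stone_Weierstrass_real_polynomial_function[OF compact_Icc contg e] by blast
    obtain a n where Pa: "P = (\<lambda>x. \<Sum>i\<le>n. a i * x ^ i)"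
      using P(1) real_polynomial_function_iff_sum by blast
    have "has_bochner_integral lborel (\<lambda>t. \<Sum>i\<le>n. a i * (exp (- (2 + real i) * t) * f t)) (\<Sum>i\<le>n. a i * 0)"
      by (intro has_bochner_integral_sum has_bochner_integral_mult_right lap) auto
    moreover have "exp (- 2 * t) * f t * P (exp (- t)) = (\<Sum>i\<le>n. a i * (exp (- (2 + real i) * t) * f t))" for t
      by (simp add: Pa sum_distrib_left exp_of_nat_mult[symmetric] exp_add[symmetric] algebra_simps flip: exp_add)
    ultimately have Pint: "has_bochner_integral lborel (\<lambda>t. exp (- 2 * t) * f t * P (exp (- t))) 0"
      by simp
    from Pint have Pint1: "integrable lborel (\<lambda>t. exp (- 2 * t) * f t * P (exp (- t)))"
      and Pint2: "(\<integral>t. exp (- 2 * t) * f t * P (exp (- t)) \<partial>lborel) = 0"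
      unfolding has_bochner_integral_iff by blast+
    have diff: "\<bar>exp (- 2 * t) * f t * (g (exp (- t)) - P (exp (- t)))\<bar> \<le> e * \<bar>exp (- 2 * t) * f t\<bar>" for t
    proof (cases "t < 0")
      case False
      then have "\<bar>g (exp (- t)) - P (exp (- t))\<bar> \<le> e" by (intro less_imp_le P) auto
      from mult_left_mono[OF this, of "\<bar>exp (- 2 * t) * f t\<bar>"] show ?thesis
        by (simp add: abs_mult mult_ac)
    qed (simp add: zero)
    have fm [measurable]: "f \<in> borel_measurable borel"
    proof -
      have "(\<lambda>t. exp (2 * t) * (exp (- 2 * t) * f t)) \<in> borel_measurable borel"
        using borel_measurable_integrable[OF int2] by measurable
      then show ?thesis by (simp flip: mult.assoc exp_add)
    qed
    have gm: "(\<lambda>t. g (exp (- t))) \<in> borel_measurable borel"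
      unfolding g_exp by measurable
    have dint: "integrable lborel (\<lambda>t. exp (- 2 * t) * f t * (g (exp (- t)) - P (exp (- t))))"
    proof (rule Bochner_Integration.integrable_bound[of _ "\<lambda>t. e * \<bar>exp (- 2 * t) * f t\<bar>"])
      show "integrable lborel (\<lambda>t. e * \<bar>exp (- 2 * t) * f t\<bar>)"
        using int2 by (intro integrable_mult_right integrable_abs)
      show "(\<lambda>t. exp (- 2 * t) * f t * (g (exp (- t)) - P (exp (- t)))) \<in> borel_measurable lborel"
        using gm unfolding Pa by measurable
    qed (use diff e in \<open>auto simp: abs_mult\<close>)
    have split: "exp (- 2 * t) * f t * g (exp (- t)) =
       exp (- 2 * t) * f t * (g (exp (- t)) - P (exp (- t))) + exp (- 2 * t) * f t * P (exp (- t))" for t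
      by (simp add: algebra_simps)
    show "integrable lborel (\<lambda>t. exp (- 2 * t) * f t * g (exp (- t)))"
      unfolding split using dint Pint1 by (intro Bochner_Integration.integrable_add)
    have "(\<integral>t. exp (- 2 * t) * f t * g (exp (- t)) \<partial>lborel) =
      (\<integral>t. exp (- 2 * t) * f t * (g (exp (- t)) - P (exp (- t))) \<partial>lborel)"
      unfolding split using dint Pint1 Pint2 by (subst Bochner_Integration.integral_add) auto
    also have "\<dots> \<le> (\<integral>t. e * \<bar>exp (- 2 * t) * f t\<bar> \<partial>lborel)"
      using dint int2 diff by (intro integral_mono integrable_mult_right integrable_abs) (auto intro: order_trans[OF abs_ge_self])
    also have "\<dots> = e * J" by (simp add: J_def)
    finally show "(\<integral>t. exp (- 2 * t) * f t * g (exp (- t)) \<partial>lborel) \<le> e * J" .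
  qed
  have sq: "exp (- 2 * t) * f t * g (exp (- t)) = exp (- 3 * t) * (f t)\<^sup>2" for t
  proof -
    have "exp (- 3 * t) = exp (- 2 * t) * exp (- t)" by (simp flip: exp_add)
    then show ?thesis by (simp add: g_exp power2_eq_square)
  qed
  define I where "I = (\<integral>t. exp (- 3 * t) * (f t)\<^sup>2 \<partial>lborel)"
  have I_int: "integrable lborel (\<lambda>t. exp (- 3 * t) * (f t)\<^sup>2)"
    using g_int[OF zero_less_one] unfolding sq .
  have "I \<le> 0"
  proof (rule field_le_epsilon)
    fix e :: real assume "0 < e"
    then have "I \<le> e / (J + 1) * J"
      using sq_le[of "e / (J + 1)"] J0 unfolding sq I_def by simp
    also have "\<dots> \<le> 0 + e" using J0 \<open>0 < e\<close> by (simp add: field_simps)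
    finally show "I \<le> 0 + e" .
  qed
  define R where "R = t + 1"
  have set_int: "set_integrable lborel {0..R} (\<lambda>t. exp (- 3 * t) * (f t)\<^sup>2)"
    unfolding set_integrable_def using I_int by (intro integrable_mult_indicator) auto
  have "integral {0..R} (\<lambda>t. exp (- 3 * t) * (f t)\<^sup>2) = (LBINT t:{0..R}. exp (- 3 * t) * (f t)\<^sup>2)"
    using set_borel_integral_eq_integral(2)[OF set_int] by simp
  also have "\<dots> \<le> I"
    unfolding I_def set_lebesgue_integral_def
    using I_int set_int unfolding set_integrable_def by (intro integral_mono) (auto simp: indicator_def)
  finally have le0: "integral {0..R} (\<lambda>t. exp (- 3 * t) * (f t)\<^sup>2) \<le> 0" using \<open>I \<le> 0\<close> by simp
  have c: "continuous_on {0..R} (\<lambda>t. exp (- 3 * t) * (f t)\<^sup>2)"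
    by (intro continuous_intros continuous_on_subset[OF cont]) auto
  have "0 \<le> integral {0..R} (\<lambda>t. exp (- 3 * t) * (f t)\<^sup>2)"
    by (intro integral_nonneg integrable_continuous_real c) auto
  with le0 have "integral (cbox 0 R) (\<lambda>t. exp (- 3 * t) * (f t)\<^sup>2) = 0" by simp
  then have "\<forall>t\<in>cbox 0 R. exp (- 3 * t) * (f t)\<^sup>2 = 0"
    using c t by (subst (asm) integral_cbox_eq_0_iff) (auto simp: R_def)
  then show ?thesis using t by (auto simp: R_def)
qed

section \<open>Cauchy's theorem on a sector\<close>

text \<open>The sector \<open>0 \<le> Arg z \<le> \<theta>\<close>, for \<open>\<theta> < pi\<close>, as
  an intersection of two half planes, from which convexity is evident.\<close>

definition sector :: "real \<Rightarrow> complex set" where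
  "sector \<theta> = {z. 0 \<le> Im z \<and> 0 \<le> Im (cis \<theta> * cnj z)}"

lemma convex_sector: "convex (sector \<theta>)"
proof -
  have "sector \<theta> = {z. inner \<i> z \<ge> 0} \<inter> {z. inner (Complex (sin \<theta>) (- cos \<theta>)) z \<ge> 0}"
    by (auto simp: sector_def inner_complex_def)
  then show ?thesis by (metis convex_Int convex_halfspace_ge)
qed

lemma rcis_in_sector:
  assumes "0 \<le> r" "0 \<le> \<psi>" "\<psi> \<le> \<theta>" "\<theta> < pi"
  shows "rcis r \<psi> \<in> sector \<theta>"
proof -
  have "cis \<theta> * cnj (rcis r \<psi>) = rcis r (\<theta> - \<psi>)"
    by (simp add: rcis_def cis_cnj cis_mult)
  then have "Im (cis \<theta> * cnj (rcis r \<psi>)) = r * sin (\<theta> - \<psi>)" by (simp only: Im_rcis)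
  moreover have "0 \<le> r * sin (\<theta> - \<psi>)" "0 \<le> r * sin \<psi>"
    using assms by (auto intro!: mult_nonneg_nonneg sin_ge_zero)
  ultimately show ?thesis unfolding sector_def by simp
qed

lemma in_sectorE:
  assumes z: "z \<in> sector \<theta>" "z \<noteq> 0" and \<theta>: "0 < \<theta>" "\<theta> < pi"
  obtains "0 \<le> Arg z" "Arg z \<le> \<theta>" "z = rcis (norm z) (Arg z)"
proof -
  have 1: "0 \<le> Arg z" using z by (simp add: Arg_less_0 sector_def)
  have 2: "z = rcis (norm z) (Arg z)" by (simp add: Arg_eq rcis_def cis_conv_exp z)
  have "cis \<theta> * cnj z = rcis (norm z) (\<theta> - Arg z)"
    by (subst 2) (simp add: rcis_def cis_cnj cis_mult)
  then have "Im (cis \<theta> * cnj z) = norm z * sin (\<theta> - Arg z)" by (simp only: Im_rcis)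
  moreover have "0 \<le> Im (cis \<theta> * cnj z)" using z unfolding sector_def by blast
  ultimately have s: "0 \<le> sin (\<theta> - Arg z)" using z(2) by (simp add: zero_le_mult_iff)
  have "Arg z \<le> \<theta>"
  proof (rule ccontr)
    assume "\<not> Arg z \<le> \<theta>"
    then have "0 < sin (Arg z - \<theta>)" using \<theta> Arg_le_pi[of z] by (intro sin_gt_zero) auto
    then show False using s sin_minus[of "\<theta> - Arg z"] by simp
  qed
  from 1 this 2 show ?thesis by (rule that)
qed

lemma zero_notin_interior_sector: "0 \<notin> interior (sector \<theta>)"
proof
  assume "0 \<in> interior (sector \<theta>)"
  then obtain e where e: "0 < e" "ball 0 e \<subseteq> sector \<theta>" by (meson mem_interior)
  then have "Complex 0 (- e / 2) \<in> sector \<theta>" by (intro subsetD[OF e(2)]) (simp add: cmod_def)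
  then show False using e by (simp add: sector_def)
qed

text \<open>Cauchy's theorem on the boundary of a circular sector: the arc vanishes in the limit, the
  real side contributes a real number, hence the imaginary part of the integral along the other side tends
  to zero. One point \<open>p\<close> of the real axis is exempt, since the function used later has a
  removable singularity there.\<close>

lemma sector_ray_limit:
  fixes p :: real and F :: "complex \<Rightarrow> complex"
  assumes \<theta>: "0 < \<theta>" "\<theta> < pi"
    and cont: "continuous_on (sector \<theta>) F" and "open O'" "sector \<theta> - {0} \<subseteq> O'" and hol: "F holomorphic_on O'"
    and real: "\<And>x. 0 \<le> x \<Longrightarrow> x \<noteq> p \<Longrightarrow> Im (F (of_real x)) = 0"
    and lim: "(M \<longlongrightarrow> 0) at_top"
    and bound: "\<And>R z. R0 < R \<Longrightarrow> z \<in> sector \<theta> \<Longrightarrow> norm z = R \<Longrightarrow> norm (F z) * R \<le> M R"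
  shows "((\<lambda>R. Im (integral {0..R} (\<lambda>r. F (rcis r \<theta>) * cis \<theta>))) \<longlongrightarrow> 0) at_top"
proof -
  have le: "\<bar>Im (integral {0..R} (\<lambda>r. F (rcis r \<theta>) * cis \<theta>))\<bar> \<le> M R * \<theta>" if R: "0 < R" "R0 < R" for R
  proof -
    define g1 where "g1 = linepath 0 (of_real R :: complex)"
    define g2 where "g2 = part_circlepath 0 R 0 \<theta>"
    define g3 where "g3 = linepath (rcis R \<theta>) 0"
    have ends: "pathfinish g1 = pathstart g2" "pathfinish g2 = pathstart g3"
      by (auto simp: g1_def g2_def g3_def rcis_def cis_conv_exp)
    have sub1: "path_image g1 \<subseteq> sector \<theta>"
      unfolding g1_def path_image_linepath
      using rcis_in_sector[of R 0 \<theta>] rcis_in_sector[of 0 0 \<theta>] \<theta> R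
      by (intro closed_segment_subset convex_sector) auto
    have sub3: "path_image g3 \<subseteq> sector \<theta>"
      unfolding g3_def path_image_linepath
      using rcis_in_sector[of R \<theta> \<theta>] rcis_in_sector[of 0 0 \<theta>] \<theta> R
      by (intro closed_segment_subset convex_sector) auto
    have pi2: "path_image g2 = {z. \<exists>x\<in>{0..\<theta>}. z = rcis R x}"
      unfolding g2_def using \<theta>
      by (subst path_image_part_circlepath) (auto simp: rcis_def cis_conv_exp)
    have sub2: "path_image g2 \<subseteq> sector \<theta>"
      using \<theta> R by (auto simp: pi2 intro!: rcis_in_sector)
    have i1: "F contour_integrable_on g1"
      unfolding g1_def by (intro contour_integrable_continuous_linepath continuous_on_subset[OF cont])
        (use sub1 in \<open>simp add: g1_def\<close>)
    have i2: "F contour_integrable_on g2"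
      unfolding g2_def by (intro contour_integrable_continuous_part_circlepath continuous_on_subset[OF cont])
        (use sub2 in \<open>simp add: g2_def\<close>)
    have i3: "F contour_integrable_on g3"
      unfolding g3_def by (intro contour_integrable_continuous_linepath continuous_on_subset[OF cont])
        (use sub3 in \<open>simp add: g3_def\<close>)
    have vp: "valid_path g1" "valid_path g2" "valid_path g3"
      by (auto simp: g1_def g2_def g3_def)
    have "(F has_contour_integral 0) (g1 +++ (g2 +++ g3))"
    proof (rule Cauchy_theorem_convex[OF cont convex_sector, of "{}"])
      fix x assume "x \<in> interior (sector \<theta>) - {}"
      then have "x \<in> O'" using assms(5) interior_subset[of "sector \<theta>"] zero_notin_interior_sector by auto
      then show "F field_differentiable at x"
        using hol \<open>open O'\<close> holomorphic_on_imp_differentiable_at by blast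
    next
      show "valid_path (g1 +++ (g2 +++ g3))" using vp ends by (simp add: valid_path_join)
      show "path_image (g1 +++ (g2 +++ g3)) \<subseteq> sector \<theta>"
        using sub1 sub2 sub3 by (meson path_image_join_subset order_trans Un_least)
    qed (use vp ends sub1 sub2 sub3 in \<open>auto simp: valid_path_join path_image_join g1_def g3_def\<close>)
    then have "contour_integral g1 F + (contour_integral g2 F + contour_integral g3 F) = 0"
      using i1 i2 i3 vp ends by (simp add: contour_integral_unique contour_integral_join contour_integrable_joinI valid_path_join flip: contour_integral_join)
    moreover have "Im (contour_integral g1 F) = 0"
    proof -
      \<comment> \<open>The exempt point is a null set; the value 0 there makes the imaginary part vanish
        everywhere.\<close>
      define h where "h = (\<lambda>x. if x = p then 0 else F (of_real x))"
      have "contour_integral g1 F = integral {0..R} (\<lambda>x. F (of_real x))"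
        unfolding g1_def using R by (subst contour_integral_linepath_Reals_eq) auto
      also have "\<dots> = integral {0..R} h"
        by (rule integral_spike[of "{p}"]) (auto simp: h_def)
      finally have eq: "contour_integral g1 F = integral {0..R} h" .
      have "(\<lambda>x. F (of_real x)) integrable_on {0..R}"
        using i1 R unfolding g1_def by (subst (asm) contour_integrable_linepath_Reals_iff) auto
      then have "h integrable_on {0..R}"
        by (rule integrable_spike[of _ _ "{p}"]) (auto simp: h_def)
      then have "Im (integral {0..R} h) = integral {0..R} (\<lambda>x. Im (h x))"
        using integral_linear[OF _ bounded_linear_Im, of h "{0..R}"] by (simp add: o_def)
      also have "\<dots> = integral {0..R} (\<lambda>x. 0)"
        by (intro integral_cong) (auto simp: h_def real)
      finally show ?thesis using eq by simp
    qed
    moreover have "contour_integral g3 F = - integral {0..R} (\<lambda>r. F (rcis r \<theta>) * cis \<theta>)"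
    proof -
      have "contour_integral g3 F = - contour_integral (linepath 0 (rcis R \<theta>)) F"
        using contour_integral_reversepath[of "linepath 0 (rcis R \<theta>)" F] by (simp add: g3_def)
      also have "contour_integral (linepath 0 (rcis R \<theta>)) F = integral {0..1} (\<lambda>x. F (linepath 0 (rcis R \<theta>) x) * rcis R \<theta>)"
        by (simp add: contour_integral_integral)
      also have "\<dots> = integral {0..1} (\<lambda>x. R *\<^sub>R (F (rcis (R * x) \<theta>) * cis \<theta>))"
        by (intro integral_cong) (auto simp: linepath_def rcis_def scaleR_conv_of_real mult_ac)
      also have "\<dots> = integral {0..R} (\<lambda>r. F (rcis r \<theta>) * cis \<theta>)"
      proof -
        have "(\<lambda>r. F (rcis r \<theta>) * cis \<theta>) integrable_on {0..R}"
        proof (intro integrable_continuous_interval continuous_intros)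
          show "continuous_on {0..R} (\<lambda>r. F (rcis r \<theta>))"
          proof (rule continuous_on_compose2[OF cont])
            show "continuous_on {0..R} (\<lambda>r. rcis r \<theta>)" unfolding rcis_def by (intro continuous_intros)
          qed (use \<theta> in \<open>auto intro!: rcis_in_sector\<close>)
        qed
        then have hi: "((\<lambda>r. F (rcis r \<theta>) * cis \<theta>) has_integral integral {0..R} (\<lambda>r. F (rcis r \<theta>) * cis \<theta>)) (cbox 0 R)"
          unfolding cbox_interval by (rule integrable_integral)
        have "((\<lambda>x. F (rcis (R * x + 0) \<theta>) * cis \<theta>) has_integral (1 / \<bar>R\<bar>) *\<^sub>R integral {0..R} (\<lambda>r. F (rcis r \<theta>) * cis \<theta>))
            ((\<lambda>x. (1 / R) *\<^sub>R x + - ((1 / R) *\<^sub>R 0)) ` cbox 0 R)"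
          using has_integral_affinity[OF hi, of R 0] R by simp
        moreover have "(\<lambda>x. (1 / R) *\<^sub>R x + - ((1 / R) *\<^sub>R 0)) ` cbox 0 R = {0..1}"
          using R by (auto simp: image_affinity_cbox)
        ultimately have "((\<lambda>x. F (rcis (R * x) \<theta>) * cis \<theta>) has_integral (1 / R) *\<^sub>R integral {0..R} (\<lambda>r. F (rcis r \<theta>) * cis \<theta>)) {0..1}"
          using R by simp
        from has_integral_cmul[OF this, of R] R
        have "((\<lambda>x. R *\<^sub>R (F (rcis (R * x) \<theta>) * cis \<theta>)) has_integral integral {0..R} (\<lambda>r. F (rcis r \<theta>) * cis \<theta>)) {0..1}"
          by (simp only: scaleR_scaleR) simp
        then show ?thesis by (rule integral_unique)
      qed
      finally show ?thesis .
    qed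
    ultimately have "Im (integral {0..R} (\<lambda>r. F (rcis r \<theta>) * cis \<theta>)) = Im (contour_integral g2 F)"
      by (simp add: complex_eq_iff)
    also have "\<bar>\<dots>\<bar> \<le> norm (contour_integral g2 F)" by (rule abs_Im_le_cmod)
    also have "\<dots> \<le> M R / R * R * \<bar>\<theta> - 0\<bar>"
      unfolding g2_def
    proof (rule contour_integral_bound_part_circlepath)
      show "F contour_integrable_on part_circlepath 0 R 0 \<theta>" using i2 by (simp add: g2_def)
      have "norm (F z) \<le> M R / R" if "z \<in> path_image g2" for z
        using bound[of R z] that R sub2 by (auto simp: pi2 field_simps)
      then show "\<And>x. x \<in> path_image (part_circlepath 0 R 0 \<theta>) \<Longrightarrow> cmod (F x) \<le> M R / R"
        by (simp add: g2_def)
      have "rcis R 0 \<in> sector \<theta>" using R \<theta> by (intro rcis_in_sector) auto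
      then have "norm (F (rcis R 0)) * R \<le> M R" using R by (intro bound) auto
      then have "0 \<le> M R" using R by (meson mult_nonneg_nonneg norm_ge_zero order_trans less_imp_le)
      then show "0 \<le> M R / R" using R by simp
    qed (use R in auto)
    finally show ?thesis using R \<theta> by simp
  qed
  show ?thesis
  proof (rule Lim_null_comparison)
    show "\<forall>\<^sub>F R in at_top. norm (Im (integral {0..R} (\<lambda>r. F (rcis r \<theta>) * cis \<theta>))) \<le> M R * \<theta>"
      using eventually_gt_at_top[of "max 0 R0"] by eventually_elim (unfold real_norm_def, rule le, auto)
    show "((\<lambda>R. M R * \<theta>) \<longlongrightarrow> 0) at_top" using tendsto_mult[OF lim tendsto_const[of \<theta>]] by simp
  qed
qed

text \<open>The integrand is \<open>1 / (p + z) + 1 / (p - z)\<close>, with the primitive \<open>Ln (p +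
  z) - Ln (p - z)\<close>; along the ray the difference of the arguments tends to \<open>\<theta> -
  (\<theta> - pi)\<close>.\<close>

lemma ray_log_limit:
  fixes p :: real
  assumes \<theta>: "0 < \<theta>" "\<theta> < pi" and p: "0 < p"
  shows "((\<lambda>R. Im (integral {0..R} (\<lambda>r. 2 * p / ((p + rcis r \<theta>) * (p - rcis r \<theta>)) * cis \<theta>))) \<longlongrightarrow> pi) at_top"
proof -
  define L where "L = (\<lambda>r. Ln (p + rcis r \<theta>) - Ln (p - rcis r \<theta>))"
  have s: "0 < sin \<theta>" using \<theta> by (simp add: sin_gt_zero)
  have cut: "p + rcis r \<theta> \<notin> \<real>\<^sub>\<le>\<^sub>0" "p - rcis r \<theta> \<notin> \<real>\<^sub>\<le>\<^sub>0" if "0 \<le> r" for r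
  proof -
    show "p + rcis r \<theta> \<notin> \<real>\<^sub>\<le>\<^sub>0" using s p that by (cases "r = 0") (auto simp: complex_nonpos_Reals_iff)
    show "p - rcis r \<theta> \<notin> \<real>\<^sub>\<le>\<^sub>0" using s p that by (cases "r = 0") (auto simp: complex_nonpos_Reals_iff)
  qed
  have eq: "integral {0..R} (\<lambda>r. 2 * p / ((p + rcis r \<theta>) * (p - rcis r \<theta>)) * cis \<theta>) = L R" if R: "0 \<le> R" for R
  proof -
    have "((\<lambda>r. 2 * p / ((p + rcis r \<theta>) * (p - rcis r \<theta>)) * cis \<theta>) has_integral (L R - L 0)) {0..R}"
    proof (rule fundamental_theorem_of_calculus[OF R])
      fix r assume r: "r \<in> {0..R}"
      then have nz: "p + rcis r \<theta> \<noteq> 0" "p - rcis r \<theta> \<noteq> 0" using cut[of r] by auto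
      have r1: "((\<lambda>r. p + rcis r \<theta>) has_vector_derivative cis \<theta>) (at r within {0..R})"
        unfolding rcis_def by (auto intro!: derivative_eq_intros simp: has_vector_derivative_def scaleR_conv_of_real)
      have r2: "((\<lambda>r. p - rcis r \<theta>) has_vector_derivative - cis \<theta>) (at r within {0..R})"
        unfolding rcis_def by (auto intro!: derivative_eq_intros simp: has_vector_derivative_def scaleR_conv_of_real)
      have "((Ln \<circ> (\<lambda>r. p + rcis r \<theta>)) has_vector_derivative cis \<theta> * inverse (p + rcis r \<theta>)) (at r within {0..R})"
        using r cut by (intro field_vector_diff_chain_within[OF r1] DERIV_subset[OF has_field_derivative_Ln subset_UNIV]) auto
      moreover have "((Ln \<circ> (\<lambda>r. p - rcis r \<theta>)) has_vector_derivative - cis \<theta> * inverse (p - rcis r \<theta>)) (at r within {0..R})"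
        using r cut by (intro field_vector_diff_chain_within[OF r2] DERIV_subset[OF has_field_derivative_Ln subset_UNIV]) auto
      ultimately have "(L has_vector_derivative cis \<theta> * inverse (p + rcis r \<theta>) - - cis \<theta> * inverse (p - rcis r \<theta>)) (at r within {0..R})"
        unfolding L_def o_def by (rule has_vector_derivative_diff)
      moreover have "cis \<theta> * inverse (p + rcis r \<theta>) - - cis \<theta> * inverse (p - rcis r \<theta>) = 2 * p / ((p + rcis r \<theta>) * (p - rcis r \<theta>)) * cis \<theta>"
        using nz by (simp add: field_simps)
      ultimately show "(L has_vector_derivative 2 * p / ((p + rcis r \<theta>) * (p - rcis r \<theta>)) * cis \<theta>) (at r within {0..R})"
        by simp
    qed
    then show ?thesis by (simp add: integral_unique L_def)
  qed
  have lim1: "((\<lambda>R. Arg (of_real (p / R) + cis \<theta>)) \<longlongrightarrow> Arg (of_real 0 + cis \<theta>)) at_top"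
    using s by (intro tendsto_intros) (auto simp: complex_nonpos_Reals_iff intro!: real_tendsto_divide_at_top filterlim_ident)
  have lim2: "((\<lambda>R. Arg (of_real (p / R) - cis \<theta>)) \<longlongrightarrow> Arg (of_real 0 - cis \<theta>)) at_top"
    using s by (intro tendsto_intros) (auto simp: complex_nonpos_Reals_iff intro!: real_tendsto_divide_at_top filterlim_ident)
  have A1: "Arg (cis \<theta>) = \<theta>" using \<theta> by (intro Arg_cis) auto
  have "- cis \<theta> = cis (\<theta> - pi)" by (simp add: cis_divide[symmetric])
  then have A2: "Arg (- cis \<theta>) = \<theta> - pi" using Arg_cis[of "\<theta> - pi"] \<theta> by simp
  have "((\<lambda>R. Arg (of_real (p / R) + cis \<theta>) - Arg (of_real (p / R) - cis \<theta>)) \<longlongrightarrow> pi) at_top"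
    using tendsto_diff[OF lim1 lim2] by (simp add: A1 A2)
  then show ?thesis
  proof (rule Lim_transform_eventually)
    show "\<forall>\<^sub>F R in at_top. Arg (of_real (p / R) + cis \<theta>) - Arg (of_real (p / R) - cis \<theta>) =
       Im (integral {0..R} (\<lambda>r. 2 * p / ((p + rcis r \<theta>) * (p - rcis r \<theta>)) * cis \<theta>))"
      using eventually_gt_at_top[of 0]
    proof eventually_elim
      case (elim R)
      have "of_real (p / R) + cis \<theta> = (p + rcis R \<theta>) / of_real R" "of_real (p / R) - cis \<theta> = (p - rcis R \<theta>) / of_real R"
        using elim by (auto simp: rcis_def field_simps)
      then have "Arg (of_real (p / R) + cis \<theta>) = Arg (p + rcis R \<theta>)" "Arg (of_real (p / R) - cis \<theta>) = Arg (p - rcis R \<theta>)"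
        using elim by (simp_all add: Arg_divide_of_real)
      moreover have "p + rcis R \<theta> \<noteq> 0" "p - rcis R \<theta> \<noteq> 0" using cut[of R] elim by auto
      ultimately show ?case using eq[of R] elim by (simp add: L_def Arg_eq_Im_Ln)
    qed
  qed
qed

text \<open>Cauchy's formula at a point of the boundary of the sector. By reflection in the real axis,
  the imaginary part is, up to a factor, the integral along both rays, which enclose \<open>p\<close>. The
  proof stays in the upper sector: it subtracts a multiple of an explicit function with the same value at
  \<open>p\<close>, which removes the pole, and evaluates the explicit function by
  \<open>ray_log_limit\<close>.\<close>

lemma sector_cauchy_integral:
  fixes p :: real and G :: "complex \<Rightarrow> complex"
  assumes \<theta>: "0 < \<theta>" "\<theta> < pi" and p: "0 < p"
    and cont: "continuous_on (sector \<theta>) G" and O': "open O'" "sector \<theta> - {0} \<subseteq> O'" and hol: "G holomorphic_on O'"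
    and bound: "\<And>z. z \<in> sector \<theta> \<Longrightarrow> z \<noteq> 0 \<Longrightarrow> norm (G z) \<le> B * norm z powr (- \<kappa>)" and \<kappa>: "0 < \<kappa>"
    and real: "\<And>x. 0 \<le> x \<Longrightarrow> Im (G (of_real x)) = 0"
    and int: "set_integrable lborel {0..} (\<lambda>r. G (rcis r \<theta>) * cis \<theta> / (p - rcis r \<theta>))"
  shows "Im (LBINT r:{0..}. G (rcis r \<theta>) * cis \<theta> / (p - rcis r \<theta>)) = pi * Re (G p)"
proof -
  \<comment> \<open>The subtracted function has the value \<open>G p\<close> at \<open>p\<close>, no pole
    in the sector, and decays at infinity.\<close>
  define Q where "Q = (\<lambda>z::complex. G z - G p * (2 * p / (p + z)))"
  define F where "F = (\<lambda>z::complex. if z = p then deriv Q p else (Q z - Q p) / (z - p))"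
  have Qp: "Q p = 0" using p by (simp add: Q_def flip: of_real_add)
  have ps: "complex_of_real p \<in> sector \<theta>" using rcis_in_sector[of p 0 \<theta>] \<theta> p by simp
  have np: "p + z \<noteq> 0" if "z \<in> sector \<theta>" for z :: complex
  proof
    assume "p + z = 0"
    then have "z = - of_real p" by (simp add: add_eq_0_iff)
    then have "- sin \<theta> * p \<ge> 0" using that by (simp add: sector_def)
    then show False using p sin_gt_zero[OF \<theta>] by (simp add: mult_le_0_iff)
  qed
  have sec_z: "rcis r \<theta> \<in> sector \<theta>" if "0 \<le> r" for r using that \<theta> by (intro rcis_in_sector) auto
  have zp: "rcis r \<theta> \<noteq> p" if "0 \<le> r" for r
  proof
    assume eq: "rcis r \<theta> = p"
    then have "r * sin \<theta> = 0" by (metis Im_rcis Im_complex_of_real)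
    then have "r = 0" using sin_gt_zero[OF \<theta>] by simp
    then show False using eq p by simp
  qed
  have "Q holomorphic_on (O' - {- of_real p})"
    unfolding Q_def by (intro holomorphic_intros holomorphic_on_subset[OF hol]) (auto simp: add_eq_0_iff)
  then have holF: "F holomorphic_on (O' - {- of_real p})"
    unfolding F_def using O'(1) by (intro pole_lemma_open) auto
  have sub: "sector \<theta> - {0} \<subseteq> O' - {- of_real p}" using O' np[of "- of_real p"] by auto
  have contF: "continuous_on (sector \<theta>) F"
  proof (subst continuous_on_eq_continuous_within, intro ballI)
    fix z assume z: "z \<in> sector \<theta>"
    show "continuous (at z within sector \<theta>) F"
    proof (cases "z = 0")
      case False
      then have "z \<in> O' - {- of_real p}" using z sub by auto
      moreover have "open (O' - {- of_real p})" using O'(1) by auto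
      ultimately have "isCont F z"
        using holF holomorphic_on_imp_continuous_on continuous_on_eq_continuous_at by blast
      then show ?thesis by (rule continuous_at_imp_continuous_at_within)
    next
      case True
      have "continuous_on (sector \<theta> - {of_real p}) (\<lambda>z. (Q z - Q p) / (z - p))"
        unfolding Q_def by (intro continuous_intros continuous_on_subset[OF cont]) (use np in auto)
      then have "continuous_on (sector \<theta> - {of_real p}) F"
        by (subst continuous_on_cong[OF refl]) (auto simp: F_def)
      then have "continuous (at z within (sector \<theta> - {of_real p})) F"
        using z True p by (auto simp: continuous_on_eq_continuous_within)
      moreover have "at z within (sector \<theta> - {of_real p}) = at z within sector \<theta>"
        by (rule at_within_nhd[of _ "- {of_real p}"]) (use True p in auto)
      ultimately show ?thesis by simp
    qed
  qed
  define M where "M = (\<lambda>R. 2 * (B * R powr (- \<kappa>) + norm (G p) * (4 * p / R)))"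
  have limM: "(M \<longlongrightarrow> 0) at_top"
  proof -
    have "((\<lambda>R. R powr (- \<kappa>)) \<longlongrightarrow> 0) at_top"
      using \<kappa> by (intro tendsto_neg_powr filterlim_ident) auto
    moreover have "((\<lambda>R. 4 * p / R) \<longlongrightarrow> 0) at_top"
      by (intro real_tendsto_divide_at_top[OF tendsto_const] filterlim_ident)
    ultimately have "(M \<longlongrightarrow> 2 * (B * 0 + norm (G p) * 0)) at_top"
      unfolding M_def by (intro tendsto_intros)
    then show ?thesis by simp
  qed
  have lim0: "((\<lambda>R. Im (integral {0..R} (\<lambda>r. F (rcis r \<theta>) * cis \<theta>))) \<longlongrightarrow> 0) at_top"
  proof (rule sector_ray_limit[OF \<theta> contF _ sub holF _ limM])
    show "open (O' - {- of_real p})" using O'(1) by auto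
    show "Im (F (of_real x)) = 0" if "0 \<le> x" "x \<noteq> p" for x
    proof -
      have "Im (Q (of_real x)) = 0" using real[of x] real[of p] that p
        by (simp add: Q_def Im_divide flip: of_real_add)
      then show ?thesis using that Qp by (simp add: F_def Im_divide)
    qed
    fix R :: real and z assume R: "2 * p < R" and z: "z \<in> sector \<theta>" "norm z = R"
    have n1: "R / 2 \<le> norm (z - p)" using norm_triangle_ineq2[of z p] z R p by simp
    have n2: "R / 2 \<le> norm (p + z)" using norm_diff_ineq[of z p] z R p by (simp add: add.commute)
    have z0: "z \<noteq> 0" "z \<noteq> p" using z R p by auto
    have "norm (2 * p / (p + z)) = 2 * p / norm (p + z)"
      using p by (simp add: norm_divide norm_mult)
    also have "\<dots> \<le> 2 * p / (R / 2)"
    proof (rule divide_left_mono[OF n2])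
      have "0 < norm (p + z)" using n2 R p by linarith
      then show "0 < norm (p + z) * (R / 2)" using R p by simp
    qed (use p in simp)
    finally have "norm (2 * p / (p + z)) \<le> 2 * p / (R / 2)" .
    then have "norm (G p * (2 * p / (p + z))) \<le> norm (G p) * (4 * p / R)"
      unfolding norm_mult by (intro mult_left_mono) auto
    then have "norm (Q z) \<le> B * R powr (- \<kappa>) + norm (G p) * (4 * p / R)"
      using norm_triangle_ineq4[of "G z" "G p * (2 * p / (p + z))"] bound[OF z(1) z0(1)] z by (simp add: Q_def)
    moreover have "norm (F z) * (R / 2) \<le> norm (Q z)"
    proof -
      have "norm (F z) * norm (z - p) = norm (Q z)" using z0 Qp by (simp add: F_def norm_divide)
      then show ?thesis using mult_left_mono[OF n1 norm_ge_zero[of "F z"]] by simp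
    qed
    ultimately show "norm (F z) * R \<le> M R" by (simp add: M_def)
  qed
  define g where "g = (\<lambda>r. G (rcis r \<theta>) * cis \<theta> / (p - rcis r \<theta>))"
  define l where "l = (\<lambda>r. 2 * p / ((p + rcis r \<theta>) * (p - rcis r \<theta>)) * cis \<theta>)"
  have contz: "continuous_on A (\<lambda>r. rcis r \<theta>)" for A unfolding rcis_def by (intro continuous_intros)
  have fin: "Im (integral {0..R} g) = Re (G p) * Im (integral {0..R} l) - Im (integral {0..R} (\<lambda>r. F (rcis r \<theta>) * cis \<theta>))" for R
  proof -
    have l_int: "l integrable_on {0..R}"
      unfolding l_def using np sec_z zp[THEN not_sym]
      by (intro integrable_continuous_interval continuous_intros contz) auto
    have F_int: "(\<lambda>r. F (rcis r \<theta>) * cis \<theta>) integrable_on {0..R}"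
      by (intro integrable_continuous_interval continuous_intros continuous_on_compose2[OF contF contz]) (use sec_z in auto)
    have "g r = G p * l r - F (rcis r \<theta>) * cis \<theta>" if "0 \<le> r" for r
    proof -
      have "p - rcis r \<theta> \<noteq> 0" "rcis r \<theta> - p \<noteq> 0" "p + rcis r \<theta> \<noteq> 0" using zp[OF that] np[OF sec_z[OF that]] by auto
      then show ?thesis using zp[OF that] Qp
        by (simp add: g_def l_def F_def Q_def divide_simps) (simp add: algebra_simps)
    qed
    then have "integral {0..R} g = integral {0..R} (\<lambda>r. G p * l r - F (rcis r \<theta>) * cis \<theta>)"
      by (intro integral_cong) auto
    also have "\<dots> = G p * integral {0..R} l - integral {0..R} (\<lambda>r. F (rcis r \<theta>) * cis \<theta>)"
      using l_int F_int by (subst Henstock_Kurzweil_Integration.integral_diff) (auto intro: integrable_on_mult_right)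
    finally show ?thesis using real[of p] p by simp
  qed
  have "((\<lambda>R. Im (integral {0..R} g)) \<longlongrightarrow> Re (G p) * pi - 0) at_top"
    unfolding fin by (intro tendsto_intros lim0) (use ray_log_limit[OF \<theta> p] in \<open>simp add: l_def\<close>)
  moreover have "((\<lambda>R. Im (integral {0..R} g)) \<longlongrightarrow> Im (LBINT r:{0..}. g r)) at_top"
  proof (rule tendsto_Im)
    have gint: "set_integrable lborel {0..} g" using int by (simp add: g_def)
    have "((\<lambda>R. LBINT r:{0..R}. g r) \<longlongrightarrow> (LBINT r:{0..}. g r)) at_top"
      by (rule tendsto_set_lebesgue_integral_at_top[OF _ gint]) auto
    moreover have "(LBINT r:{0..R}. g r) = integral {0..R} g" for R
      by (rule set_borel_integral_eq_integral(2)[OF set_integrable_subset[OF gint]]) auto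
    ultimately show "((\<lambda>R. integral {0..R} g) \<longlongrightarrow> (LBINT r:{0..}. g r)) at_top" by simp
  qed
  ultimately have "Re (G p) * pi - 0 = Im (LBINT r:{0..}. g r)"
    by (intro tendsto_unique[OF trivial_limit_at_top_linorder])
  then show ?thesis by (simp only: g_def diff_zero mult.commute)
qed

section \<open>Inverse Laplace transforms along rays\<close>

text \<open>Causality is part of the definition: fractional integrals then start at time 0, and the
  transform over the whole line is the one-sided transform.\<close>

definition has_laplace :: "(real \<Rightarrow> real) \<Rightarrow> (real \<Rightarrow> real) \<Rightarrow> bool" where
  "has_laplace f F \<longleftrightarrow> f \<in> borel_measurable borel \<and> (\<forall>t\<le>0. f t = 0) \<and>
     (\<forall>p>0. has_bochner_integral lborel (\<lambda>t. exp (- p * t) * f t) (F p))"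

lemma has_laplaceD:
  assumes "has_laplace f F"
  shows "f \<in> borel_measurable borel" "\<And>t. t \<le> 0 \<Longrightarrow> f t = 0"
    "\<And>p. 0 < p \<Longrightarrow> has_bochner_integral lborel (\<lambda>t. exp (- p * t) * f t) (F p)"
  using assms by (auto simp: has_laplace_def)

lemma has_laplace_frac_kernel: "0 < b \<Longrightarrow> has_laplace (frac_kernel b) (\<lambda>p. p powr (- b))"
  using laplace_frac_kernel by (auto simp: has_laplace_def frac_kernel_def)

lemma frac_int_nonpos:
  assumes "\<And>s. s \<le> 0 \<Longrightarrow> f s = 0" "t \<le> 0"
  shows "frac_int b f t = 0"
proof -
  have z: "frac_kernel b (t - s) * f s = 0" for s
    using assms(1)[of s] assms(2) by (auto simp: frac_kernel_def)
  show ?thesis unfolding frac_int_def z by simp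
qed

lemma has_laplace_frac_int:
  assumes "0 < b" "has_laplace f F"
  shows "has_laplace (frac_int b f) (\<lambda>p. p powr (- b) * F p)"
  using assms laplace_frac_int[OF _ assms(1)] has_laplaceD[OF assms(2)]
  by (auto simp: has_laplace_def intro!: frac_int_nonpos)

lemma has_laplace_add:
  assumes "has_laplace f F" "has_laplace g G"
  shows "has_laplace (\<lambda>t. f t + g t) (\<lambda>p. F p + G p)"
  using assms by (auto simp: has_laplace_def distrib_left intro!: has_bochner_integral_add)

lemma has_laplace_cmult:
  assumes "has_laplace f F"
  shows "has_laplace (\<lambda>t. c * f t) (\<lambda>p. c * F p)"
proof -
  have "has_bochner_integral lborel (\<lambda>t. exp (- p * t) * (c * f t)) (c * F p)" if "0 < p" for p
    using has_bochner_integral_mult_right[OF has_laplaceD(3)[OF assms that], of c] by (simp add: mult_ac)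
  then show ?thesis using assms by (auto simp: has_laplace_def)
qed

lemma has_laplace_diff:
  assumes "has_laplace f F" "has_laplace g G"
  shows "has_laplace (\<lambda>t. f t - g t) (\<lambda>p. F p - G p)"
  using has_laplace_add[OF assms(1) has_laplace_cmult[OF assms(2), of "-1"]] by simp

lemma has_laplace_set_integrable:
  assumes "has_laplace f F"
  shows "set_integrable lborel {0..T} f"
proof -
  note f = has_laplaceD[OF assms]
  show ?thesis unfolding set_integrable_def
  proof (rule Bochner_Integration.integrable_bound)
    show "integrable lborel (\<lambda>t. exp T * (exp (- 1 * t) * f t))"
      using f(3)[of 1] by (intro integrable_mult_right) (simp add: has_bochner_integral_iff)
    have "\<bar>f t\<bar> \<le> exp T * (exp (- t) * \<bar>f t\<bar>)" if "t \<le> T" for t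
    proof -
      have "1 \<le> exp (T - t)" using that by simp
      then have "1 * \<bar>f t\<bar> \<le> exp (T - t) * \<bar>f t\<bar>" by (intro mult_right_mono) auto
      then show ?thesis by (simp add: exp_diff exp_minus divide_inverse)
    qed
    then show "AE t in lborel. norm (indicator {0..T} t *\<^sub>R f t) \<le> norm (exp T * (exp (- 1 * t) * f t))"
      by (intro AE_I2) (auto simp: indicator_def abs_mult)
  qed (use f in measurable)
qed

text \<open>For orders at least 1 the kernel is bounded on bounded intervals, so local integrability of
  \<open>f\<close> is enough.\<close>

lemma has_laplace_kernel_integrable:
  assumes f: "has_laplace f F" and c: "1 \<le> c"
  shows "integrable lborel (\<lambda>s. frac_kernel c (t - s) * f s)"
proof (cases "0 < t")
  case False
  then have z: "frac_kernel c (t - s) * f s = 0" for s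
    using has_laplaceD(2)[OF f, of s] by (auto simp: frac_kernel_def)
  show ?thesis unfolding z by simp
next
  case True
  show ?thesis
  proof (rule Bochner_Integration.integrable_bound)
    show "integrable lborel (\<lambda>s. omega c t * (indicator {0..t} s *\<^sub>R f s))"
      using has_laplace_set_integrable[OF f, of t] unfolding set_integrable_def by (rule integrable_mult_right)
    show "(\<lambda>s. frac_kernel c (t - s) * f s) \<in> borel_measurable lborel"
      using has_laplaceD(1)[OF f] by measurable
    have "norm (frac_kernel c (t - s) * f s) \<le> norm (omega c t * (indicator {0..t} s *\<^sub>R f s))" for s
    proof (cases "0 < s \<and> s < t")
      case True
      have "0 < Gamma c" using c by (intro Gamma_real_pos) auto
      then have "\<bar>frac_kernel c (t - s)\<bar> \<le> \<bar>omega c t\<bar>"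
        using True c by (auto simp: frac_kernel_def omega_def intro!: divide_right_mono powr_mono2)
      then show ?thesis using True by (auto simp: abs_mult intro!: mult_right_mono)
    qed (use has_laplaceD(2)[OF f, of s] in \<open>auto simp: frac_kernel_def\<close>)
    then show "AE s in lborel. norm (frac_kernel c (t - s) * f s) \<le> norm (omega c t * (indicator {0..t} s *\<^sub>R f s))"
      by (intro AE_I2)
  qed
qed

lemma has_laplace_frac_int_semigroup:
  assumes "has_laplace f F" "0 < a" "0 < b" "1 \<le> a + b"
  shows "frac_int a (frac_int b f) = frac_int (a + b) f"
    and "integrable lborel (\<lambda>r. frac_kernel a (t - r) * frac_int b f r)"
  using frac_int_semigroup[OF assms(2,3) has_laplaceD(1)[OF assms(1)] has_laplace_kernel_integrable[OF assms(1,4)]]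
  by auto

lemma has_laplace_frac_int_continuous:
  assumes "has_laplace f F" "1 \<le> c"
  shows "continuous_on {0..} (frac_int c f)"
proof -
  have one: "continuous_on {0..} (frac_int 1 g)" if "has_laplace g G" for g G
    using frac_int_one_continuous[OF has_laplaceD(2)[OF that] has_laplace_set_integrable[OF that]]
    by (intro continuous_on_atLeast_if_Icc) auto
  show ?thesis
  proof (cases "c = 1")
    case False
    then have "frac_int c f = frac_int 1 (frac_int (c - 1) f)"
      using has_laplace_frac_int_semigroup(1)[OF assms(1), of 1 "c - 1"] assms(2) by auto
    then show ?thesis using one[OF has_laplace_frac_int[OF _ assms(1)], of "c - 1"] False assms(2) by auto
  qed (use one assms in auto)
qed

text \<open>The functions may be singular at 0. The integral of their difference is continuous on
  [0,\<infinity>) and grows at most like \<open>exp (t / 2)\<close>, so that \<open>laplace_unique\<close>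
  applies to it; differentiation recovers the functions.\<close>

lemma has_laplace_unique:
  assumes f: "has_laplace f F" and g: "has_laplace g G" and eq: "\<And>p. 0 < p \<Longrightarrow> F p = G p"
    and cont: "\<And>t. 0 < t \<Longrightarrow> isCont f t" "\<And>t. 0 < t \<Longrightarrow> isCont g t"
  shows "f t = g t"
proof -
  define h where "h = (\<lambda>t. f t - g t)"
  have h: "has_laplace h (\<lambda>p. F p - G p)" unfolding h_def by (rule has_laplace_diff[OF f g])
  have H: "has_laplace (frac_int 1 h) (\<lambda>p. p powr (- 1) * (F p - G p))"
    by (rule has_laplace_frac_int[OF _ h]) simp
  have int: "integrable lborel (\<lambda>s. exp (- (1 / 2) * s) * h s)"
    using has_laplaceD(3)[OF h, of "1/2"] by (simp add: has_bochner_integral_iff)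
  define C where "C = (\<integral>s. norm (exp (- (1 / 2) * s) * h s) \<partial>lborel)"
  have bound: "\<bar>frac_int 1 h u\<bar> \<le> exp (u / 2) * C" for u
  proof -
    have "\<bar>frac_int 1 h u\<bar> \<le> (\<integral>s. norm (frac_kernel 1 (u - s) * h s) \<partial>lborel)"
      unfolding frac_int_def using integral_norm_bound[of lborel "\<lambda>s. frac_kernel 1 (u - s) * h s"] by simp
    also have "\<dots> \<le> (\<integral>s. exp (u / 2) * norm (exp (- (1 / 2) * s) * h s) \<partial>lborel)"
    proof (rule integral_mono)
      show "integrable lborel (\<lambda>s. norm (frac_kernel 1 (u - s) * h s))"
        by (intro integrable_norm has_laplace_kernel_integrable[OF h]) simp
      show "integrable lborel (\<lambda>s. exp (u / 2) * norm (exp (- (1 / 2) * s) * h s))"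
        by (intro integrable_mult_right integrable_norm int)
      fix s
      have "1 * \<bar>h s\<bar> \<le> exp (u / 2 - s / 2) * \<bar>h s\<bar>" if "s < u"
        using that by (intro mult_right_mono) auto
      then have "\<bar>h s\<bar> \<le> exp (u / 2) * (exp (- (s / 2)) * \<bar>h s\<bar>)" if "s < u"
      proof -
        have "exp (u / 2 - s / 2) = exp (u / 2) * exp (- (s / 2))" by (simp flip: exp_add)
        then show ?thesis using \<open>s < u \<Longrightarrow> 1 * \<bar>h s\<bar> \<le> exp (u / 2 - s / 2) * \<bar>h s\<bar>\<close>[OF that] by (simp only: mult.assoc mult_1)
      qed
      then show "norm (frac_kernel 1 (u - s) * h s) \<le> exp (u / 2) * norm (exp (- (1 / 2) * s) * h s)"
        by (auto simp: frac_kernel_def omega_def abs_mult)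
    qed
    finally show ?thesis by (simp add: C_def)
  qed
  have lim: "((\<lambda>t. exp (- t) * frac_int 1 h t) \<longlongrightarrow> 0) at_top"
  proof (rule Lim_null_comparison)
    have "norm (exp (- t) * frac_int 1 h t) \<le> C * exp (- (t / 2))" for t
    proof -
      have "exp (- t) * \<bar>frac_int 1 h t\<bar> \<le> exp (- t) * (exp (t / 2) * C)"
        using bound[of t] by (intro mult_left_mono) auto
      also have "exp (- t) * (exp (t / 2) * C) = C * exp (- (t / 2))"
        by (simp add: mult_ac flip: exp_add mult.assoc)
      finally show ?thesis by (simp add: abs_mult)
    qed
    then show "\<forall>\<^sub>F t in at_top. norm (exp (- t) * frac_int 1 h t) \<le> C * exp (- (t / 2))" by simp
    have "((\<lambda>t::real. exp (- (t / 2))) \<longlongrightarrow> 0) at_top"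
    proof (rule Lim_null_comparison)
      have "exp (- (t / 2)) \<le> 2 / t" if "0 < t" for t :: real
        using exp_ge_add_one_self[of "t / 2"] that by (simp add: exp_minus field_simps)
      then show "\<forall>\<^sub>F t in at_top. norm (exp (- (t / 2))) \<le> 2 / (t::real)"
        by (intro eventually_mono[OF eventually_gt_at_top[of 0]]) auto
      show "((\<lambda>t. 2 / t) \<longlongrightarrow> (0::real)) at_top"
        by (intro real_tendsto_divide_at_top[OF tendsto_const] filterlim_ident)
    qed
    from tendsto_mult_right_zero[OF this, of C] show "((\<lambda>t. C * exp (- (t / 2))) \<longlongrightarrow> 0) at_top" by simp
  qed
  have zero: "frac_int 1 h u = 0" if "0 \<le> u" for u
  proof (rule laplace_unique[OF _ _ lim _ that])
    show "continuous_on {0..} (frac_int 1 h)" by (rule has_laplace_frac_int_continuous[OF h]) simp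
    show "has_bochner_integral lborel (\<lambda>t. exp (- p * t) * frac_int 1 h t) 0" if "0 < p" for p
      using has_laplaceD(3)[OF H that] eq[OF that] by simp
  qed (use has_laplaceD(2)[OF H] in auto)
  show ?thesis
  proof (cases "0 < t")
    case True
    have "isCont h t" unfolding h_def by (intro continuous_intros cont True)
    then have "(frac_int 1 h has_real_derivative h t) (at t)"
      using True by (intro frac_int_one_deriv[OF has_laplaceD(2)[OF h] has_laplace_set_integrable[OF h, of "t + 1"]]) auto
    moreover have "(frac_int 1 h has_real_derivative 0) (at t)"
      by (rule has_field_derivative_transform_within_open[of "\<lambda>_. 0" _ _ "{0<..}"]) (use True zero in auto)
    ultimately have "h t = 0" by (rule DERIV_unique)
    then show ?thesis by (simp add: h_def)
  qed (use has_laplaceD(2)[OF f] has_laplaceD(2)[OF g] in auto)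
qed

lemma has_bochner_integral_cexp:
  assumes w: "0 < Re w"
  shows "has_bochner_integral lborel (\<lambda>t. indicator {0<..} t *\<^sub>R exp (- w * of_real t)) (1 / w)"
proof -
  have int: "set_integrable lborel {0<..} (\<lambda>t. exp (- w * of_real t))"
    unfolding set_integrable_def
  proof (rule Bochner_Integration.integrable_bound)
    show "integrable lborel (\<lambda>t. exp (- Re w * t) * frac_kernel 1 t)"
      using laplace_frac_kernel[OF w, of 1] by (simp add: has_bochner_integral_iff)
  qed (measurable, auto simp: frac_kernel_def omega_def indicator_def)
  have "(LBINT t=ereal 0..\<infinity>. exp (- w * of_real t)) = 0 - (- 1 / w)"
  proof (rule interval_integral_FTC_integrable[where F = "\<lambda>t. - exp (- w * of_real t) / w"])
    have w0: "w \<noteq> 0" using w by auto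
    show "((\<lambda>t. - exp (- w * of_real t) / w) has_vector_derivative exp (- w * of_real t)) (at t)" for t
    proof -
      have "((\<lambda>z. - exp (- w * z) / w) has_field_derivative exp (- w * of_real t)) (at (of_real t))"
        using w0 by (auto intro!: derivative_eq_intros)
      then show ?thesis by (rule has_vector_derivative_real_field)
    qed
    show "set_integrable lborel (einterval (ereal 0) \<infinity>) (\<lambda>t. exp (- w * of_real t))"
      using int by simp
    have "isCont (\<lambda>t. - exp (- w * of_real t) / w) (0::real)"
      using w0 by (intro continuous_intros) auto
    then have "((\<lambda>t. - exp (- w * of_real t) / w) \<longlongrightarrow> - 1 / w) (at (0::real))" by (simp add: isCont_def)
    then have "((\<lambda>t. - exp (- w * of_real t) / w) \<longlongrightarrow> - 1 / w) (at_right (0::real))"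
      by (rule filterlim_mono[OF _ order_refl]) (simp add: at_le)
    then show "(((\<lambda>t. - exp (- w * of_real t) / w) \<circ> real_of_ereal) \<longlongrightarrow> - 1 / w) (at_right (ereal 0))"
      by (simp add: ereal_tendsto_simps1)
    have "((\<lambda>t. exp (- w * of_real t)) \<longlongrightarrow> 0) at_top"
    proof (rule Lim_null_comparison)
      have "norm (exp (- w * of_real t)) \<le> (1 / Re w) / t" if "0 < t" for t :: real
      proof -
        have "norm (exp (- w * of_real t)) = exp (- (Re w * t))" by simp
        also have "\<dots> \<le> (1 / Re w) / t"
        proof -
          have "Re w * t \<le> exp (Re w * t)" using exp_ge_add_one_self[of "Re w * t"] by linarith
          then show ?thesis using that w by (simp add: exp_minus field_simps)
        qed
        finally show ?thesis .
      qed
      then show "\<forall>\<^sub>F t in at_top. norm (exp (- w * of_real t)) \<le> (1 / Re w) / (t::real)"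
        by (intro eventually_mono[OF eventually_gt_at_top[of 0]]) auto
      show "((\<lambda>t. (1 / Re w) / t) \<longlongrightarrow> (0::real)) at_top"
        by (intro real_tendsto_divide_at_top[OF tendsto_const] filterlim_ident)
    qed
    then have "((\<lambda>t. - exp (- w * of_real t) / w) \<longlongrightarrow> - 0 / w) at_top"
      using w0 by (intro tendsto_intros) auto
    then show "(((\<lambda>t. - exp (- w * of_real t) / w) \<circ> real_of_ereal) \<longlongrightarrow> 0) (at_left \<infinity>)"
      by (simp add: ereal_tendsto_simps1)
  qed (auto intro!: continuous_intros)
  then have "(LBINT t:{0<..}. exp (- w * of_real t)) = 1 / w"
    by (simp add: interval_integral_to_infinity_eq)
  with int show ?thesis
    by (simp add: has_bochner_integral_iff set_integrable_def set_lebesgue_integral_def)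
qed

text \<open>The inverse Laplace transform of \<open>G\<close>, with Bromwich's line bent into the two
  rays of argument \<open>\<plusminus>\<theta>\<close>. As \<open>G\<close> is real on the real axis, the
  two rays give conjugate contributions and the imaginary part of one of them suffices.\<close>

definition ray_fun :: "real \<Rightarrow> (complex \<Rightarrow> complex) \<Rightarrow> real \<Rightarrow> real" where
  "ray_fun \<theta> G t = (if 0 < t
     then Im (LBINT r:{0<..}. exp (of_real t * rcis r \<theta>) * (G (rcis r \<theta>) * cis \<theta>)) / pi else 0)"

lemma norm_exp_ray: "norm (exp (of_real t * rcis r \<theta>)) = exp (- (- cos \<theta> * t) * r)"
  by (simp add: mult_ac)

text \<open>Transforms that can be inverted along the ray of argument \<open>\<theta>\<close>. The ray
  lies in the left half plane, where \<open>exp (t * z)\<close> decays; continuity at the vertex is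
  required because the contour passes through it.\<close>

locale ray_symbol =
  fixes \<theta> :: real and G :: "complex \<Rightarrow> complex" and D :: "complex set" and B \<kappa> :: real
  assumes \<theta>: "pi / 2 < \<theta>" "\<theta> < pi"
    and cont: "continuous_on (sector \<theta>) G"
    and hol: "G holomorphic_on D" "open D" "sector \<theta> - {0} \<subseteq> D"
    and bound: "\<And>z. z \<in> sector \<theta> \<Longrightarrow> z \<noteq> 0 \<Longrightarrow> norm (G z) \<le> B * norm z powr (- \<kappa>)"
    and \<kappa>: "0 < \<kappa>" "\<kappa> < 1"
    and real: "\<And>x. 0 \<le> x \<Longrightarrow> Im (G (of_real x)) = 0"
begin

definition g :: "real \<Rightarrow> complex" where
  "g r = indicator {0..} r *\<^sub>R (G (rcis r \<theta>) * cis \<theta>)"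

text \<open>The rate of decay of \<open>exp (t * z)\<close> along the ray.\<close>

definition c :: real where "c = - cos \<theta>"

lemma c_pos: "0 < c"
  using \<theta> cos_lt_zero_pi[of \<theta>] by (simp add: c_def)

lemma rcis_sector: "0 \<le> r \<Longrightarrow> rcis r \<theta> \<in> sector \<theta>"
  using \<theta> pi_gt_zero by (intro rcis_in_sector) linarith+

lemma rcis_measurable [measurable]: "(\<lambda>r. rcis r \<theta>) \<in> borel_measurable borel"
  unfolding rcis_def by measurable

lemma g_measurable [measurable]: "g \<in> borel_measurable borel"
proof -
  have "continuous_on {0..} (\<lambda>r. rcis r \<theta>)" unfolding rcis_def by (intro continuous_intros)
  then have "continuous_on {0..} (\<lambda>r. G (rcis r \<theta>) * cis \<theta>)"
    by (intro continuous_intros continuous_on_compose2[OF cont]) (auto intro: rcis_sector)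
  then show ?thesis
    unfolding g_def by (intro borel_measurable_continuous_on_indicator) auto
qed

lemma g_bound: "0 < r \<Longrightarrow> norm (g r) \<le> B * r powr (- \<kappa>)"
  using bound[OF rcis_sector, of r] by (simp add: g_def norm_mult)

lemma B_nonneg: "0 \<le> B"
  using order_trans[OF norm_ge_zero g_bound[OF zero_less_one]] by simp

lemma ray_fun_eq: "0 < t \<Longrightarrow> ray_fun \<theta> G t = Im (\<integral>r. indicator {0<..} r *\<^sub>R (exp (of_real t * rcis r \<theta>) * g r) \<partial>lborel) / pi"
  unfolding ray_fun_def set_lebesgue_integral_def
  by (auto simp: g_def indicator_def intro!: arg_cong[where f = Im] Bochner_Integration.integral_cong)

lemma ray_integrand_bound:
  assumes "\<And>r. 0 < r \<Longrightarrow> norm (h r) \<le> K * r powr s" "-1 < s" "0 < t" and [measurable]: "h \<in> borel_measurable borel"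
  shows "integrable lborel (\<lambda>r. indicator {0<..} r *\<^sub>R (exp (of_real t * rcis r \<theta>) * (h r :: complex)))" (is ?int)
    and "norm (\<integral>r. indicator {0<..} r *\<^sub>R (exp (of_real t * rcis r \<theta>) * h r) \<partial>lborel) \<le> K * Gamma (s + 1) * (c * t) powr (- (s + 1))"
proof -
  define b where "b = (\<lambda>r. K * Gamma (s + 1) * (exp (- (c * t) * r) * frac_kernel (s + 1) r))"
  have b: "has_bochner_integral lborel b (K * Gamma (s + 1) * (c * t) powr (- (s + 1)))"
    unfolding b_def using assms c_pos by (intro has_bochner_integral_mult_right laplace_frac_kernel) auto
  have G0: "Gamma (s + 1) > 0" using assms(2) by (intro Gamma_real_pos) auto
  have le: "norm (indicator {0<..} r *\<^sub>R (exp (of_real t * rcis r \<theta>) * h r)) \<le> b r" for r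
  proof (cases "0 < r")
    case True
    then have "norm (exp (of_real t * rcis r \<theta>) * h r) \<le> exp (- (c * t) * r) * (K * r powr s)"
      using assms(1)[of r] unfolding norm_mult norm_exp_ray c_def by (intro mult_left_mono) auto
    then show ?thesis using True G0 by (simp add: b_def frac_kernel_def omega_def mult_ac)
  qed (simp add: b_def frac_kernel_def)
  show ?int
  proof (rule Bochner_Integration.integrable_bound)
    show "integrable lborel b" using b by (simp add: has_bochner_integral_iff)
    show "AE r in lborel. norm (indicator {0<..} r *\<^sub>R (exp (of_real t * rcis r \<theta>) * h r)) \<le> norm (b r)"
      using le by (intro AE_I2) (metis abs_ge_self order_trans real_norm_def)
  qed measurable
  then have "norm (\<integral>r. indicator {0<..} r *\<^sub>R (exp (of_real t * rcis r \<theta>) * h r) \<partial>lborel) \<le> (\<integral>r. b r \<partial>lborel)"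
    using b le by (intro order_trans[OF integral_norm_bound] integral_mono integrable_norm) (auto simp: has_bochner_integral_iff)
  then show "norm (\<integral>r. indicator {0<..} r *\<^sub>R (exp (of_real t * rcis r \<theta>) * h r) \<partial>lborel) \<le> K * Gamma (s + 1) * (c * t) powr (- (s + 1))"
    using b by (simp add: has_bochner_integral_iff)
qed

text \<open>Adding a real constant \<open>a\<close> to the symbol does not change the inverse at positive
  times, since the integral of \<open>exp (t * z)\<close> along the ray is real. The symbol may thus be
  compared with the most favourable constant before absolute values are taken.\<close>

lemma ray_fun_bound:
  assumes "\<And>r. 0 < r \<Longrightarrow> norm (G (rcis r \<theta>) - of_real a) \<le> K * r powr s" "-1 < s" "0 < t"
  shows "\<bar>ray_fun \<theta> G t\<bar> \<le> K * Gamma (s + 1) * (c * t) powr (- (s + 1))"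
proof -
  define h where "h = (\<lambda>r. g r - of_real a * cis \<theta>)"
  have [measurable]: "h \<in> borel_measurable borel" unfolding h_def by measurable
  have "norm (h r) \<le> K * r powr s" if "0 < r" for r
  proof -
    have "h r = (G (rcis r \<theta>) - of_real a) * cis \<theta>" using that by (simp add: h_def g_def algebra_simps)
    then show ?thesis using assms(1)[OF that] by (simp add: norm_mult)
  qed
  note h = ray_integrand_bound[of h K s t, OF this assms(2,3)]
  have ct: "0 < c * t" using c_pos assms by simp
  have one: "has_bochner_integral lborel (\<lambda>r. indicator {0<..} r *\<^sub>R (exp (of_real t * rcis r \<theta>) * (of_real a * cis \<theta>))) (- (of_real (a / t)))"
  proof -
    have "has_bochner_integral lborel (\<lambda>r. (indicator {0<..} r *\<^sub>R exp (- (- of_real t * cis \<theta>) * of_real r)) * (of_real a * cis \<theta>)) (1 / (- of_real t * cis \<theta>) * (of_real a * cis \<theta>))"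
      using ct by (intro has_bochner_integral_mult_left has_bochner_integral_cexp) (simp add: c_def mult.commute)
    then show ?thesis using assms(3) by (simp add: rcis_def mult_ac)
  qed
  have g: "has_bochner_integral lborel (\<lambda>r. indicator {0<..} r *\<^sub>R (exp (of_real t * rcis r \<theta>) * h r) + indicator {0<..} r *\<^sub>R (exp (of_real t * rcis r \<theta>) * (of_real a * cis \<theta>)))
      ((\<integral>r. indicator {0<..} r *\<^sub>R (exp (of_real t * rcis r \<theta>) * h r) \<partial>lborel) + - (of_real (a / t)))"
    by (intro has_bochner_integral_add one has_bochner_integral_integrable h(1)) measurable
  moreover have "indicator {0<..} r *\<^sub>R (exp (of_real t * rcis r \<theta>) * h r) + indicator {0<..} r *\<^sub>R (exp (of_real t * rcis r \<theta>) * (of_real a * cis \<theta>))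
     = indicator {0<..} r *\<^sub>R (exp (of_real t * rcis r \<theta>) * g r)" for r
    by (simp add: h_def algebra_simps)
  ultimately have "(\<integral>r. indicator {0<..} r *\<^sub>R (exp (of_real t * rcis r \<theta>) * g r) \<partial>lborel) =
      (\<integral>r. indicator {0<..} r *\<^sub>R (exp (of_real t * rcis r \<theta>) * h r) \<partial>lborel) + - (of_real (a / t))"
    by (simp only: has_bochner_integral_iff)
  then have "\<bar>ray_fun \<theta> G t\<bar> = \<bar>Im (\<integral>r. indicator {0<..} r *\<^sub>R (exp (of_real t * rcis r \<theta>) * h r) \<partial>lborel)\<bar> / pi"
    using assms(3) by (simp add: ray_fun_eq)
  also have "\<dots> \<le> norm (\<integral>r. indicator {0<..} r *\<^sub>R (exp (of_real t * rcis r \<theta>) * h r) \<partial>lborel) / 1"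
    using pi_gt3 by (intro frac_le abs_Im_le_cmod) auto
  also have "\<dots> \<le> K * Gamma (s + 1) * (c * t) powr (- (s + 1))" using h(2) by simp
  finally show ?thesis .
qed

lemma isCont_ray_fun:
  assumes t: "0 < t"
  shows "isCont (ray_fun \<theta> G) t"
proof -
  define I where "I = (\<lambda>t. \<integral>r. indicator {0<..} r *\<^sub>R (exp (of_real t * rcis r \<theta>) * g r) \<partial>lborel)"
  have "continuous_on {t / 2<..} I"
    unfolding continuous_on_sequentially
  proof (intro allI ballI impI)
    fix x u assume x: "x \<in> {t / 2<..}" and u: "(\<forall>n. u n \<in> {t / 2<..}) \<and> u \<longlonglongrightarrow> x"
    show "(I \<circ> u) \<longlonglongrightarrow> I x"
      unfolding I_def o_def
    proof (rule integral_dominated_convergence[where w = "\<lambda>r. B * Gamma (1 - \<kappa>) * (exp (- (c * (t / 2)) * r) * frac_kernel (1 - \<kappa>) r)"])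
      show "integrable lborel (\<lambda>r. B * Gamma (1 - \<kappa>) * (exp (- (c * (t / 2)) * r) * frac_kernel (1 - \<kappa>) r))"
        using laplace_frac_kernel[of "c * (t / 2)" "1 - \<kappa>"] t c_pos \<kappa>
        by (simp add: has_bochner_integral_iff)
      show "AE r in lborel. (\<lambda>n. indicator {0<..} r *\<^sub>R (exp (of_real (u n) * rcis r \<theta>) * g r)) \<longlonglongrightarrow> indicator {0<..} r *\<^sub>R (exp (of_real x * rcis r \<theta>) * g r)"
        using u by (intro AE_I2 tendsto_intros) simp
      show "AE r in lborel. norm (indicator {0<..} r *\<^sub>R (exp (of_real (u n) * rcis r \<theta>) * g r)) \<le> B * Gamma (1 - \<kappa>) * (exp (- (c * (t / 2)) * r) * frac_kernel (1 - \<kappa>) r)" for n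
      proof (intro AE_I2)
        fix r :: real
        show "norm (indicator {0<..} r *\<^sub>R (exp (of_real (u n) * rcis r \<theta>) * g r)) \<le> B * Gamma (1 - \<kappa>) * (exp (- (c * (t / 2)) * r) * frac_kernel (1 - \<kappa>) r)"
        proof (cases "0 < r")
          case True
          have un: "t / 2 \<le> u n" using u by (auto intro: less_imp_le)
          have "Gamma (1 - \<kappa>) > 0" using \<kappa> by (intro Gamma_real_pos) auto
          moreover have "norm (exp (of_real (u n) * rcis r \<theta>) * g r) \<le> exp (- (c * (t / 2)) * r) * (B * r powr (- \<kappa>))"
            unfolding norm_mult norm_exp_ray c_def[symmetric]
            using True g_bound[OF True] un c_pos by (intro mult_mono) (auto intro!: mult_right_mono mult_left_mono)
          ultimately show ?thesis using True by (simp add: frac_kernel_def omega_def mult_ac)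
        qed (simp add: frac_kernel_def)
      qed
    qed measurable
  qed
  then have "isCont I t" using t by (intro continuous_on_interior[of "{t / 2<..}"]) (auto simp: interior_open)
  then have "isCont (\<lambda>t. Im (I t) / pi) t" by (intro continuous_intros) auto
  moreover have "\<forall>\<^sub>F u in nhds t. Im (I u) / pi = ray_fun \<theta> G u"
    using eventually_nhds_in_open[of "{0<..}" t] t by (auto elim!: eventually_mono simp: ray_fun_eq I_def)
  ultimately show ?thesis by (subst (asm) isCont_cong) auto
qed

text \<open>The symbol is of size \<open>r powr (- \<kappa>)\<close>: this is integrable at 0, and the
  resolvent supplies one more power at infinity. The bound justifies exchanging the ray integral with the
  Laplace integral.\<close>

lemma ray_resolvent_integrable:
  assumes p: "0 < p"
  shows "integrable lborel (\<lambda>r. indicator {0<..} r * (norm (g r) / (p + c * r)))"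
proof (rule Bochner_Integration.integrable_bound)
  define b where "b = (\<lambda>r. B / p * (Gamma (1 - \<kappa>) * (frac_kernel 1 (1 - r) * frac_kernel (1 - \<kappa>) (r - 0)))
     + B / c * (indicator {1..} r * r powr (- \<kappa> - 1)))"
  have "(\<lambda>r. r powr (- \<kappa> - 1)) integrable_on {1..}"
    using has_integral_powr_to_inf[of "- \<kappa> - 1" 1] \<kappa> by (auto simp: integrable_on_def)
  then have "(\<lambda>r. r powr (- \<kappa> - 1)) absolutely_integrable_on {1..}"
    by (subst absolutely_integrable_on_iff_nonneg) auto
  then have "integrable lborel (\<lambda>r::real. indicator {1..} r * r powr (- \<kappa> - 1))"
    unfolding set_integrable_def by (subst (asm) integrable_completion) auto
  moreover have "integrable lborel (\<lambda>r. frac_kernel 1 (1 - r) * frac_kernel (1 - \<kappa>) (r - 0))"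
    using frac_kernel_convolution[of 1 "1 - \<kappa>" 1 0] \<kappa> by (simp only: has_bochner_integral_iff)
  ultimately show "integrable lborel b"
    unfolding b_def by (intro Bochner_Integration.integrable_add integrable_mult_right)
  show "AE r in lborel. norm (indicator {0<..} r * (norm (g r) / (p + c * r))) \<le> norm (b r)"
  proof -
    have "AE r in lborel. r \<noteq> (1::real)" by (rule AE_lborel_singleton)
    then show ?thesis
    proof eventually_elim
      case (elim r)
      have Gp: "Gamma (1 - \<kappa>) > 0" using \<kappa> by (intro Gamma_real_pos) auto
      consider "r \<le> 0" | "0 < r" "r < 1" | "1 < r" using elim by linarith
      then show ?case
      proof cases
        case 2
        have "norm (g r) / (p + c * r) \<le> B * r powr (- \<kappa>) / p"
          using g_bound[of r] 2 p c_pos B_nonneg by (intro frac_le) auto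
        then show ?thesis using 2 Gp p c_pos B_nonneg by (simp add: b_def frac_kernel_def omega_def)
      next
        case 3
        have "norm (g r) / (p + c * r) \<le> B * r powr (- \<kappa>) / (c * r)"
          using g_bound[of r] 3 p c_pos B_nonneg by (intro frac_le) auto
        also have "\<dots> = B / c * r powr (- \<kappa> - 1)" using 3 by (simp add: powr_diff)
        finally show ?thesis using 3 p c_pos B_nonneg by (simp add: b_def frac_kernel_def)
      qed simp
    qed
  qed
qed measurable

text \<open>Exchanging the integrals, the Laplace transform of the exponential is the resolvent \<open>1
  / (p - z)\<close>, and \<open>sector_cauchy_integral\<close> recovers the symbol.\<close>

lemma has_laplace_ray_fun: "has_laplace (ray_fun \<theta> G) (\<lambda>p. Re (G (of_real p)))"
proof -
  define K where "K = (\<lambda>p r t. (indicator {0<..} r *\<^sub>R (indicator {0<..} t *\<^sub>R (exp (- (of_real p - rcis r \<theta>) * of_real t) * g r))))"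
  have Km: "(\<lambda>(r, t). K p r t) \<in> borel_measurable (lborel \<Otimes>\<^sub>M lborel)" for p
    unfolding K_def by measurable
  have Re: "0 < Re (of_real p - rcis r \<theta>)" "p + c * r = Re (of_real p - rcis r \<theta>)" if "0 < p" "0 < r" for p r
    using that c_pos by (auto simp: c_def intro!: add_pos_pos mult_pos_pos) (smt (verit) mult_pos_neg)
  have main: "has_bochner_integral lborel (\<lambda>t. exp (- p * t) * ray_fun \<theta> G t) (Re (G p))" if p: "0 < p" for p
  proof -
    have inner: "has_bochner_integral lborel (K p r) (indicator {0<..} r *\<^sub>R (1 / (of_real p - rcis r \<theta>) * g r))" for r
    proof (cases "0 < r")
      case True
      have "has_bochner_integral lborel (\<lambda>t. indicator {0<..} t *\<^sub>R exp (- (of_real p - rcis r \<theta>) * of_real t) * g r) (1 / (of_real p - rcis r \<theta>) * g r)"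
        by (intro has_bochner_integral_mult_left has_bochner_integral_cexp Re p True)
      then show ?thesis using True by (simp add: K_def)
    qed (simp add: K_def has_bochner_integral_zero)
    have inner': "(\<integral>t. norm (K p r t) \<partial>lborel) = indicator {0<..} r * (norm (g r) / (p + c * r))" for r
    proof (cases "0 < r")
      case True
      have "0 < p + c * r" using Re[OF p True] by simp
      then have "has_bochner_integral lborel (\<lambda>t. norm (g r) * (exp (- (p + c * r) * t) * frac_kernel 1 t)) (norm (g r) * (p + c * r) powr (- 1))"
        by (intro has_bochner_integral_mult_right laplace_frac_kernel) auto
      moreover have "norm (g r) * (exp (- (p + c * r) * t) * frac_kernel 1 t) = norm (K p r t)" for t
        using True by (auto simp: K_def norm_mult frac_kernel_def omega_def c_def algebra_simps)
      ultimately have "(\<integral>t. norm (K p r t) \<partial>lborel) = norm (g r) * (p + c * r) powr (- 1)"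
        by (simp only: has_bochner_integral_iff)
      then show ?thesis using True \<open>0 < p + c * r\<close> by (simp add: powr_minus field_simps)
    qed (simp add: K_def)
    have "integrable (lborel \<Otimes>\<^sub>M lborel) (\<lambda>(r, t). K p r t)"
    proof (rule lborel_pair.Fubini_integrable[OF Km])
      show "integrable lborel (\<lambda>r. LINT t|lborel. norm (case (r, t) of (r, t) \<Rightarrow> K p r t))"
        unfolding prod.case inner' by (rule ray_resolvent_integrable[OF p])
    qed (use inner in \<open>auto simp: has_bochner_integral_iff\<close>)
    from lborel_pair.Fubini_integral[OF this] lborel_pair.integrable_snd[OF this] lborel_pair.integrable_fst[OF this]
    have eq: "(\<integral>t. (\<integral>r. K p r t \<partial>lborel) \<partial>lborel) = (\<integral>r. (\<integral>t. K p r t \<partial>lborel) \<partial>lborel)"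
      and int2: "integrable lborel (\<lambda>t. \<integral>r. K p r t \<partial>lborel)" and int1: "integrable lborel (\<lambda>r. \<integral>t. K p r t \<partial>lborel)" by auto
    have ray: "exp (- p * t) * ray_fun \<theta> G t = Im (\<integral>r. K p r t \<partial>lborel) / pi" for t
    proof (cases "0 < t")
      case True
      have "(\<integral>r. K p r t \<partial>lborel) = (\<integral>r. exp (- p * t) *\<^sub>R (indicator {0<..} r *\<^sub>R (exp (of_real t * rcis r \<theta>) * g r)) \<partial>lborel)"
      proof (rule Bochner_Integration.integral_cong[OF refl])
        fix r
        have "exp (- (of_real p - rcis r \<theta>) * of_real t) = of_real (exp (- p * t)) * exp (of_real t * rcis r \<theta>)"
          by (simp add: algebra_simps flip: exp_of_real exp_add)
        then show "K p r t = exp (- p * t) *\<^sub>R (indicator {0<..} r *\<^sub>R (exp (of_real t * rcis r \<theta>) * g r))"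
          using True by (simp add: K_def scaleR_conv_of_real mult_ac)
      qed
      also have "\<dots> = exp (- p * t) *\<^sub>R (\<integral>r. indicator {0<..} r *\<^sub>R (exp (of_real t * rcis r \<theta>) * g r) \<partial>lborel)"
        by (rule integral_scaleR_right)
      finally show ?thesis using True by (simp add: ray_fun_eq)
    qed (simp add: ray_fun_def K_def)
    have disc: "set_integrable lborel {0..} f = set_integrable lborel {0<..} f"
      "(LBINT r:{0..}. f r) = (LBINT r:{0<..}. f r)" for f :: "real \<Rightarrow> complex"
      by (rule set_integrable_discrete_difference[of "{0}"] set_integral_discrete_difference[of "{0}"]; auto)+
    have geq: "(\<integral>t. K p r t \<partial>lborel) = indicator {0<..} r *\<^sub>R (G (rcis r \<theta>) * cis \<theta> / (of_real p - rcis r \<theta>))" for r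
      using inner[of r] by (simp add: has_bochner_integral_iff g_def indicator_def)
    have "Im (LBINT r:{0..}. G (rcis r \<theta>) * cis \<theta> / (p - rcis r \<theta>)) = pi * Re (G p)"
    proof (rule sector_cauchy_integral[OF _ _ p cont hol(2,3,1) bound \<kappa>(1) real])
      show "set_integrable lborel {0..} (\<lambda>r. G (rcis r \<theta>) * cis \<theta> / (of_real p - rcis r \<theta>))"
        unfolding disc using int1 unfolding geq by (simp add: set_integrable_def)
    qed (use \<theta> pi_gt_zero in linarith)+
    then have "Im (\<integral>t. (\<integral>r. K p r t \<partial>lborel) \<partial>lborel) = pi * Re (G p)"
      unfolding eq geq disc by (simp add: set_lebesgue_integral_def)
    then show ?thesis
      unfolding ray using integrable_Im[OF int2] integral_Im[OF int2] by (simp add: has_bochner_integral_iff)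
  qed
  have m: "(\<lambda>t. \<integral>r. K 0 r t \<partial>lborel) \<in> borel_measurable borel"
    unfolding K_def by measurable
  have "ray_fun \<theta> G t = Im (\<integral>r. K 0 r t \<partial>lborel) / pi" for t
  proof (cases "0 < t")
    case True
    then show ?thesis by (simp add: ray_fun_eq K_def mult_ac)
  qed (simp add: ray_fun_def K_def)
  then have "ray_fun \<theta> G = (\<lambda>t. Im (\<integral>r. K 0 r t \<partial>lborel) / pi)" by blast
  then have "ray_fun \<theta> G \<in> borel_measurable borel" using m by simp
  with main show ?thesis by (auto simp: has_laplace_def ray_fun_def)
qed

end

section \<open>Symbols of the fractional oscillator\<close>

lemma norm_cpowr_real: "z \<noteq> 0 \<Longrightarrow> norm (z powr of_real a) = norm z powr a" for z :: complex
  by (simp add: powr_def)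

lemma sector_powr:
  assumes "z \<in> sector \<theta>" "z \<noteq> 0" "0 < \<theta>" "\<theta> < pi"
  shows "z powr of_real a = rcis (norm z powr a) (a * Arg z)"
proof -
  have "z powr of_real a = exp (of_real a * (of_real (ln (norm z)) + \<i> * of_real (Arg z)))"
    using assms(2) by (simp add: powr_def Ln_Arg)
  also have "\<dots> = exp (of_real (a * ln (norm z))) * exp (\<i> * of_real (a * Arg z))"
    by (simp add: algebra_simps flip: exp_add)
  also have "\<dots> = rcis (norm z powr a) (a * Arg z)"
    unfolding exp_of_real using assms(2) by (simp add: rcis_def cis_conv_exp powr_def)
  finally show ?thesis .
qed

text \<open>The square of the left side differs from that of the right side by \<open>(1 - cos \<psi>) /
  2 * (x - y)^2\<close>.\<close>

lemma norm_rcis_add_real: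
  assumes "0 \<le> x" "0 \<le> y"
  shows "sqrt ((1 + cos \<psi>) / 2) * (x + y) \<le> norm (rcis x \<psi> + of_real y)"
proof -
  have "(1 + cos \<psi>) / 2 * (x + y)\<^sup>2 \<le> (x * cos \<psi> + y)\<^sup>2 + (x * sin \<psi>)\<^sup>2"
  proof -
    have "(x * cos \<psi> + y)\<^sup>2 + (x * sin \<psi>)\<^sup>2 = x\<^sup>2 + y\<^sup>2 + 2 * x * y * cos \<psi>"
      by (simp add: power2_sum power_mult_distrib sin_squared_eq) (simp add: algebra_simps)
    then have "(x * cos \<psi> + y)\<^sup>2 + (x * sin \<psi>)\<^sup>2 - (1 + cos \<psi>) / 2 * (x + y)\<^sup>2 = (1 - cos \<psi>) / 2 * (x - y)\<^sup>2"
      by (simp add: power2_eq_square algebra_simps field_simps)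
    moreover have "0 \<le> (1 - cos \<psi>) / 2 * (x - y)\<^sup>2" by (intro mult_nonneg_nonneg) auto
    ultimately show ?thesis by linarith
  qed
  then have "sqrt ((1 + cos \<psi>) / 2 * (x + y)\<^sup>2) \<le> norm (rcis x \<psi> + of_real y)"
    unfolding cmod_def by (intro real_sqrt_le_mono) simp
  then show ?thesis
    using assms by (simp only: real_sqrt_mult real_sqrt_abs abs_of_nonneg add_nonneg_nonneg)
qed

locale oscillator_sector =
  fixes \<nu> :: real
  assumes \<nu>: "1 / 2 < \<nu>" "\<nu> < 1"
begin

text \<open>The midpoint between \<open>pi / 2\<close>, beyond which the exponential decays, and
  \<open>pi / (2 * \<nu>)\<close>, where \<open>z powr (2 * \<nu>)\<close> reaches the negative real
  axis.\<close>

definition \<theta> :: real where "\<theta> = (pi / 2 + pi / (2 * \<nu>)) / 2"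

text \<open>The constant in the lower bound of the denominator on the sector, uniform in
  \<open>lam\<close>.\<close>

definition q :: real where "q = sqrt ((1 + cos (2 * \<nu> * \<theta>)) / 2)"

text \<open>\<open>G0\<close> is the transform of \<open>- y''\<close>, and \<open>G1\<close> that of
  \<open>- v''\<close> up to an explicit power of \<open>t\<close>, for the oscillator \<open>y\<close> and
  its Caputo derivative \<open>v\<close> of order \<open>\<nu>\<close>.\<close>

definition G0 :: "real \<Rightarrow> complex \<Rightarrow> complex" where
  "G0 lam z = of_real lam / (z powr of_real (2 * \<nu>) + of_real lam)"
definition G1 :: "real \<Rightarrow> complex \<Rightarrow> complex" where
  "G1 lam z = of_real lam * z powr of_real \<nu> / (z powr of_real (2 * \<nu>) + of_real lam)"
definition D :: "real \<Rightarrow> complex set" where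
  "D lam = {z. z \<notin> \<real>\<^sub>\<le>\<^sub>0 \<and> z powr of_real (2 * \<nu>) + of_real lam \<noteq> 0}"

lemma \<theta>_bounds: "pi / 2 < \<theta>" "\<theta> < pi" "0 < \<theta>" "0 < 2 * \<nu> * \<theta>" "2 * \<nu> * \<theta> < pi"
proof -
  define X where "X = pi / \<nu>"
  have "pi < X" using \<nu> by (simp add: X_def field_simps)
  moreover have \<theta>: "\<theta> = pi / 4 + X / 4" using \<nu> by (simp add: \<theta>_def X_def field_simps)
  ultimately show 1: "pi / 2 < \<theta>" by linarith
  have "X < 2 * pi" using \<nu> by (simp add: X_def field_simps)
  then show "\<theta> < pi" using \<theta> pi_gt_zero by linarith
  show 2: "0 < \<theta>" using 1 pi_gt_zero by linarith
  then show "0 < 2 * \<nu> * \<theta>" using \<nu> by simp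
  have "2 * \<nu> * \<theta> = (\<nu> * pi + pi) / 2" using \<nu> by (simp add: \<theta>_def field_simps)
  also have "\<dots> < pi" using \<nu> by (simp add: field_simps)
  finally show "2 * \<nu> * \<theta> < pi" .
qed

lemma q_pos: "0 < q"
proof -
  have "cos pi < cos (2 * \<nu> * \<theta>)" using \<theta>_bounds by (intro cos_monotone_0_pi) auto
  then show ?thesis by (simp add: q_def)
qed

text \<open>On the sector the argument of \<open>z powr (2 * \<nu>)\<close> stays at most \<open>2 *
  \<nu> * \<theta> < pi\<close>, so the two summands cannot cancel.\<close>

lemma denominator_bound:
  assumes "0 < lam" "z \<in> sector \<theta>" "z \<noteq> 0"
  shows "q * (norm z powr (2 * \<nu>) + lam) \<le> norm (z powr of_real (2 * \<nu>) + of_real lam)"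
proof -
  obtain "0 \<le> Arg z" "Arg z \<le> \<theta>" using in_sectorE[OF assms(2,3)] \<theta>_bounds by blast
  then have "2 * \<nu> * Arg z \<le> 2 * \<nu> * \<theta>" "0 \<le> 2 * \<nu> * Arg z" using \<nu> by auto
  then have "cos (2 * \<nu> * \<theta>) \<le> cos (2 * \<nu> * Arg z)" using \<theta>_bounds by (intro cos_monotone_0_pi_le) auto
  then have "q * (norm z powr (2 * \<nu>) + lam) \<le> sqrt ((1 + cos (2 * \<nu> * Arg z)) / 2) * (norm z powr (2 * \<nu>) + lam)"
    unfolding q_def using assms by (intro mult_right_mono) auto
  also have "\<dots> \<le> norm (z powr of_real (2 * \<nu>) + of_real lam)"
    using assms \<theta>_bounds by (subst sector_powr[of z \<theta>]) (auto intro!: norm_rcis_add_real)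
  finally show ?thesis .
qed

lemma denominator_pos:
  assumes "0 < lam" "z \<in> sector \<theta>" "z \<noteq> 0"
  shows "0 < norm (z powr of_real (2 * \<nu>) + of_real lam)"
proof -
  have "0 < q * (norm z powr (2 * \<nu>) + lam)" using q_pos assms by (intro mult_pos_pos add_nonneg_pos) auto
  then show ?thesis using denominator_bound[OF assms] by linarith
qed

lemma open_D: "open (D lam)"
proof -
  have "continuous_on (- \<real>\<^sub>\<le>\<^sub>0) (\<lambda>z. z powr of_real (2 * \<nu>) + of_real lam :: complex)"
    by (intro continuous_intros) (auto simp: complex_nonpos_Reals_iff)
  then have "open ((\<lambda>z. z powr of_real (2 * \<nu>) + of_real lam :: complex) -` (- {0}) \<inter> (- \<real>\<^sub>\<le>\<^sub>0))"
    by (intro continuous_on_open_vimage[THEN iffD1, rule_format]) (auto simp: open_Compl)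
  also have "((\<lambda>z. z powr of_real (2 * \<nu>) + of_real lam :: complex) -` (- {0}) \<inter> (- \<real>\<^sub>\<le>\<^sub>0)) = D lam"
    by (auto simp: D_def)
  finally show ?thesis .
qed

lemma sector_subset_D:
  assumes "0 < lam"
  shows "sector \<theta> - {0} \<subseteq> D lam"
proof
  fix z assume z: "z \<in> sector \<theta> - {0}"
  then have "Arg z \<le> \<theta>" using in_sectorE[of z \<theta>] \<theta>_bounds by blast
  then have "Arg z \<noteq> pi" using \<theta>_bounds by auto
  then have "z \<notin> \<real>\<^sub>\<le>\<^sub>0" using z by (auto simp: Arg_eq_pi complex_nonpos_Reals_iff complex_eq_iff)
  then show "z \<in> D lam" using denominator_pos[OF assms, of z] z by (auto simp: D_def)
qed

lemma continuous_on_sector_powr: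
  assumes "0 < a"
  shows "continuous_on (sector \<theta>) (\<lambda>z. z powr of_real a)"
proof (intro continuous_intros)
  show "sector \<theta> \<subseteq> {z. 0 \<le> Re z \<or> Im z \<noteq> 0}"
  proof
    fix z assume z: "z \<in> sector \<theta>"
    show "z \<in> {z. 0 \<le> Re z \<or> Im z \<noteq> 0}"
      using sector_subset_D[of 1] z by (cases "z = 0") (auto simp: D_def complex_nonpos_Reals_iff)
  qed
qed (use assms in auto)

lemma denominator_nz:
  assumes "0 < lam" "z \<in> sector \<theta>"
  shows "z powr of_real (2 * \<nu>) + of_real lam \<noteq> 0"
proof (cases "z = 0")
  case False
  then show ?thesis using denominator_pos[OF assms] by (metis norm_zero less_irrefl)
qed (use assms in auto)

lemma powr_add_ge: "0 < r \<Longrightarrow> 0 < lam \<Longrightarrow> sqrt lam * r powr \<nu> \<le> r powr (2 * \<nu>) + lam"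
proof -
  assume r: "0 < r" and l: "0 < lam"
  have "r powr (2 * \<nu>) = (r powr \<nu>)\<^sup>2" using r by (simp add: powr_power)
  moreover have "0 \<le> (r powr \<nu> - sqrt lam)\<^sup>2" by simp
  moreover have "(r powr \<nu> - sqrt lam)\<^sup>2 = (r powr \<nu>)\<^sup>2 + lam - 2 * (sqrt lam * r powr \<nu>)"
    using l by (simp add: power2_diff)
  moreover have "0 \<le> sqrt lam * r powr \<nu>" using l by simp
  ultimately show ?thesis by linarith
qed

lemma of_real_powr_of_real: "0 \<le> x \<Longrightarrow> of_real x powr of_real a = (of_real (x powr a) :: complex)"
  by (rule powr_of_real)

lemma G0_of_real: "0 \<le> x \<Longrightarrow> G0 lam (of_real x) = of_real (lam / (x powr (2 * \<nu>) + lam))"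
  unfolding G0_def by (simp only: of_real_powr_of_real flip: of_real_add of_real_divide)

lemma G1_of_real: "0 \<le> x \<Longrightarrow> G1 lam (of_real x) = of_real (lam * x powr \<nu> / (x powr (2 * \<nu>) + lam))"
  unfolding G1_def by (simp only: of_real_powr_of_real flip: of_real_add of_real_divide of_real_mult)

lemma ray_symbol_G0:
  assumes l: "0 < lam"
  shows "ray_symbol \<theta> (G0 lam) (D lam) (sqrt lam / q) \<nu>"
proof
  show "continuous_on (sector \<theta>) (G0 lam)"
    unfolding G0_def using \<nu> denominator_nz[OF l] by (intro continuous_intros continuous_on_sector_powr) auto
  show "G0 lam holomorphic_on D lam"
    unfolding G0_def by (intro holomorphic_intros) (auto simp: D_def)
  show "norm (G0 lam z) \<le> sqrt lam / q * norm z powr (- \<nu>)" if z: "z \<in> sector \<theta>" "z \<noteq> 0" for z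
  proof -
    have "q * (sqrt lam * norm z powr \<nu>) \<le> q * (norm z powr (2 * \<nu>) + lam)"
      using q_pos z l by (intro mult_left_mono powr_add_ge) auto
    also have "\<dots> \<le> norm (z powr of_real (2 * \<nu>) + of_real lam)" by (rule denominator_bound[OF l z])
    finally have "norm (G0 lam z) \<le> lam / (q * (sqrt lam * norm z powr \<nu>))"
      unfolding G0_def norm_divide using q_pos z l by (intro frac_le) auto
    also have "\<dots> = sqrt lam / q * norm z powr (- \<nu>)"
      using l q_pos z by (simp add: powr_minus field_simps flip: power2_eq_square)
    finally show ?thesis .
  qed
  show "Im (G0 lam (of_real x)) = 0" if "0 \<le> x" for x
    using that by (simp only: G0_of_real Im_complex_of_real)
qed (use \<theta>_bounds \<nu> open_D sector_subset_D[OF l] in auto)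

lemma ray_symbol_G1:
  assumes l: "0 < lam"
  shows "ray_symbol \<theta> (G1 lam) (D lam) (lam / q) \<nu>"
proof
  show "continuous_on (sector \<theta>) (G1 lam)"
    unfolding G1_def using \<nu> denominator_nz[OF l] by (intro continuous_intros continuous_on_sector_powr) auto
  show "G1 lam holomorphic_on D lam"
    unfolding G1_def by (intro holomorphic_intros) (auto simp: D_def)
  show "norm (G1 lam z) \<le> lam / q * norm z powr (- \<nu>)" if z: "z \<in> sector \<theta>" "z \<noteq> 0" for z
  proof -
    have "q * norm z powr (2 * \<nu>) \<le> q * (norm z powr (2 * \<nu>) + lam)"
      using q_pos z l by (intro mult_left_mono) auto
    also have "\<dots> \<le> norm (z powr of_real (2 * \<nu>) + of_real lam)" by (rule denominator_bound[OF l z])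
    finally have "norm (G1 lam z) \<le> lam * norm z powr \<nu> / (q * norm z powr (2 * \<nu>))"
      unfolding G1_def norm_divide norm_mult norm_cpowr_real[OF z(2)] using q_pos z l by (intro frac_le) auto
    also have "\<dots> = lam / q * norm z powr (- \<nu>)"
    proof -
      have "norm z powr (2 * \<nu>) = norm z powr \<nu> * norm z powr \<nu>" by (simp flip: powr_add)
      then show ?thesis using q_pos z by (simp add: powr_minus field_simps)
    qed
    finally show ?thesis .
  qed
  show "Im (G1 lam (of_real x)) = 0" if "0 \<le> x" for x
    using that by (simp only: G1_of_real Im_complex_of_real)
qed (use \<theta>_bounds \<nu> open_D sector_subset_D[OF l] in auto)

text \<open>With \<open>x = r powr (\<nu> / 2)\<close> and \<open>y = lam powr (1 / 4)\<close> the
  quantity is of size \<open>x^4 / (x^4 + y^4)\<close>, which is at most \<open>x / y\<close>. Giving up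
  three quarters of the available decay in \<open>lam\<close> in this way leaves the mild singularity
  \<open>t powr (- 1 - \<nu> / 2)\<close> in time.\<close>

lemma G0_minus_one_bound:
  assumes l: "0 < lam" and r: "0 < r"
  shows "norm (G0 lam (rcis r \<theta>) - of_real 1) \<le> lam powr (- (1 / 4)) / q * r powr (\<nu> / 2)"
proof -
  define z where "z = rcis r \<theta>"
  have z: "z \<in> sector \<theta>" "z \<noteq> 0" "norm z = r"
    using r \<theta>_bounds by (auto simp: z_def intro!: rcis_in_sector)
  define x y where "x = r powr (\<nu> / 2)" and "y = lam powr (1 / 4)"
  have xy: "0 < x" "0 < y" using r l by (auto simp: x_def y_def)
  have x4: "r powr (2 * \<nu>) = x ^ 4" using r by (simp add: x_def powr_power)
  have y4: "lam = y ^ 4" using l by (simp add: y_def powr_power)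
  have "y * x ^ 3 \<le> x ^ 4 + y ^ 4"
  proof (cases "y \<le> x")
    case True
    then have "y * x ^ 3 \<le> x * x ^ 3" using xy by (intro mult_right_mono) auto
    moreover have "x * x ^ 3 = x ^ 4" by (simp add: eval_nat_numeral)
    moreover have "0 \<le> y ^ 4" by simp
    ultimately show ?thesis by linarith
  next
    case False
    then have "y * x ^ 3 \<le> y * y ^ 3" using xy by (intro mult_left_mono power_mono) auto
    moreover have "y * y ^ 3 = y ^ 4" by (simp add: eval_nat_numeral)
    moreover have "0 \<le> x ^ 4" by simp
    ultimately show ?thesis by linarith
  qed
  then have "x * q * (y * x ^ 3) \<le> x * q * (x ^ 4 + y ^ 4)"
    using xy q_pos by (intro mult_left_mono) auto
  then have m: "x ^ 4 * (q * y) \<le> x * (q * (x ^ 4 + y ^ 4))"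
    by (simp add: eval_nat_numeral mult_ac)
  have p1: "0 < q * (x ^ 4 + y ^ 4)" and p2: "0 < q * y" using xy q_pos by (auto intro!: mult_pos_pos add_pos_pos)
  have le: "x ^ 4 / (q * (x ^ 4 + y ^ 4)) \<le> x / (q * y)"
    using m by (simp only: pos_divide_le_eq[OF p1] times_divide_eq_left pos_le_divide_eq[OF p2])
  have "G0 lam z - of_real 1 = - (z powr of_real (2 * \<nu>)) / (z powr of_real (2 * \<nu>) + of_real lam)"
    using denominator_nz[OF l z(1)] by (simp add: G0_def divide_simps)
  then have "norm (G0 lam z - of_real 1) = r powr (2 * \<nu>) / norm (z powr of_real (2 * \<nu>) + of_real lam)"
    using norm_cpowr_real[OF z(2), of "2 * \<nu>"] z(3) by (simp add: norm_divide)
  also have "\<dots> \<le> r powr (2 * \<nu>) / (q * (r powr (2 * \<nu>) + lam))"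
    using denominator_bound[OF l z(1,2)] z(3) q_pos l r
    by (intro divide_left_mono mult_pos_pos add_nonneg_pos denominator_pos[OF l z(1,2)]) auto
  also have "\<dots> \<le> x / (q * y)" using le x4 y4 by simp
  also have "\<dots> = lam powr (- (1 / 4)) / q * r powr (\<nu> / 2)"
    using l by (simp add: x_def y_def powr_minus field_simps)
  finally show ?thesis by (simp add: z_def)
qed

text \<open>A bound free of \<open>lam\<close>: the term \<open>lam\<close> of the denominator absorbs
  the one in the numerator.\<close>

lemma G1_bound:
  assumes l: "0 < lam" and r: "0 < r"
  shows "norm (G1 lam (rcis r \<theta>) - of_real 0) \<le> 1 / q * r powr \<nu>"
proof -
  define z where "z = rcis r \<theta>"
  have z: "z \<in> sector \<theta>" "z \<noteq> 0" "norm z = r"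
    using r \<theta>_bounds by (auto simp: z_def intro!: rcis_in_sector)
  have "q * lam \<le> q * (norm z powr (2 * \<nu>) + lam)"
    using q_pos z l by (intro mult_left_mono) auto
  also have "\<dots> \<le> norm (z powr of_real (2 * \<nu>) + of_real lam)" by (rule denominator_bound[OF l z(1,2)])
  finally have "norm (G1 lam z) \<le> lam * norm z powr \<nu> / (q * lam)"
    unfolding G1_def norm_divide norm_mult norm_cpowr_real[OF z(2)] using q_pos z l by (intro frac_le) auto
  also have "\<dots> = 1 / q * r powr \<nu>" using l z by simp
  finally show ?thesis by (simp add: z_def)
qed

text \<open>The kernels are ray integrals of \<open>G0\<close> and \<open>G1\<close>. The comparison
  constants in \<open>ray_fun_bound\<close> are 1 and 0, the values of the symbols at the origin, so that
  the remainders vanish there like powers of \<open>r\<close> and the kernels are controlled by powers of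
  \<open>t\<close>.\<close>

lemma oscillator_kernels:
  "\<exists>C>0. \<forall>lam>0. \<exists>H n.
     has_laplace H (\<lambda>p. lam / (p powr (2 * \<nu>) + lam)) \<and> (\<forall>t>0. isCont H t) \<and>
     (\<forall>t>0. \<bar>H t\<bar> \<le> C * lam powr (- (1 / 4)) * t powr (- (1 + \<nu> / 2))) \<and>
     has_laplace n (\<lambda>p. lam * p powr \<nu> / (p powr (2 * \<nu>) + lam)) \<and> (\<forall>t>0. isCont n t) \<and>
     (\<forall>t>0. \<bar>n t\<bar> \<le> C * t powr (- (1 + \<nu>)))"
proof -
  define c where "c = - cos \<theta>"
  have c: "0 < c" using \<theta>_bounds cos_lt_zero_pi[of \<theta>] by (simp add: c_def)
  define C where "C = max (Gamma (\<nu> / 2 + 1) * c powr (- (\<nu> / 2 + 1)) / q) (Gamma (\<nu> + 1) * c powr (- (\<nu> + 1)) / q)"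
  have "0 < Gamma (\<nu> + 1) * c powr (- (\<nu> + 1)) / q"
    using \<nu> c q_pos by (intro divide_pos_pos mult_pos_pos Gamma_real_pos) auto
  then have C: "0 < C" by (simp add: C_def)
  show ?thesis
  proof (intro exI[of _ C] conjI C allI impI)
    fix lam :: real assume l: "0 < lam"
    interpret R0: ray_symbol \<theta> "G0 lam" "D lam" "sqrt lam / q" \<nu> by (rule ray_symbol_G0[OF l])
    interpret R1: ray_symbol \<theta> "G1 lam" "D lam" "lam / q" \<nu> by (rule ray_symbol_G1[OF l])
    have lapeq: "has_laplace f F'" if "has_laplace f F" "\<And>p. 0 < p \<Longrightarrow> F p = F' p" for f F F'
      using that by (auto simp: has_laplace_def)
    show "\<exists>H n. has_laplace H (\<lambda>p. lam / (p powr (2 * \<nu>) + lam)) \<and> (\<forall>t>0. isCont H t) \<and>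
     (\<forall>t>0. \<bar>H t\<bar> \<le> C * lam powr (- (1 / 4)) * t powr (- (1 + \<nu> / 2))) \<and>
     has_laplace n (\<lambda>p. lam * p powr \<nu> / (p powr (2 * \<nu>) + lam)) \<and> (\<forall>t>0. isCont n t) \<and>
     (\<forall>t>0. \<bar>n t\<bar> \<le> C * t powr (- (1 + \<nu>)))"
    proof (rule exI[of _ "ray_fun \<theta> (G0 lam)"], rule exI[of _ "ray_fun \<theta> (G1 lam)"], intro conjI allI impI)
      show "has_laplace (ray_fun \<theta> (G0 lam)) (\<lambda>p. lam / (p powr (2 * \<nu>) + lam))"
        by (rule lapeq[OF R0.has_laplace_ray_fun]) (simp only: G0_of_real Re_complex_of_real less_imp_le)
      show "has_laplace (ray_fun \<theta> (G1 lam)) (\<lambda>p. lam * p powr \<nu> / (p powr (2 * \<nu>) + lam))"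
        by (rule lapeq[OF R1.has_laplace_ray_fun]) (simp only: G1_of_real Re_complex_of_real less_imp_le)
      fix t :: real assume t: "0 < t"
      have "\<bar>ray_fun \<theta> (G0 lam) t\<bar> \<le> lam powr (- (1 / 4)) / q * Gamma (\<nu> / 2 + 1) * (R0.c * t) powr (- (\<nu> / 2 + 1))"
        by (rule R0.ray_fun_bound[OF G0_minus_one_bound[OF l]]) (use \<nu> t in auto)
      also have "\<dots> = Gamma (\<nu> / 2 + 1) * c powr (- (\<nu> / 2 + 1)) / q * (lam powr (- (1 / 4)) * t powr (- (1 + \<nu> / 2)))"
        using c t by (simp add: R0.c_def c_def[symmetric] powr_mult add.commute)
      also have "\<dots> \<le> C * (lam powr (- (1 / 4)) * t powr (- (1 + \<nu> / 2)))"
        by (intro mult_right_mono) (auto simp: C_def)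
      finally show "\<bar>ray_fun \<theta> (G0 lam) t\<bar> \<le> C * lam powr (- (1 / 4)) * t powr (- (1 + \<nu> / 2))" by simp
      have "\<bar>ray_fun \<theta> (G1 lam) t\<bar> \<le> 1 / q * Gamma (\<nu> + 1) * (R1.c * t) powr (- (\<nu> + 1))"
        by (rule R1.ray_fun_bound[OF G1_bound[OF l]]) (use \<nu> t in auto)
      also have "\<dots> = Gamma (\<nu> + 1) * c powr (- (\<nu> + 1)) / q * t powr (- (1 + \<nu>))"
        using c t by (simp add: R1.c_def c_def[symmetric] powr_mult add.commute)
      also have "\<dots> \<le> C * t powr (- (1 + \<nu>))"
        by (intro mult_right_mono) (auto simp: C_def)
      finally show "\<bar>ray_fun \<theta> (G1 lam) t\<bar> \<le> C * t powr (- (1 + \<nu>))" .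
    qed (auto intro: R0.isCont_ray_fun R1.isCont_ray_fun)
  qed
qed

end

section \<open>Exact solution of one mode\<close>

lemma frac_int_diff:
  assumes "integrable lborel (\<lambda>s. frac_kernel b (t - s) * f s)" "integrable lborel (\<lambda>s. frac_kernel b (t - s) * g s)"
  shows "frac_int b (\<lambda>s. f s - g s) t = frac_int b f t - frac_int b g t"
    and "integrable lborel (\<lambda>s. frac_kernel b (t - s) * (f s - g s))"
  using assms unfolding frac_int_def right_diff_distrib by auto

lemma frac_kernel_integrable:
  assumes "0 < a" "0 < b"
  shows "integrable lborel (\<lambda>s. frac_kernel a (t - s) * frac_kernel b s)"
  using frac_kernel_convolution[OF assms, of t 0] by (simp add: has_bochner_integral_iff)

lemma frac_kernel_deriv:
  assumes "0 < t" "b \<noteq> 0" "0 < b + 1"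
  shows "(frac_kernel (b + 1) has_real_derivative b / Gamma (b + 1) * t powr (b - 1)) (at t)"
proof -
  have "Gamma (b + 1) \<noteq> 0" using Gamma_real_pos[of "b + 1"] assms by linarith
  then have "((\<lambda>t. t powr b / Gamma (b + 1)) has_real_derivative b / Gamma (b + 1) * t powr (b - 1)) (at t)"
    using assms by (auto intro!: derivative_eq_intros simp: powr_diff)
  then show ?thesis
    by (rule has_field_derivative_transform_within_open[of _ _ _ "{0<..}"])
      (use assms in \<open>auto simp: frac_kernel_def omega_def\<close>)
qed

lemma isCont_frac_kernel: "0 < t \<Longrightarrow> 0 < b \<Longrightarrow> isCont (frac_kernel b) t"
proof -
  assume t: "0 < t" and b: "0 < b"
  have "isCont (\<lambda>t. t powr (b - 1) / Gamma b) t"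
    using t Gamma_real_pos[OF b] by (intro continuous_intros) auto
  moreover have "\<forall>\<^sub>F u in nhds t. u powr (b - 1) / Gamma b = frac_kernel b u"
    using eventually_nhds_in_open[of "{0<..}" t] t by (auto elim!: eventually_mono simp: frac_kernel_def omega_def)
  ultimately show ?thesis by (subst (asm) isCont_cong) auto
qed

lemma has_laplace_frac_int_deriv:
  assumes "has_laplace f F" "0 < t" "isCont f t"
  shows "(frac_int 1 f has_real_derivative f t) (at t)"
  using frac_int_one_deriv[OF has_laplaceD(2)[OF assms(1)] has_laplace_set_integrable[OF assms(1), of "t + 1"]] assms
  by auto

lemma isCont_frac_int:
  assumes "has_laplace f F" "1 \<le> c" "0 < t"
  shows "isCont (frac_int c f) t"
  using continuous_on_interior[OF has_laplace_frac_int_continuous[OF assms(1,2)], of t] assms(3) by simp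

lemma continuous_on_frac_kernel:
  assumes "1 < b"
  shows "continuous_on {0..} (frac_kernel b)"
proof -
  have "Gamma b \<noteq> 0" using Gamma_real_pos[of b] assms by linarith
  then have "continuous_on {0..} (\<lambda>t::real. t powr (b - 1) / Gamma b)"
    using assms
    by (intro continuous_on_divide continuous_on_powr' continuous_on_id continuous_on_const) auto
  then show ?thesis
    by (rule continuous_on_eq) (use assms in \<open>auto simp: frac_kernel_def omega_def\<close>)
qed

text \<open>The fractional oscillator \<open>y\<close> and its Caputo derivative \<open>v\<close> of
  order \<open>\<nu>\<close>, with two classical derivatives at positive times and bounds whose dependence
  on \<open>lam\<close> is explicit. The equation for \<open>y\<close> is the Volterra form of the initial
  value problem \<open>y 0 = 0\<close>, \<open>y' 0 = 1\<close>. The last clause states that the Caputo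
  derivative of \<open>v\<close> is \<open>omega (2 - 2 * \<nu>) - lam * y\<close>: the derivative of order
  \<open>2 * \<nu>\<close> of \<open>y\<close> differs from the iterated derivative of order
  \<open>\<nu>\<close> by the contribution of \<open>y' 0 = 1\<close>, which is also the right-hand side of
  the scheme. The conditionals extend \<open>y1\<close> and \<open>v1\<close> by zero, so that the
  integrals start at time 0.\<close>

definition oscillator_mode ::
  "real \<Rightarrow> real \<Rightarrow> real \<Rightarrow> (real \<Rightarrow> real) \<Rightarrow> (real \<Rightarrow> real) \<Rightarrow> (real \<Rightarrow> real) \<Rightarrow>
   (real \<Rightarrow> real) \<Rightarrow> (real \<Rightarrow> real) \<Rightarrow> (real \<Rightarrow> real) \<Rightarrow> bool" where
  "oscillator_mode \<nu> C lam y y1 y2 v v1 v2 \<longleftrightarrow>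
     y \<in> borel_measurable borel \<and> (\<forall>t\<le>0. y t = 0 \<and> v t = 0) \<and>
     continuous_on {0..} y \<and> continuous_on {0..} v \<and>
     (\<forall>t>0. (y has_real_derivative y1 t) (at t) \<and> (y1 has_real_derivative y2 t) (at t) \<and>
            (v has_real_derivative v1 t) (at t) \<and> (v1 has_real_derivative v2 t) (at t) \<and>
            \<bar>y2 t\<bar> \<le> C * lam powr (- (1 / 4)) * t powr (- (1 + \<nu> / 2)) \<and>
            \<bar>v2 t\<bar> \<le> C * t powr (- (1 + \<nu>)) \<and>
            y t + lam * frac_int (2 * \<nu>) y t = t \<and>
            has_bochner_integral lborel (\<lambda>s. frac_kernel (1 - \<nu>) (t - s) * (if 0 < s then y1 s else 0)) (v t) \<and>
            has_bochner_integral lborel (\<lambda>s. frac_kernel (1 - \<nu>) (t - s) * (if 0 < s then v1 s else 0))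
              (omega (2 - 2 * \<nu>) t - lam * y t))"

text \<open>Integrating the kernels \<open>H\<close> and \<open>n\<close> of
  \<open>oscillator_kernels\<close> twice gives \<open>y\<close> and \<open>v\<close>. Every identity of
  \<open>oscillator_mode\<close> then becomes, by the semigroup law, an identity between fractional
  integrals of \<open>H\<close> and \<open>n\<close> of order at least 1; these are continuous, so
  comparing Laplace transforms proves them at every time.\<close>

lemma oscillator_modes:
  assumes \<nu>: "1 / 2 < \<nu>" "\<nu> < 1"
  shows "\<exists>C>0. \<forall>lam>0. \<exists>y y1 y2 v v1 v2. oscillator_mode \<nu> C lam y y1 y2 v v1 v2"
proof -
  interpret oscillator_sector \<nu> by unfold_locales (fact \<nu>)+
  obtain C0 where C0: "0 < C0" and ker: "\<And>lam. 0 < lam \<Longrightarrow> \<exists>H n.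
     has_laplace H (\<lambda>p. lam / (p powr (2 * \<nu>) + lam)) \<and> (\<forall>t>0. isCont H t) \<and>
     (\<forall>t>0. \<bar>H t\<bar> \<le> C0 * lam powr (- (1 / 4)) * t powr (- (1 + \<nu> / 2))) \<and>
     has_laplace n (\<lambda>p. lam * p powr \<nu> / (p powr (2 * \<nu>) + lam)) \<and> (\<forall>t>0. isCont n t) \<and>
     (\<forall>t>0. \<bar>n t\<bar> \<le> C0 * t powr (- (1 + \<nu>)))"
    using oscillator_kernels by blast
  define K where "K = \<nu> / Gamma (1 - \<nu>)"
  have K: "0 \<le> K" using \<nu> by (simp add: K_def Gamma_real_pos less_imp_le)
  have "\<exists>y y1 y2 v v1 v2. oscillator_mode \<nu> (C0 + K) lam y y1 y2 v v1 v2" if lam: "0 < lam" for lam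
  proof -
    obtain H n where H: "has_laplace H (\<lambda>p. lam / (p powr (2 * \<nu>) + lam))" "\<And>t. 0 < t \<Longrightarrow> isCont H t"
        "\<And>t. 0 < t \<Longrightarrow> \<bar>H t\<bar> \<le> C0 * lam powr (- (1 / 4)) * t powr (- (1 + \<nu> / 2))"
      and n: "has_laplace n (\<lambda>p. lam * p powr \<nu> / (p powr (2 * \<nu>) + lam))" "\<And>t. 0 < t \<Longrightarrow> isCont n t"
        "\<And>t. 0 < t \<Longrightarrow> \<bar>n t\<bar> \<le> C0 * t powr (- (1 + \<nu>))"
      using ker[OF lam] by blast
    define y where "y = (\<lambda>t. frac_kernel 2 t - frac_int 2 H t)"
    define y1 where "y1 = (\<lambda>t. frac_kernel 1 t - frac_int 1 H t)"
    define v where "v = (\<lambda>t. frac_kernel (2 - \<nu>) t - frac_int 2 n t)"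
    define v1 where "v1 = (\<lambda>t. frac_kernel (1 - \<nu>) t - frac_int 1 n t)"
    define v2 where "v2 = (\<lambda>t. - \<nu> / Gamma (1 - \<nu>) * t powr (- \<nu> - 1) - n t)"
    have Hn2: "frac_int 2 H = frac_int 1 (frac_int 1 H)" "frac_int 2 n = frac_int 1 (frac_int 1 n)"
      using has_laplace_frac_int_semigroup(1)[OF H(1), of 1 1] has_laplace_frac_int_semigroup(1)[OF n(1), of 1 1] by auto
    have ylap: "has_laplace y (\<lambda>p. p powr (- 2) - p powr (- 2) * (lam / (p powr (2 * \<nu>) + lam)))"
      unfolding y_def by (intro has_laplace_diff has_laplace_frac_kernel has_laplace_frac_int H(1)) auto
    have yC: "continuous_on {0..} y"
      unfolding y_def by (intro continuous_intros continuous_on_frac_kernel has_laplace_frac_int_continuous[OF H(1)]) auto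
    have vC: "continuous_on {0..} v"
      unfolding v_def using \<nu> by (intro continuous_intros continuous_on_frac_kernel has_laplace_frac_int_continuous[OF n(1)]) auto
    have den: "p powr (2 * \<nu>) + lam > 0" for p using lam by (intro add_nonneg_pos) auto
    have pw: "p powr (a + b) = p powr a * p powr b" for p a b :: real by (rule powr_add)
    have volt: "y t + lam * frac_int (2 * \<nu>) y t = frac_kernel 2 t" if t: "0 < t" for t
    proof (rule has_laplace_unique[OF has_laplace_add[OF ylap has_laplace_cmult[OF has_laplace_frac_int[OF _ ylap]]] has_laplace_frac_kernel])
      fix p :: real assume p: "0 < p"
      define P Q R where "P = p powr (2 * \<nu>)" and "Q = p powr (- 2)" and "R = p powr (- (2 * \<nu>))"
      have "P * R = 1" using p by (simp add: P_def R_def flip: powr_add)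
      then have "P * (1 + lam * R) = P + lam" by (simp add: algebra_simps)
      then have "P / (P + lam) * (1 + lam * R) = 1" using den[of p] by (simp add: P_def)
      moreover have "Q - Q * (lam / (P + lam)) = Q * (P / (P + lam))"
        using den[of p] by (simp add: P_def field_simps)
      ultimately have "(Q - Q * (lam / (P + lam))) * (1 + lam * R) = Q" by (simp only: mult.assoc mult_1_right)
      moreover define A where A: "A = Q - Q * (lam / (P + lam))"
      ultimately have "A * (1 + lam * R) = Q" by (simp only:)
      then have "A + lam * (R * A) = Q" by (simp add: algebra_simps)
      then show "p powr - 2 - p powr - 2 * (lam / (p powr (2 * \<nu>) + lam)) +
         lam * (p powr - (2 * \<nu>) * (p powr - 2 - p powr - 2 * (lam / (p powr (2 * \<nu>) + lam)))) = p powr - 2"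
        by (simp only: A P_def Q_def R_def)
    next
      fix t :: real assume t: "0 < t"
      have "isCont y t" using yC t by (intro continuous_on_interior[of "{0..}"]) auto
      then show "isCont (\<lambda>t. y t + lam * frac_int (2 * \<nu>) y t) t"
        using \<nu> t by (intro continuous_intros isCont_frac_int[OF ylap]) auto
      show "isCont (frac_kernel 2) t" using t by (intro isCont_frac_kernel) auto
    qed (use \<nu> in auto)
    \<comment> \<open>These two identities express that \<open>v\<close> is the Caputo derivative of
      \<open>y\<close>, and that the one of \<open>v\<close> contains \<open>- lam * y\<close>.\<close>
    have Heq: "frac_int (2 - \<nu>) H t = frac_int 2 n t" for t
    proof (rule has_laplace_unique[OF has_laplace_frac_int[OF _ H(1)] has_laplace_frac_int[OF _ n(1)]])
      fix p :: real assume p: "0 < p"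
      have "p powr (- (2 - \<nu>)) = p powr (- 2) * p powr \<nu>" by (simp flip: powr_add)
      then show "p powr - (2 - \<nu>) * (lam / (p powr (2 * \<nu>) + lam)) = p powr - 2 * (lam * p powr \<nu> / (p powr (2 * \<nu>) + lam))"
        by simp
    qed (use \<nu> in \<open>auto intro!: isCont_frac_int[OF H(1)] isCont_frac_int[OF n(1)]\<close>)
    have neq: "frac_int (2 - \<nu>) n t = lam * y t" for t
    proof (rule has_laplace_unique[OF has_laplace_frac_int[OF _ n(1)] has_laplace_cmult[OF ylap]])
      fix p :: real assume p: "0 < p"
      have "p powr (- (2 - \<nu>)) = p powr (- 2) * p powr \<nu>" "p powr (2 * \<nu>) = p powr \<nu> * p powr \<nu>" by (simp_all flip: powr_add)
      then show "p powr - (2 - \<nu>) * (lam * p powr \<nu> / (p powr (2 * \<nu>) + lam)) = lam * (p powr - 2 - p powr - 2 * (lam / (p powr (2 * \<nu>) + lam)))"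
        using den[of p] by (simp add: field_simps)
    next
      fix t :: real assume t: "0 < t"
      then show "isCont (frac_int (2 - \<nu>) n) t" using \<nu> by (intro isCont_frac_int[OF n(1)]) auto
      have "isCont y t" using yC t by (intro continuous_on_interior[of "{0..}"]) auto
      then show "isCont (\<lambda>t. lam * y t) t" by (intro continuous_intros)
    qed (use \<nu> in auto)
    have y1z: "(if 0 < s then y1 s else 0) = y1 s" "(if 0 < s then v1 s else 0) = v1 s" for s
      using frac_int_nonpos[OF has_laplaceD(2)[OF H(1)], where t = s and b = 1] frac_int_nonpos[OF has_laplaceD(2)[OF n(1)], where t = s and b = 1]
      by (auto simp: y1_def v1_def frac_kernel_def)
    have D1: "(frac_kernel 2 has_real_derivative frac_kernel 1 t) (at t)" if "0 < t" for t
      using frac_kernel_deriv[of t 1] that by (simp add: frac_kernel_def omega_def Gamma_numeral)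
    have D2: "(frac_kernel 1 has_real_derivative 0) (at t)" if "0 < t" for t
      by (rule has_field_derivative_transform_within_open[of "\<lambda>_. 1" _ _ "{0<..}"]) (use that in \<open>auto simp: frac_kernel_def omega_def\<close>)
    have D3: "(frac_kernel (2 - \<nu>) has_real_derivative frac_kernel (1 - \<nu>) t) (at t)" if "0 < t" for t
    proof -
      have "Gamma (1 - \<nu> + 1) = (1 - \<nu>) * Gamma (1 - \<nu>)" using \<nu> by (intro Gamma_plus1) (auto dest: nonpos_Ints_nonpos)
      then show ?thesis
        using frac_kernel_deriv[of t "1 - \<nu>"] that \<nu> by (simp add: frac_kernel_def omega_def)
    qed
    have D4: "(frac_kernel (1 - \<nu>) has_real_derivative - \<nu> / Gamma (1 - \<nu>) * t powr (- \<nu> - 1)) (at t)" if "0 < t" for t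
      using frac_kernel_deriv[of t "- \<nu>"] that \<nu> by simp
    have "oscillator_mode \<nu> (C0 + K) lam y y1 (\<lambda>t. - H t) v v1 v2"
      unfolding oscillator_mode_def
    proof (intro conjI allI impI)
      show "y \<in> borel_measurable borel" using has_laplaceD(1)[OF ylap] .
      fix t :: real
      show "y t = 0" if "t \<le> 0" using has_laplaceD(2)[OF ylap that] .
      show "v t = 0" if "t \<le> 0" using that has_laplaceD(2)[OF has_laplace_frac_int[OF _ n(1)], of 2]
        by (simp add: v_def frac_kernel_def)
      show "continuous_on {0..} y" "continuous_on {0..} v" by fact+
      assume t: "0 < t"
      show "(y has_real_derivative y1 t) (at t)"
        unfolding y_def y1_def Hn2 using t
        by (intro DERIV_diff D1 has_laplace_frac_int_deriv[OF has_laplace_frac_int[OF _ H(1)]] isCont_frac_int[OF H(1)]) auto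
      show "(y1 has_real_derivative - H t) (at t)"
        using DERIV_diff[OF D2[OF t] has_laplace_frac_int_deriv[OF H(1) t H(2)[OF t]]] by (simp add: y1_def)
      show "(v has_real_derivative v1 t) (at t)"
        unfolding v_def v1_def Hn2 using t
        by (intro DERIV_diff D3 has_laplace_frac_int_deriv[OF has_laplace_frac_int[OF _ n(1)]] isCont_frac_int[OF n(1)]) auto
      show "(v1 has_real_derivative v2 t) (at t)"
        using DERIV_diff[OF D4[OF t] has_laplace_frac_int_deriv[OF n(1) t n(2)[OF t]]] by (simp add: v1_def v2_def)
      have "\<bar>- H t\<bar> \<le> C0 * (lam powr (- (1 / 4)) * t powr (- (1 + \<nu> / 2)))" using H(3)[OF t] by simp
      also have "\<dots> \<le> (C0 + K) * (lam powr (- (1 / 4)) * t powr (- (1 + \<nu> / 2)))"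
        using K by (intro mult_right_mono) auto
      finally show "\<bar>- H t\<bar> \<le> (C0 + K) * lam powr (- (1 / 4)) * t powr (- (1 + \<nu> / 2))" by simp
      have "\<bar>v2 t\<bar> \<le> K * t powr (- (1 + \<nu>)) + C0 * t powr (- (1 + \<nu>))"
      proof -
        have "- (1 + \<nu>) = - \<nu> - 1" by simp
        then have "- \<nu> / Gamma (1 - \<nu>) * t powr (- \<nu> - 1) = - (K * t powr (- (1 + \<nu>)))"
          by (simp only: K_def minus_divide_left mult_minus_left)
        moreover have "0 \<le> K * t powr (- (1 + \<nu>))" using K by simp
        ultimately show ?thesis using n(3)[OF t] unfolding v2_def by linarith
      qed
      then show "\<bar>v2 t\<bar> \<le> (C0 + K) * t powr (- (1 + \<nu>))" by (simp add: algebra_simps)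
      show "y t + lam * frac_int (2 * \<nu>) y t = t"
        using volt[OF t] t by (simp add: frac_kernel_def omega_def Gamma_numeral)
      have 1: "integrable lborel (\<lambda>s. frac_kernel (1 - \<nu>) (t - s) * frac_kernel 1 s)"
        "integrable lborel (\<lambda>s. frac_kernel (1 - \<nu>) (t - s) * frac_kernel (1 - \<nu>) s)"
        using \<nu> by (auto intro: frac_kernel_integrable)
      have 2: "integrable lborel (\<lambda>s. frac_kernel (1 - \<nu>) (t - s) * frac_int 1 H s)"
        "integrable lborel (\<lambda>s. frac_kernel (1 - \<nu>) (t - s) * frac_int 1 n s)"
        using \<nu> has_laplace_frac_int_semigroup(2)[OF H(1), of "1 - \<nu>" 1 t] has_laplace_frac_int_semigroup(2)[OF n(1), of "1 - \<nu>" 1 t] by auto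
      have 3: "frac_int (1 - \<nu>) (frac_int 1 H) t = frac_int (2 - \<nu>) H t" "frac_int (1 - \<nu>) (frac_int 1 n) t = frac_int (2 - \<nu>) n t"
        using \<nu> has_laplace_frac_int_semigroup(1)[OF H(1), of "1 - \<nu>" 1] has_laplace_frac_int_semigroup(1)[OF n(1), of "1 - \<nu>" 1] by auto
      have 4: "frac_int (1 - \<nu>) (frac_kernel 1) t = frac_kernel (2 - \<nu>) t" "frac_int (1 - \<nu>) (frac_kernel (1 - \<nu>)) t = frac_kernel (2 - 2 * \<nu>) t"
        using \<nu> by (simp_all add: frac_int_kernel)
      show "has_bochner_integral lborel (\<lambda>s. frac_kernel (1 - \<nu>) (t - s) * (if 0 < s then y1 s else 0)) (v t)"
        unfolding y1z using frac_int_diff[OF 1(1) 2(1)] 3 4 Heq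
        by (simp add: has_bochner_integral_iff frac_int_def[symmetric] v_def y1_def)
      have "frac_kernel (2 - 2 * \<nu>) t = omega (2 - 2 * \<nu>) t" using t by (simp add: frac_kernel_def)
      then show "has_bochner_integral lborel (\<lambda>s. frac_kernel (1 - \<nu>) (t - s) * (if 0 < s then v1 s else 0)) (omega (2 - 2 * \<nu>) t - lam * y t)"
        unfolding y1z using frac_int_diff[OF 1(2) 2(2)] 3 4 neq
        by (simp add: has_bochner_integral_iff frac_int_def[symmetric] v1_def)
    qed
    then show ?thesis by blast
  qed
  moreover have "0 < C0 + K" using C0 K by simp
  ultimately show ?thesis by blast
qed

section \<open>Graded meshes\<close>

lemma omega_antimono:
  assumes "0 < \<nu>" "\<nu> < 1" "0 < x" "x \<le> y"
  shows "omega (1 - \<nu>) y \<le> omega (1 - \<nu>) x"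
  using assms unfolding omega_def
  by (intro divide_right_mono powr_mono2') (auto intro: less_imp_le Gamma_real_pos)

lemma omega_nonneg: "0 < p \<Longrightarrow> 0 \<le> omega p x"
  by (simp add: omega_def Gamma_real_pos less_imp_le)

lemma has_integral_omega:
  assumes \<nu>: "0 < \<nu>" "\<nu> < 1" and "a \<le> b" "b \<le> s"
  shows "((\<lambda>x. omega (1 - \<nu>) (s - x)) has_integral (omega (2 - \<nu>) (s - a) - omega (2 - \<nu>) (s - b))) {a..b}"
proof -
  have "Gamma (1 - \<nu> + 1) = (1 - \<nu>) * Gamma (1 - \<nu>)"
    using \<nu> by (intro Gamma_plus1) (auto dest: nonpos_Ints_nonpos)
  moreover have "Gamma (1 - \<nu>) > 0" using \<nu> by (intro Gamma_real_pos) auto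
  ultimately have G: "Gamma (2 - \<nu>) = (1 - \<nu>) * Gamma (1 - \<nu>)" "Gamma (1 - \<nu>) \<noteq> 0"
    by auto
  have "((\<lambda>x. omega (1 - \<nu>) (s - x)) has_integral (- omega (2 - \<nu>) (s - b) - - omega (2 - \<nu>) (s - a))) {a..b}"
  proof (rule fundamental_theorem_of_calculus_interior[OF assms(3)])
    show "continuous_on {a..b} (\<lambda>x. - omega (2 - \<nu>) (s - x))"
      using \<nu> G assms unfolding omega_def
      by (intro continuous_on_minus continuous_on_divide continuous_on_powr' continuous_intros) auto
    fix x assume x: "x \<in> {a<..<b}"
    then have sx: "0 < s - x" using assms by auto
    have "((\<lambda>x. - omega (2 - \<nu>) (s - x)) has_real_derivative omega (1 - \<nu>) (s - x)) (at x)"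
    proof -
      have "((\<lambda>x. (s - x) powr (1 - \<nu>)) has_real_derivative (1 - \<nu>) * (s - x) powr (1 - \<nu> - 1) * (- 1)) (at x)"
        by (rule DERIV_chain2[where f = "\<lambda>u. u powr (1 - \<nu>)" and g = "\<lambda>x. s - x", OF has_real_derivative_powr[OF sx]])
          (auto intro!: derivative_eq_intros)
      from DERIV_minus[OF DERIV_cdivide[OF this, of "Gamma (2 - \<nu>)"]]
      show ?thesis using G \<nu> by (simp add: omega_def)
    qed
    then show "((\<lambda>x. - omega (2 - \<nu>) (s - x)) has_vector_derivative omega (1 - \<nu>) (s - x)) (at x)"
      by (simp add: has_real_derivative_iff_has_vector_derivative)
  qed
  then show ?thesis by simp
qed

locale graded_time_mesh =
  fixes T r :: real and N :: nat
  assumes T: "0 < T" and r: "1 \<le> r" and N: "1 \<le> N"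
begin

abbreviation "t \<equiv> graded_mesh T N r"

lemma mesh_zero [simp]: "t 0 = 0" by (simp add: graded_mesh_def)

lemma mesh_mono: "j \<le> k \<Longrightarrow> t j \<le> t k"
  unfolding graded_mesh_def using T r N
  by (intro mult_left_mono powr_mono2 divide_right_mono) auto

lemma mesh_pos: "1 \<le> k \<Longrightarrow> 0 < t k"
  unfolding graded_mesh_def using T N by simp

lemma mesh_nonneg: "0 \<le> t k"
  unfolding graded_mesh_def using T N by simp

lemma mesh_le_T: "k \<le> N \<Longrightarrow> t k \<le> T"
  using mesh_mono[of k N] N by (simp add: graded_mesh_def)

lemma mesh_ratio: "1 \<le> n \<Longrightarrow> t k = t n * (real k / real n) powr r"
proof -
  assume n: "1 \<le> n"
  have "real k / real N = (real n / real N) * (real k / real n)" using n by simp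
  then have "(real k / real N) powr r = (real n / real N) powr r * (real k / real n) powr r"
    by (simp only: powr_mult)
  then show ?thesis by (simp add: graded_mesh_def)
qed

lemma mesh_strict: "1 \<le> k \<Longrightarrow> t (k - 1) < t k"
proof -
  assume k: "1 \<le> k"
  have "(real (k - 1) / real k) powr r \<le> (real (k - 1) / real k) powr 1"
    using k r by (intro powr_mono') auto
  also have "\<dots> < 1" using k by simp
  finally have "t k * (real (k - 1) / real k) powr r < t k * 1"
    using mesh_pos[OF k] by (intro mult_strict_left_mono) auto
  then show ?thesis using mesh_ratio[OF k, of "k - 1"] by simp
qed

lemma mesh_half: "2 * m \<le> n \<Longrightarrow> 1 \<le> n \<Longrightarrow> t m \<le> t n / 2"
proof -
  assume mn: "2 * m \<le> n" "1 \<le> n"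
  have "(real m / real n) powr r \<le> (real m / real n) powr 1"
    using mn r by (intro powr_mono') (auto simp: field_simps)
  also have "\<dots> \<le> 1 / 2" using mn by (simp add: field_simps)
  finally have "t n * (real m / real n) powr r \<le> t n * (1 / 2)"
    using mesh_nonneg by (intro mult_left_mono) auto
  then show ?thesis using mesh_ratio[OF mn(2), of m] by simp
qed

lemma step_lower: "1 \<le> n \<Longrightarrow> t n / real n \<le> t n - t (n - 1)"
proof -
  assume n: "1 \<le> n"
  have "(real (n - 1) / real n) powr r \<le> (real (n - 1) / real n) powr 1"
    using n r by (intro powr_mono') auto
  also have "\<dots> = 1 - 1 / real n" using n by (simp add: field_simps of_nat_diff)
  finally have "t n * (real (n - 1) / real n) powr r \<le> t n * (1 - 1 / real n)"
    using mesh_nonneg by (intro mult_left_mono) auto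
  then show ?thesis using mesh_ratio[OF n, of "n - 1"] by (simp add: algebra_simps)
qed

lemma step_upper: "2 \<le> k \<Longrightarrow> t k - t (k - 1) \<le> r * t k / real k"
proof -
  assume k: "2 \<le> k"
  define x where "x = real (k - 1) / real k"
  have x: "0 < x" "x < 1" "1 - x = 1 / real k" using k by (auto simp: x_def field_simps of_nat_diff)
  obtain z where z: "x < z" "z < 1" "1 powr r - x powr r = (1 - x) * (r * z powr (r - 1))"
    using MVT2[OF x(2), of "\<lambda>z. z powr r" "\<lambda>z. r * z powr (r - 1)"] x
    by (force intro!: derivative_eq_intros)
  have "z powr (r - 1) \<le> 1" using z x r by (intro powr_le1) auto
  then have "1 - x powr r \<le> (1 - x) * (r * 1)" unfolding z(3)[simplified]
    using x r by (intro mult_left_mono) auto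
  then have "t k * (1 - x powr r) \<le> t k * (r / real k)"
    using mesh_nonneg[of k] by (intro mult_left_mono) (auto simp: x(3))
  moreover have "t (k - 1) = t k * x powr r" using mesh_ratio[of k "k - 1"] k by (simp only: x_def)
  ultimately show ?thesis by (simp add: right_diff_distrib mult.commute)
qed

lemma mesh_prev_lower: "2 \<le> k \<Longrightarrow> (1 / 2) powr r * t k \<le> t (k - 1)"
proof -
  assume k: "2 \<le> k"
  have "(1 / 2) powr r \<le> (real (k - 1) / real k) powr r"
    using k r by (intro powr_mono2) (auto simp: field_simps of_nat_diff)
  then have "t k * (1 / 2) powr r \<le> t k * (real (k - 1) / real k) powr r"
    using mesh_nonneg by (intro mult_left_mono) auto
  then show ?thesis using mesh_ratio[of k "k - 1"] k by (simp add: mult.commute)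
qed

text \<open>Where the two exponents of the rate come from: the grading turns \<open>t k powr s\<close>
  into \<open>(k / N) powr (r * s)\<close>, and both this power and the decay in \<open>k\<close> may be
  weakened to the common exponent \<open>q\<close>.\<close>

lemma mesh_power_bound:
  assumes k: "1 \<le> k" "k \<le> N" and s: "0 < s" and q: "q = min (r * s) m" and m: "0 < m"
  shows "t k powr s * real k powr (- m) \<le> T powr s * real N powr (- q)"
proof -
  have q0: "0 \<le> q" "q \<le> r * s" "q \<le> m" using q s m r by auto
  have "t k powr s = T powr s * (real k / real N) powr (r * s)"
    using T by (simp add: graded_mesh_def powr_mult powr_powr)
  moreover have "(real k / real N) powr (r * s) \<le> (real k / real N) powr q"
    using k q0 by (intro powr_mono') auto
  moreover have "real k powr (- m) \<le> real k powr (- q)" using k q0 by (intro powr_mono) auto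
  moreover have "(real k / real N) powr q * real k powr (- q) = real N powr (- q)"
    using k by (simp add: powr_divide powr_minus field_simps)
  ultimately show ?thesis
    using mult_mono[of "(real k / real N) powr (r * s)" "(real k / real N) powr q" "real k powr (- m)" "real k powr (- q)"]
    by (simp add: mult.assoc mult_left_mono)
qed

text \<open>The sum over all cells would telescope to the singular value of the kernel near \<open>t
  n\<close>. For \<open>k \<le> n / 2\<close> the kernel is still of size \<open>t n powr (-
  \<nu>)\<close>; for larger \<open>k\<close> the weight \<open>k powr (- \<nu>)\<close> compensates the
  singular value, since \<open>t n - t (n - 1)\<close> is at least \<open>t n / n\<close>.\<close>

lemma kernel_jump_sum:
  assumes \<nu>: "0 < \<nu>" "\<nu> < 1" and n: "1 \<le> n"
  shows "(\<Sum>k\<in>{2..<n}. (omega (1 - \<nu>) (t n - t k) - omega (1 - \<nu>) (t n - t (k - 1))) * real k powr (- \<nu>))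
    \<le> 2 * 2 powr \<nu> / Gamma (1 - \<nu>) * t n powr (- \<nu>)"
proof (cases "2 \<le> n")
  case False
  then have "{2..<n} = {}" by auto
  then show ?thesis using \<nu> by (simp add: Gamma_real_pos less_imp_le)
next
  case True
  define W where "W = (\<lambda>k. omega (1 - \<nu>) (t n - t k))"
  define D where "D = (\<lambda>k. W k - W (k - 1))"
  have G: "Gamma (1 - \<nu>) > 0" using \<nu> by (intro Gamma_real_pos) auto
  have lt: "t k < t n" if "k < n" for k
  proof -
    have "t k \<le> t (n - 1)" using that by (intro mesh_mono) auto
    then show ?thesis using mesh_strict[OF n] by linarith
  qed
  have W0: "0 \<le> W k" for k unfolding W_def using \<nu> by (intro omega_nonneg) auto
  have D0: "0 \<le> D k" if "k < n" for k
    unfolding D_def W_def using omega_antimono[OF \<nu>, of "t n - t k" "t n - t (k - 1)"] lt[OF that] mesh_mono[of "k - 1" k] by auto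
  have tel: "(\<Sum>k\<in>{2..m}. D k) = W m - W 1" if "1 \<le> m" for m
    using that by (induction m rule: dec_induct) (auto simp: D_def)
  \<comment> \<open>The jumps up to \<open>m\<close> are summed without their weight, the others with the
    uniform weight at \<open>n / 2\<close>.\<close>
  define m where "m = n div 2"
  have m: "1 \<le> m" "2 * m \<le> n" "m < n" using True by (auto simp: m_def)
  have "(\<Sum>k\<in>{2..<n}. D k * real k powr (- \<nu>)) \<le> (\<Sum>k\<in>{2..<n}. (if k \<le> m then D k else 0) + D k * (2 powr \<nu> * real n powr (- \<nu>)))"
  proof (rule sum_mono)
    fix k assume k: "k \<in> {2..<n}"
    show "D k * real k powr (- \<nu>) \<le> (if k \<le> m then D k else 0) + D k * (2 powr \<nu> * real n powr (- \<nu>))"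
    proof (cases "k \<le> m")
      case True
      have "real k powr (- \<nu>) \<le> 1" using powr_mono[of "- \<nu>" 0 "real k"] k \<nu> by simp
      then have "D k * real k powr (- \<nu>) \<le> D k * 1" using D0[of k] k by (intro mult_left_mono) auto
      moreover have "0 \<le> D k * (2 powr \<nu> * real n powr (- \<nu>))" using D0[of k] k by simp
      ultimately show ?thesis using True by simp
    next
      case False
      then have "real n / 2 \<le> real k" unfolding m_def by linarith
      then have "real k powr (- \<nu>) \<le> (real n / 2) powr (- \<nu>)" using True \<nu> by (intro powr_mono2') auto
      also have "\<dots> = 2 powr \<nu> * real n powr (- \<nu>)" using True by (simp add: powr_divide powr_minus field_simps)
      finally show ?thesis using False D0[of k] k by (simp add: mult_left_mono)
    qed
  qed
  also have "\<dots> = (\<Sum>k\<in>{2..m}. D k) + (\<Sum>k\<in>{2..<n}. D k) * (2 powr \<nu> * real n powr (- \<nu>))"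
  proof -
    have "(\<Sum>k\<in>{2..<n}. (if k \<le> m then D k else 0)) = (\<Sum>k\<in>{2..m}. D k)"
      using m by (intro sum.mono_neutral_cong_right) auto
    then show ?thesis by (simp add: sum.distrib sum_distrib_right)
  qed
  also have "\<dots> \<le> W m + W (n - 1) * (2 powr \<nu> * real n powr (- \<nu>))"
  proof -
    have "{2..<n} = {2..n - 1}" using True by auto
    then have "(\<Sum>k\<in>{2..<n}. D k) \<le> W (n - 1)" using tel[of "n - 1"] True W0[of 1] by simp
    moreover have "(\<Sum>k\<in>{2..m}. D k) \<le> W m" using tel[OF m(1)] W0[of 1] by simp
    ultimately show ?thesis by (intro add_mono mult_right_mono) auto
  qed
  also have "\<dots> \<le> 2 powr \<nu> / Gamma (1 - \<nu>) * t n powr (- \<nu>) + 2 powr \<nu> / Gamma (1 - \<nu>) * t n powr (- \<nu>)"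
  proof (rule add_mono)
    have "W m \<le> omega (1 - \<nu>) (t n / 2)"
      unfolding W_def using mesh_half[OF m(2) n] mesh_pos[OF n] by (intro omega_antimono \<nu>) auto
    also have "\<dots> = 2 powr \<nu> / Gamma (1 - \<nu>) * t n powr (- \<nu>)"
      using mesh_pos[OF n] by (simp add: omega_def powr_divide powr_minus field_simps)
    finally show "W m \<le> 2 powr \<nu> / Gamma (1 - \<nu>) * t n powr (- \<nu>)" .
    have "W (n - 1) \<le> omega (1 - \<nu>) (t n / real n)"
      unfolding W_def using step_lower[OF n] mesh_pos[OF n] n by (intro omega_antimono \<nu>) auto
    also have "\<dots> = t n powr (- \<nu>) * real n powr \<nu> / Gamma (1 - \<nu>)"
      using mesh_pos[OF n] n by (simp add: omega_def powr_divide powr_minus field_simps)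
    finally have "W (n - 1) * (2 powr \<nu> * real n powr (- \<nu>)) \<le> t n powr (- \<nu>) * real n powr \<nu> / Gamma (1 - \<nu>) * (2 powr \<nu> * real n powr (- \<nu>))"
      by (intro mult_right_mono) auto
    also have "\<dots> = 2 powr \<nu> / Gamma (1 - \<nu>) * t n powr (- \<nu>)"
      using n by (simp add: powr_minus field_simps)
    finally show "W (n - 1) * (2 powr \<nu> * real n powr (- \<nu>)) \<le> 2 powr \<nu> / Gamma (1 - \<nu>) * t n powr (- \<nu>)" .
  qed
  finally show ?thesis by (simp add: D_def W_def)
qed

end

text \<open>In the first cell the derivative may blow up at 0; it still differs from the difference
  quotient by no more than its own singularity. Both estimates below show that a function corrected by a
  suitable power is monotone.\<close>

lemma power_singularity_increment:
  fixes y y1 y2 :: "real \<Rightarrow> real"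
  assumes \<sigma>: "0 < \<sigma>" "\<sigma> < 1" and cont: "continuous_on {0..} y"
    and d1: "\<And>s. 0 < s \<Longrightarrow> (y has_real_derivative y1 s) (at s)"
    and d2: "\<And>s. 0 < s \<Longrightarrow> (y1 has_real_derivative y2 s) (at s)"
    and b: "\<And>s. 0 < s \<Longrightarrow> \<bar>y2 s\<bar> \<le> K * s powr (\<sigma> - 2)" and s: "0 < s" "s \<le> h"
  shows "\<bar>(y h - y 0) / h - y1 s\<bar> \<le> 2 * K / (\<sigma> * (1 - \<sigma>)) * s powr (\<sigma> - 1)"
proof -
  have K: "0 \<le> K" using b[of 1] abs_ge_zero[of "y2 1"] by simp
  have h: "0 < h" using s by simp
  have mono1: "\<bar>y1 h - y1 x\<bar> \<le> K / (1 - \<sigma>) * x powr (\<sigma> - 1)" if x: "0 < x" "x \<le> h" for x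
  proof -
    have d: "((\<lambda>x. e * y1 x + K / (1 - \<sigma>) * x powr (\<sigma> - 1)) has_real_derivative e * y2 u - K * u powr (\<sigma> - 2)) (at u)" if "0 < u" for u e
    proof -
      have "((\<lambda>x. e * y1 x + K / (1 - \<sigma>) * x powr (\<sigma> - 1)) has_real_derivative e * y2 u + K / (1 - \<sigma>) * ((\<sigma> - 1) * u powr (\<sigma> - 1 - 1))) (at u)"
        using that \<sigma> d2[OF that] by (auto intro!: derivative_eq_intros)
      moreover have "K / (1 - \<sigma>) * ((\<sigma> - 1) * z) = - (K * z)" for z
        using \<sigma> by (simp add: field_simps)
      ultimately show ?thesis by simp
    qed
    have le: "e * y1 h + K / (1 - \<sigma>) * h powr (\<sigma> - 1) \<le> e * y1 x + K / (1 - \<sigma>) * x powr (\<sigma> - 1)" if e: "\<bar>e\<bar> = 1" for e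
    proof (rule DERIV_nonpos_imp_nonincreasing[OF x(2)])
      fix u assume u: "x \<le> u" "u \<le> h"
      then have u0: "0 < u" using x by simp
      have "e * y2 u \<le> \<bar>y2 u\<bar>" using abs_ge_self[of "e * y2 u"] e by (simp add: abs_mult)
      then have "e * y2 u - K * u powr (\<sigma> - 2) \<le> 0" using b[OF u0] by simp
      then show "\<exists>z. ((\<lambda>x. e * y1 x + K / (1 - \<sigma>) * x powr (\<sigma> - 1)) has_real_derivative z) (at u) \<and> z \<le> 0"
        using d[OF u0] by blast
    qed
    have "0 \<le> K / (1 - \<sigma>) * h powr (\<sigma> - 1)" using K \<sigma> by simp
    then show ?thesis using le[of 1] le[of "-1"] by (simp add: abs_le_iff)
  qed
  define c where "c = K / (\<sigma> * (1 - \<sigma>))"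
  have c0: "0 \<le> c" using K \<sigma> by (simp add: c_def)
  have incr: "\<bar>(y h - h * y1 h) - (y 0 - 0 * y1 h)\<bar> \<le> c * h powr \<sigma>"
  proof -
    have le: "e * (y 0 - 0 * y1 h) + c * 0 powr \<sigma> \<le> e * (y h - h * y1 h) + c * h powr \<sigma>" if e: "\<bar>e\<bar> = 1" for e
    proof (rule DERIV_nonneg_imp_increasing_open[of 0 h "\<lambda>x. e * (y x - x * y1 h) + c * x powr \<sigma>"])
      show "continuous_on {0..h} (\<lambda>x. e * (y x - x * y1 h) + c * x powr \<sigma>)"
        using \<sigma> by (intro continuous_on_add continuous_on_mult continuous_on_diff continuous_on_const continuous_on_id
             continuous_on_powr' continuous_on_subset[OF cont]) auto
      fix x assume x: "0 < x" "x < h"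
      have "((\<lambda>x. e * (y x - x * y1 h) + c * x powr \<sigma>) has_real_derivative e * (y1 x - y1 h) + c * \<sigma> * x powr (\<sigma> - 1)) (at x)"
        using x d1[OF x(1)] by (auto intro!: derivative_eq_intros)
      moreover have "0 \<le> e * (y1 x - y1 h) + c * \<sigma> * x powr (\<sigma> - 1)"
      proof -
        have "- (e * (y1 x - y1 h)) \<le> \<bar>y1 h - y1 x\<bar>"
          using abs_ge_self[of "- (e * (y1 x - y1 h))"] e by (simp add: abs_mult abs_minus_commute)
        moreover have "c * \<sigma> = K / (1 - \<sigma>)" using \<sigma> by (simp add: c_def)
        ultimately show ?thesis using mono1[of x] x by simp
      qed
      ultimately show "\<exists>z. ((\<lambda>x. e * (y x - x * y1 h) + c * x powr \<sigma>) has_real_derivative z) (at x) \<and> 0 \<le> z" by blast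
    qed (use h in auto)
    show ?thesis using le[of 1] le[of "-1"] by (simp add: abs_le_iff)
  qed
  have p: "h powr (\<sigma> - 1) \<le> s powr (\<sigma> - 1)" using s \<sigma> by (intro powr_mono2') auto
  have "\<bar>(y h - y 0) / h - y1 h\<bar> \<le> c * h powr (\<sigma> - 1)"
  proof -
    have "(y h - y 0) / h - y1 h = ((y h - h * y1 h) - (y 0 - 0 * y1 h)) / h" using h by (simp add: field_simps)
    then have "\<bar>(y h - y 0) / h - y1 h\<bar> \<le> c * h powr \<sigma> / h"
      using incr h by (simp only: abs_divide) (auto intro: divide_right_mono)
    also have "c * h powr \<sigma> / h = c * h powr (\<sigma> - 1)" using h by (simp add: powr_diff)
    finally show ?thesis .
  qed
  moreover have "c * h powr (\<sigma> - 1) \<le> c * s powr (\<sigma> - 1)" using p c0 by (intro mult_left_mono) auto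
  moreover have "\<bar>y1 h - y1 s\<bar> \<le> c * s powr (\<sigma> - 1)"
  proof -
    have "K / (1 - \<sigma>) \<le> c" unfolding c_def using K \<sigma> by (intro divide_left_mono) (auto simp: mult_le_cancel_right1)
    then have "K / (1 - \<sigma>) * s powr (\<sigma> - 1) \<le> c * s powr (\<sigma> - 1)" by (intro mult_right_mono) auto
    then show ?thesis using mono1[OF s] by linarith
  qed
  ultimately have "\<bar>(y h - y 0) / h - y1 s\<bar> \<le> 2 * (c * s powr (\<sigma> - 1))" by linarith
  then show ?thesis by (simp add: c_def)
qed

section \<open>Truncation error of the L1 formula\<close>

text \<open>Away from 0 the mean value theorem represents the difference quotient as a value of the
  derivative.\<close>

lemma smooth_increment:
  fixes y y1 y2 :: "real \<Rightarrow> real"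
  assumes \<sigma>: "\<sigma> < 2" and d1: "\<And>s. 0 < s \<Longrightarrow> (y has_real_derivative y1 s) (at s)"
    and d2: "\<And>s. 0 < s \<Longrightarrow> (y1 has_real_derivative y2 s) (at s)"
    and b: "\<And>s. 0 < s \<Longrightarrow> \<bar>y2 s\<bar> \<le> K * s powr (\<sigma> - 2)" and ab: "0 < a" "a < b" and s: "s \<in> {a..b}"
  shows "\<bar>(y b - y a) / (b - a) - y1 s\<bar> \<le> K * a powr (\<sigma> - 2) * (b - a)"
proof -
  have K: "0 \<le> K" using b[of 1] abs_ge_zero[of "y2 1"] by simp
  obtain z where z: "a < z" "z < b" "y b - y a = (b - a) * y1 z"
    using MVT2[OF ab(2), of y y1] d1 ab by (metis less_le_trans)
  then have zeq: "(y b - y a) / (b - a) = y1 z" using ab by simp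
  have "norm (y1 z - y1 s) \<le> K * a powr (\<sigma> - 2) * norm (z - s)"
  proof (rule field_differentiable_bound[of "{a..b}" y1 y2])
    fix x assume x: "x \<in> {a..b}"
    then show "(y1 has_field_derivative y2 x) (at x within {a..b})"
      using d2[of x] ab by (auto intro: has_field_derivative_at_within)
    have "x powr (\<sigma> - 2) \<le> a powr (\<sigma> - 2)" using x ab \<sigma> by (intro powr_mono2') auto
    then have "K * x powr (\<sigma> - 2) \<le> K * a powr (\<sigma> - 2)" using K by (intro mult_left_mono)
    then show "norm (y2 x) \<le> K * a powr (\<sigma> - 2)" using b[of x] x ab by auto
  qed (use z s in auto)
  also have "\<dots> \<le> K * a powr (\<sigma> - 2) * (b - a)" using K z s by (intro mult_left_mono) auto
  finally show ?thesis by (simp add: zeq)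
qed

lemma integral_bound_open:
  fixes f g :: "real \<Rightarrow> real"
  assumes "f integrable_on {a..b}" "(g has_integral G) {a..b}" "\<And>s. s \<in> {a<..<b} \<Longrightarrow> \<bar>f s\<bar> \<le> g s"
  shows "\<bar>integral {a..b} f\<bar> \<le> G"
proof -
  have "norm (integral {a<..<b} f) \<le> integral {a<..<b} g"
    using assms by (intro integral_norm_bound_integral) (auto simp: integrable_on_Icc_iff_Ioo has_integral_Icc_iff_Ioo integrable_on_def)
  moreover have "integral {a<..<b} g = G"
    using integral_unique[OF assms(2)] integral_open_interval_real[of a b g] by simp
  ultimately show ?thesis using integral_open_interval_real[of a b f] by simp
qed

lemma has_integral_lborel_Icc:
  fixes f :: "real \<Rightarrow> real"
  assumes "has_bochner_integral lborel f I" "\<And>s. s \<notin> {a..b} \<Longrightarrow> f s = 0"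
  shows "(f has_integral I) {a..b}"
proof -
  have "(\<lambda>x. if x \<in> {a..b} then f x else 0) = f" using assms(2) by fastforce
  moreover have "(f has_integral I) UNIV"
    using assms(1) has_integral_integral_lborel[of f] by (simp add: has_bochner_integral_iff)
  ultimately show ?thesis using has_integral_restrict_UNIV[of "{a..b}" f I] by simp
qed

text \<open>The first summand is the contribution of the first cell, the two others those of the middle
  cells and of the last cell in \<open>L1_truncation\<close>.\<close>

definition truncation_const :: "real \<Rightarrow> real \<Rightarrow> real \<Rightarrow> real \<Rightarrow> real" where
  "truncation_const T r \<nu> \<sigma> = T powr \<sigma> *
     (2 / (\<sigma> * (1 - \<sigma>)) * Gamma \<sigma> / Gamma (1 - \<nu> + \<sigma>)
      + r * ((1 / 2) powr r) powr (\<sigma> - 2) * (r * (2 * 2 powr \<nu> / Gamma (1 - \<nu>)) + r powr (1 - \<nu>) / Gamma (2 - \<nu>)))"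

lemma truncation_const_nonneg:
  "0 < \<nu> \<Longrightarrow> \<nu> < 1 \<Longrightarrow> 0 < \<sigma> \<Longrightarrow> \<sigma> < 1 \<Longrightarrow> 1 \<le> r \<Longrightarrow> 0 \<le> truncation_const T r \<nu> \<sigma>"
  unfolding truncation_const_def
  by (intro mult_nonneg_nonneg add_nonneg_nonneg divide_nonneg_nonneg) (auto intro: less_imp_le Gamma_real_pos)

context graded_time_mesh
begin

text \<open>The L1 formula replaces the derivative on each cell by its mean. In the first cell the
  derivative is singular, and a Beta integral bounds the error against the kernel. In the middle cells the
  error of the derivative has mean zero, so only the variation of the kernel over the cell matters, which
  \<open>kernel_jump_sum\<close> adds up. In the last cell the kernel is singular but the derivative is
  smooth.\<close>

lemma L1_truncation:
  assumes \<nu>: "0 < \<nu>" "\<nu> < 1" and \<sigma>: "0 < \<sigma>" "\<sigma> < 1" and n: "1 \<le> n" "n \<le> N"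
    and cont: "continuous_on {0..} y"
    and d1: "\<And>s. 0 < s \<Longrightarrow> (y has_real_derivative y1 s) (at s)"
    and d2: "\<And>s. 0 < s \<Longrightarrow> (y1 has_real_derivative y2 s) (at s)"
    and b: "\<And>s. 0 < s \<Longrightarrow> \<bar>y2 s\<bar> \<le> K * s powr (\<sigma> - 2)"
    and caputo: "has_bochner_integral lborel (\<lambda>s. frac_kernel (1 - \<nu>) (t n - s) * (if 0 < s then y1 s else 0)) I"
    and q: "q = min (r * \<sigma>) (2 - \<nu>)"
  shows "\<bar>(\<Sum>k = 1..n. L1_weight \<nu> t n (n - k) * (y (t k) - y (t (k - 1)))) - I\<bar>
    \<le> K * truncation_const T r \<nu> \<sigma> * t n powr (- \<nu>) * real N powr (- q)"
proof -
  have K: "0 \<le> K" using b[of 1] abs_ge_zero[of "y2 1"] by simp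
  define yy where "yy = (\<lambda>s. if 0 < s then y1 s else 0)"
  define w where "w = (\<lambda>s. omega (1 - \<nu>) (t n - s))"
  define f where "f = (\<lambda>s. frac_kernel (1 - \<nu>) (t n - s) * yy s)"
  define \<delta> where "\<delta> = (\<lambda>k. (y (t k) - y (t (k - 1))) / (t k - t (k - 1)))"
  define e where "e = (\<lambda>k. integral {t (k - 1)..t k} (\<lambda>s. w s * (\<delta> k - yy s)))"
  define R where "R = t n powr (- \<nu>) * (T powr \<sigma> * real N powr (- q))"
  have R0: "0 \<le> R" by (simp add: R_def)
  have Gpos: "0 < Gamma (1 - \<nu>)" "0 < Gamma (2 - \<nu>)" "0 < Gamma \<sigma>" "0 < Gamma (1 - \<nu> + \<sigma>)"
    using \<nu> \<sigma> by (auto intro: Gamma_real_pos)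
  have fI: "(f has_integral I) {0..t n}"
    using caputo by (intro has_integral_lborel_Icc) (auto simp: f_def yy_def frac_kernel_def)
  have fw: "f s = w s * yy s" if "s \<le> t n" for s
    using that by (auto simp: f_def w_def frac_kernel_def omega_def)
  have Ik: "{t (k - 1)..t k} \<subseteq> {0..t n}" if "k \<le> n" for k
    using mesh_nonneg[of "k - 1"] mesh_mono[OF that] by auto
  have f_int: "f integrable_on {t (k - 1)..t k}" if "k \<le> n" for k
    by (rule integrable_on_subinterval[OF has_integral_integrable[OF fI] Ik[OF that]])
  have w_int: "(w has_integral (omega (2 - \<nu>) (t n - t (k - 1)) - omega (2 - \<nu>) (t n - t k))) {t (k - 1)..t k}"
    if "k \<le> n" for k
    unfolding w_def using mesh_mono[of "k - 1" k] mesh_mono[OF that] by (intro has_integral_omega \<nu>) auto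
  have wy_int: "(\<lambda>s. w s * yy s) integrable_on {t (k - 1)..t k}"
    and wy_eq: "integral {t (k - 1)..t k} (\<lambda>s. w s * yy s) = integral {t (k - 1)..t k} f" if "k \<le> n" for k
  proof -
    have eq: "w s * yy s = f s" if "s \<in> {t (k - 1)..t k}" for s using fw[of s] that Ik[OF \<open>k \<le> n\<close>] by auto
    show "(\<lambda>s. w s * yy s) integrable_on {t (k - 1)..t k}"
      using f_int[OF that] by (rule integrable_eq) (simp add: eq)
    show "integral {t (k - 1)..t k} (\<lambda>s. w s * yy s) = integral {t (k - 1)..t k} f"
      by (intro integral_cong eq)
  qed
  have e_int: "(\<lambda>s. w s * (\<delta> k - yy s)) integrable_on {t (k - 1)..t k}"
    and e_eq: "e k = \<delta> k * integral {t (k - 1)..t k} w - integral {t (k - 1)..t k} f" if "k \<le> n" for k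
  proof -
    have wd: "(\<lambda>s. \<delta> k * w s) integrable_on {t (k - 1)..t k}"
      by (rule has_integral_integrable[OF has_integral_mult_right[OF w_int[OF that]]])
    have split: "(\<lambda>s. w s * (\<delta> k - yy s)) = (\<lambda>s. \<delta> k * w s - w s * yy s)" by (auto simp: algebra_simps)
    show "(\<lambda>s. w s * (\<delta> k - yy s)) integrable_on {t (k - 1)..t k}"
      unfolding split using wd wy_int[OF that] by (rule integrable_diff)
    show "e k = \<delta> k * integral {t (k - 1)..t k} w - integral {t (k - 1)..t k} f"
      unfolding e_def split using wd wy_int[OF that] wy_eq[OF that]
      by (simp add: Henstock_Kurzweil_Integration.integral_diff)
  qed
  have sumf: "(\<Sum>k = 1..m. integral {t (k - 1)..t k} f) = integral {0..t m} f" if "m \<le> n" for m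
    using that
  proof (induction m)
    case (Suc m)
    have "f integrable_on {0..t (Suc m)}"
      by (rule integrable_on_subinterval[OF has_integral_integrable[OF fI]]) (use mesh_mono[OF Suc.prems] in simp)
    then have "integral {0..t m} f + integral {t m..t (Suc m)} f = integral {0..t (Suc m)} f"
      using mesh_nonneg mesh_mono[of m "Suc m"] by (intro Henstock_Kurzweil_Integration.integral_combine) auto
    then show ?case using Suc by simp
  qed simp
  have diff: "(\<Sum>k = 1..n. L1_weight \<nu> t n (n - k) * (y (t k) - y (t (k - 1)))) - I = (\<Sum>k = 1..n. e k)"
  proof -
    have "L1_weight \<nu> t n (n - k) * (y (t k) - y (t (k - 1))) = e k + integral {t (k - 1)..t k} f" if "k \<in> {1..n}" for k
    proof -
      have nk: "n - (n - k) = k" using that by auto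
      have "L1_weight \<nu> t n (n - k) = integral {t (k - 1)..t k} w / (t k - t (k - 1))"
        unfolding L1_weight_def Let_def nk w_def by simp
      then show ?thesis using e_eq[of k] that by (simp add: \<delta>_def mult.commute)
    qed
    then have "(\<Sum>k = 1..n. L1_weight \<nu> t n (n - k) * (y (t k) - y (t (k - 1)))) = (\<Sum>k = 1..n. e k + integral {t (k - 1)..t k} f)"
      by (intro sum.cong) auto
    also have "\<dots> = (\<Sum>k = 1..n. e k) + I"
      using sumf[of n] fI by (simp add: sum.distrib integral_unique)
    finally show ?thesis by simp
  qed
  define A1 where "A1 = 2 / (\<sigma> * (1 - \<sigma>)) * Gamma \<sigma> / Gamma (1 - \<nu> + \<sigma>)"
  define B where "B = r * ((1 / 2) powr r) powr (\<sigma> - 2)"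
  have B0: "0 \<le> B" using r by (simp add: B_def)
  have t1: "0 < t 1" by (rule mesh_pos) simp
  have tn: "0 < t n" by (rule mesh_pos[OF n(1)])
  have qT: "t k powr \<sigma> * real k powr (- (2 - \<nu>)) \<le> T powr \<sigma> * real N powr (- q)" if "1 \<le> k" "k \<le> N" for k
    using \<nu> by (intro mesh_power_bound that \<sigma>(1) q) auto
  have e1: "\<bar>e 1\<bar> \<le> K * A1 * R"
  proof -
    define c where "c = 2 * K / (\<sigma> * (1 - \<sigma>)) * Gamma \<sigma> * (t n / t 1) powr (- \<nu>)"
    have c0: "0 \<le> c" using K \<sigma> Gpos by (simp add: c_def)
    have "has_bochner_integral lborel (\<lambda>s. c * (frac_kernel (1 - \<nu>) (t 1 - s) * frac_kernel \<sigma> s)) (c * frac_kernel (1 - \<nu> + \<sigma>) (t 1))"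
      using frac_kernel_convolution[of "1 - \<nu>" \<sigma> "t 1" 0] \<nu> \<sigma> by (intro has_bochner_integral_mult_right) simp
    then have g: "((\<lambda>s. c * (frac_kernel (1 - \<nu>) (t 1 - s) * frac_kernel \<sigma> s)) has_integral c * frac_kernel (1 - \<nu> + \<sigma>) (t 1)) {0..t 1}"
      by (rule has_integral_lborel_Icc) (auto simp: frac_kernel_def)
    have "\<bar>integral {0..t 1} (\<lambda>s. w s * (\<delta> 1 - yy s))\<bar> \<le> c * frac_kernel (1 - \<nu> + \<sigma>) (t 1)"
    proof (rule integral_bound_open[OF _ g])
      show "(\<lambda>s. w s * (\<delta> 1 - yy s)) integrable_on {0..t 1}" using e_int[of 1] n by simp
      fix s assume s: "s \<in> {0<..<t 1}"
      have 1: "\<bar>\<delta> 1 - yy s\<bar> \<le> 2 * K / (\<sigma> * (1 - \<sigma>)) * s powr (\<sigma> - 1)"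
        using power_singularity_increment[OF \<sigma> cont d1 d2 b, of s "t 1"] s by (simp add: \<delta>_def yy_def)
      have le: "t 1 \<le> t n" by (rule mesh_mono[OF n(1)])
      \<comment> \<open>The kernel at level \<open>n\<close> is compared with the kernel at level 1, for which
        the integral is explicit.\<close>
      have "t n / t 1 * (t 1 - s) \<le> t n - s"
      proof -
        have "0 \<le> s * (t n / t 1 - 1)" using s le t1 by (intro mult_nonneg_nonneg) auto
        then show ?thesis using t1 by (simp add: field_simps)
      qed
      then have "w s \<le> omega (1 - \<nu>) (t n / t 1 * (t 1 - s))"
        unfolding w_def using s tn t1 by (intro omega_antimono \<nu>) auto
      also have "\<dots> = (t n / t 1) powr (- \<nu>) * omega (1 - \<nu>) (t 1 - s)"
      proof -
        have "1 - \<nu> - 1 = - \<nu>" by simp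
        then show ?thesis by (simp only: omega_def powr_mult times_divide_eq_right)
      qed
      finally have 2: "w s \<le> (t n / t 1) powr (- \<nu>) * omega (1 - \<nu>) (t 1 - s)" .
      have w0: "0 \<le> w s" unfolding w_def using \<nu> by (intro omega_nonneg) auto
      have "\<bar>w s * (\<delta> 1 - yy s)\<bar> = w s * \<bar>\<delta> 1 - yy s\<bar>" using w0 by (simp add: abs_mult)
      also have "\<dots> \<le> ((t n / t 1) powr (- \<nu>) * omega (1 - \<nu>) (t 1 - s)) * (2 * K / (\<sigma> * (1 - \<sigma>)) * s powr (\<sigma> - 1))"
        using 1 2 w0 by (intro mult_mono) auto
      also have "\<dots> = c * (frac_kernel (1 - \<nu>) (t 1 - s) * frac_kernel \<sigma> s)"
        using s Gpos by (simp add: c_def frac_kernel_def omega_def[of \<sigma>])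
      finally show "\<bar>w s * (\<delta> 1 - yy s)\<bar> \<le> c * (frac_kernel (1 - \<nu>) (t 1 - s) * frac_kernel \<sigma> s)" .
    qed
    then have "\<bar>e 1\<bar> \<le> c * frac_kernel (1 - \<nu> + \<sigma>) (t 1)" by (simp add: e_def)
    also have "\<dots> = K * A1 * (t n powr (- \<nu>) * t 1 powr \<sigma>)"
      using t1 tn by (simp add: c_def A1_def frac_kernel_def omega_def powr_divide powr_minus powr_diff field_simps)
    also have "\<dots> \<le> K * A1 * R"
    proof -
      have "t 1 powr \<sigma> \<le> T powr \<sigma> * real N powr (- q)" using qT[of 1] N by simp
      then show ?thesis unfolding R_def using K \<sigma> Gpos by (intro mult_left_mono) (auto simp: A1_def)
    qed
    finally show ?thesis .
  qed
  have incr: "\<bar>\<delta> k - yy s\<bar> \<le> K * B * t k powr (\<sigma> - 1) / real k" if k: "2 \<le> k" and s: "s \<in> {t (k - 1)..t k}" for k s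
  proof -
    have tk: "0 < t (k - 1)" "t (k - 1) < t k" "0 < t k" using k mesh_strict[of k] by (auto intro: mesh_pos)
    have "\<bar>\<delta> k - yy s\<bar> \<le> K * t (k - 1) powr (\<sigma> - 2) * (t k - t (k - 1))"
      using smooth_increment[OF _ d1 d2 b tk(1,2) s] \<sigma> s tk by (simp add: \<delta>_def yy_def)
    also have "\<dots> \<le> K * ((1 / 2) powr r * t k) powr (\<sigma> - 2) * (r * t k / real k)"
      using K \<sigma> tk mesh_prev_lower[OF k] step_upper[OF k] by (intro mult_mono mult_left_mono powr_mono2') auto
    also have "\<dots> = K * B * (t k powr (\<sigma> - 2) * t k) / real k"
      using tk by (simp add: B_def powr_mult)
    also have "t k powr (\<sigma> - 2) * t k = t k powr (\<sigma> - 1)"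
      using tk powr_mult_base[of "t k" "\<sigma> - 2"] by (simp add: mult.commute)
    finally show ?thesis .
  qed
  define D where "D = (\<lambda>k. omega (1 - \<nu>) (t n - t k) - omega (1 - \<nu>) (t n - t (k - 1)))"
  have mid: "\<bar>e k\<bar> \<le> K * (B * r) * (T powr \<sigma> * real N powr (- q)) * (D k * real k powr (- \<nu>))" if k: "k \<in> {2..<n}" for k
  proof -
    have tk: "0 < t (k - 1)" "t (k - 1) < t k" "0 < t k" using k mesh_strict[of k] by (auto intro: mesh_pos)
    have ktn: "t k < t n" using mesh_strict[OF n(1)] mesh_mono[of k "n - 1"] k by fastforce
    have kn: "k \<le> n" "k \<le> N" "2 \<le> k" "1 \<le> k" using k n by auto
    have D0: "0 \<le> D k" unfolding D_def using omega_antimono[OF \<nu>, of "t n - t k" "t n - t (k - 1)"] tk ktn by auto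
    have y1: "(y1 has_integral (y (t k) - y (t (k - 1)))) {t (k - 1)..t k}"
    proof (rule fundamental_theorem_of_calculus)
      show "t (k - 1) \<le> t k" using tk by simp
      fix x assume "x \<in> {t (k - 1)..t k}"
      then have "(y has_real_derivative y1 x) (at x within {t (k - 1)..t k})"
        using tk by (intro has_field_derivative_at_within[OF d1]) auto
      then show "(y has_vector_derivative y1 x) (at x within {t (k - 1)..t k})"
        by (simp add: has_real_derivative_iff_has_vector_derivative)
    qed
    have "(yy has_integral (y (t k) - y (t (k - 1)))) {t (k - 1)..t k}"
      using y1 by (rule has_integral_eq[rotated]) (use tk in \<open>auto simp: yy_def\<close>)
    from has_integral_diff[OF has_integral_const_real[of "\<delta> k" "t (k - 1)" "t k"] this]
    have zero: "((\<lambda>s. \<delta> k - yy s) has_integral 0) {t (k - 1)..t k}" using tk by (simp add: \<delta>_def)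
    \<comment> \<open>As \<open>\<delta> k\<close> is the mean of the derivative, a constant may be
      subtracted from the kernel.\<close>
    define W where "W = omega (1 - \<nu>) (t n - t (k - 1))"
    have "((\<lambda>s. w s * (\<delta> k - yy s) - W * (\<delta> k - yy s)) has_integral (e k - W * 0)) {t (k - 1)..t k}"
      unfolding e_def by (intro has_integral_diff has_integral_mult_right zero integrable_integral e_int kn)
    moreover have "(\<lambda>s. w s * (\<delta> k - yy s) - W * (\<delta> k - yy s)) = (\<lambda>s. (w s - W) * (\<delta> k - yy s))"
      by (auto simp: algebra_simps)
    ultimately have he: "((\<lambda>s. (w s - W) * (\<delta> k - yy s)) has_integral e k) {t (k - 1)..t k}" by simp
    have "\<bar>integral {t (k - 1)..t k} (\<lambda>s. (w s - W) * (\<delta> k - yy s))\<bar> \<le> (t k - t (k - 1)) *\<^sub>R (D k * (K * B * t k powr (\<sigma> - 1) / real k))"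
    proof (rule integral_bound_open)
      show "(\<lambda>s. (w s - W) * (\<delta> k - yy s)) integrable_on {t (k - 1)..t k}" using he by blast
      show "((\<lambda>s. D k * (K * B * t k powr (\<sigma> - 1) / real k)) has_integral (t k - t (k - 1)) *\<^sub>R (D k * (K * B * t k powr (\<sigma> - 1) / real k))) {t (k - 1)..t k}"
        using has_integral_const_real[of "D k * (K * B * t k powr (\<sigma> - 1) / real k)" "t (k - 1)" "t k"] tk by simp
      fix s assume s: "s \<in> {t (k - 1)<..<t k}"
      have "W \<le> w s" unfolding W_def w_def using s ktn by (intro omega_antimono \<nu>) auto
      moreover have "w s \<le> omega (1 - \<nu>) (t n - t k)" unfolding w_def using s ktn by (intro omega_antimono \<nu>) auto
      ultimately have "\<bar>w s - W\<bar> \<le> D k" by (simp add: D_def W_def)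
      then show "\<bar>(w s - W) * (\<delta> k - yy s)\<bar> \<le> D k * (K * B * t k powr (\<sigma> - 1) / real k)"
        unfolding abs_mult using incr[OF kn(3), of s] s D0 by (intro mult_mono) auto
    qed
    then have "\<bar>e k\<bar> \<le> (t k - t (k - 1)) * (D k * (K * B * t k powr (\<sigma> - 1) / real k))"
      using he by (simp add: integral_unique)
    also have "\<dots> \<le> (r * t k / real k) * (D k * (K * B * t k powr (\<sigma> - 1) / real k))"
      using step_upper[OF kn(3)] D0 K B0 by (intro mult_right_mono) auto
    also have "\<dots> = K * (B * r) * (t k * t k powr (\<sigma> - 1)) * (D k * (1 / real k * (1 / real k)))" by simp
    also have "t k * t k powr (\<sigma> - 1) = t k powr \<sigma>" using tk powr_mult_base[of "t k" "\<sigma> - 1"] by simp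
    also have "1 / real k * (1 / real k) = real k powr (- (2 - \<nu>)) * real k powr (- \<nu>)"
    proof -
      have "real k powr (- (2 - \<nu>)) * real k powr (- \<nu>) = real k powr (- 2)" by (simp flip: powr_add)
      then show ?thesis using kn by (simp add: powr_minus powr_numeral power2_eq_square field_simps)
    qed
    also have "K * (B * r) * t k powr \<sigma> * (D k * (real k powr (- (2 - \<nu>)) * real k powr (- \<nu>)))
      = K * (B * r) * (t k powr \<sigma> * real k powr (- (2 - \<nu>))) * (D k * real k powr (- \<nu>))" by (simp only: mult_ac)
    also have "\<dots> \<le> K * (B * r) * (T powr \<sigma> * real N powr (- q)) * (D k * real k powr (- \<nu>))"
      using K B0 r D0 by (intro mult_right_mono mult_left_mono qT kn) auto
    finally show ?thesis .
  qed
  have last: "\<bar>e n\<bar> \<le> K * (B * (r powr (1 - \<nu>) / Gamma (2 - \<nu>))) * R" if n2: "2 \<le> n"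
  proof -
    define M where "M = K * B * t n powr (\<sigma> - 1) / real n"
    have M0: "0 \<le> M" using K B0 by (simp add: M_def)
    have "\<bar>integral {t (n - 1)..t n} (\<lambda>s. w s * (\<delta> n - yy s))\<bar> \<le> (omega (2 - \<nu>) (t n - t (n - 1)) - omega (2 - \<nu>) (t n - t n)) * M"
    proof (rule integral_bound_open)
      show "(\<lambda>s. w s * (\<delta> n - yy s)) integrable_on {t (n - 1)..t n}" by (rule e_int) simp
      show "((\<lambda>s. w s * M) has_integral (omega (2 - \<nu>) (t n - t (n - 1)) - omega (2 - \<nu>) (t n - t n)) * M) {t (n - 1)..t n}"
        by (intro has_integral_mult_left w_int) simp
      fix s assume s: "s \<in> {t (n - 1)<..<t n}"
      have "0 \<le> w s" unfolding w_def using \<nu> by (intro omega_nonneg) auto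
      then show "\<bar>w s * (\<delta> n - yy s)\<bar> \<le> w s * M"
        unfolding abs_mult M_def using incr[OF n2, of s] s by (intro mult_mono) auto
    qed
    then have "\<bar>e n\<bar> \<le> omega (2 - \<nu>) (t n - t (n - 1)) * M" by (simp add: e_def omega_def)
    also have "\<dots> \<le> omega (2 - \<nu>) (r * t n / real n) * M"
      unfolding omega_def using step_upper[OF n2] mesh_mono[of "n - 1" n] \<nu> Gpos M0
      by (intro mult_right_mono divide_right_mono powr_mono2) auto
    also have "\<dots> = K * (B * (r powr (1 - \<nu>) / Gamma (2 - \<nu>))) * (t n powr (- \<nu>) * (t n powr \<sigma> * real n powr (- (2 - \<nu>))))"
    proof -
      have 1: "(r * t n / real n) powr (1 - \<nu>) = r powr (1 - \<nu>) * (t n powr (1 - \<nu>) * real n powr (- (1 - \<nu>)))"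
        using tn r n by (simp add: powr_mult powr_divide powr_minus_divide[of _ "1 - \<nu>"] field_simps del: minus_diff_eq)
      have 2: "t n powr (1 - \<nu>) * t n powr (\<sigma> - 1) = t n powr (- \<nu>) * t n powr \<sigma>" by (simp flip: powr_add)
      have 3: "real n powr (- (1 - \<nu>)) / real n = real n powr (- (2 - \<nu>))"
      proof -
        have "- (1 - \<nu>) - 1 = - (2 - \<nu>)" by simp
        then show ?thesis using powr_diff[of "real n" "- (1 - \<nu>)" 1] n by simp
      qed
      have "omega (2 - \<nu>) (r * t n / real n) * M = K * (B * (r powr (1 - \<nu>) / Gamma (2 - \<nu>))) * ((t n powr (1 - \<nu>) * t n powr (\<sigma> - 1)) * (real n powr (- (1 - \<nu>)) / real n))"
        using 1 by (simp add: omega_def M_def)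
      then show ?thesis unfolding 2 3 by simp
    qed
    also have "\<dots> \<le> K * (B * (r powr (1 - \<nu>) / Gamma (2 - \<nu>))) * R"
      unfolding R_def using K B0 Gpos n by (intro mult_left_mono qT) auto
    finally show ?thesis .
  qed
  have A2: "(\<Sum>k = 2..<n. \<bar>e k\<bar>) \<le> K * (B * (r * (2 * 2 powr \<nu> / Gamma (1 - \<nu>)))) * R"
  proof -
    have "(\<Sum>k = 2..<n. \<bar>e k\<bar>) \<le> (\<Sum>k = 2..<n. K * (B * r) * (T powr \<sigma> * real N powr (- q)) * (D k * real k powr (- \<nu>)))"
      by (intro sum_mono mid)
    also have "\<dots> = K * (B * r) * (T powr \<sigma> * real N powr (- q)) * (\<Sum>k = 2..<n. D k * real k powr (- \<nu>))"
      by (simp add: sum_distrib_left)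
    also have "\<dots> \<le> K * (B * r) * (T powr \<sigma> * real N powr (- q)) * (2 * 2 powr \<nu> / Gamma (1 - \<nu>) * t n powr (- \<nu>))"
      using kernel_jump_sum[OF \<nu> n(1)] K B0 r by (intro mult_left_mono) (auto simp: D_def)
    finally show ?thesis by (simp add: R_def mult_ac)
  qed
  have "\<bar>\<Sum>k = 1..n. e k\<bar> \<le> K * (A1 + B * (r * (2 * 2 powr \<nu> / Gamma (1 - \<nu>)) + r powr (1 - \<nu>) / Gamma (2 - \<nu>))) * R"
  proof (cases "2 \<le> n")
    case True
    have "{1..n} = insert 1 (insert n {2..<n})" using True by auto
    then have "(\<Sum>k = 1..n. e k) = e 1 + (e n + (\<Sum>k = 2..<n. e k))" using True by simp
    moreover have "\<bar>\<Sum>k = 2..<n. e k\<bar> \<le> (\<Sum>k = 2..<n. \<bar>e k\<bar>)" by (rule sum_abs)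
    ultimately have "\<bar>\<Sum>k = 1..n. e k\<bar> \<le> \<bar>e 1\<bar> + \<bar>e n\<bar> + (\<Sum>k = 2..<n. \<bar>e k\<bar>)" by linarith
    then show ?thesis using e1 last[OF True] A2 by (simp add: algebra_simps)
  next
    case False
    then have "n = 1" using n by simp
    moreover have "0 \<le> K * (B * (r * (2 * 2 powr \<nu> / Gamma (1 - \<nu>)) + r powr (1 - \<nu>) / Gamma (2 - \<nu>))) * R"
      using K B0 r Gpos R0 by simp
    ultimately show ?thesis using e1 by (simp add: algebra_simps)
  qed
  then show ?thesis
    unfolding diff by (simp add: truncation_const_def A1_def B_def R_def mult_ac)
qed

end

section \<open>Stability and the error of one mode\<close>

context graded_time_mesh
begin

text \<open>The weight is the mean of the decreasing kernel over its cell. Both bounds together show that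
  the weights increase with \<open>k\<close>.\<close>

lemma L1_weight_bounds:
  assumes \<nu>: "0 < \<nu>" "\<nu> < 1" and k: "1 \<le> k" "k \<le> n"
  shows "omega (1 - \<nu>) (t n - t (k - 1)) \<le> L1_weight \<nu> t n (n - k)"
    and "k < n \<Longrightarrow> L1_weight \<nu> t n (n - k) \<le> omega (1 - \<nu>) (t n - t k)"
proof -
  define w where "w = (\<lambda>s. omega (1 - \<nu>) (t n - s))"
  have tk: "t (k - 1) < t k" "t k \<le> t n" using mesh_strict[OF k(1)] mesh_mono[OF k(2)] .
  have w: "(w has_integral (omega (2 - \<nu>) (t n - t (k - 1)) - omega (2 - \<nu>) (t n - t k))) {t (k - 1)..t k}"
    unfolding w_def using tk by (intro has_integral_omega \<nu>) auto
  have "n - (n - k) = k" using k by simp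
  then have A: "L1_weight \<nu> t n (n - k) = integral {t (k - 1)..t k} w / (t k - t (k - 1))"
    by (simp add: L1_weight_def Let_def w_def)
  have const: "((\<lambda>s. c) has_integral (t k - t (k - 1)) * c) {t (k - 1)..t k}" for c
    using has_integral_const_real[of c "t (k - 1)" "t k"] tk by simp
  have "omega (1 - \<nu>) (t n - t (k - 1)) * (t k - t (k - 1)) \<le> integral {t (k - 1)..t k} w"
  proof -
    have "((\<lambda>s. omega (1 - \<nu>) (t n - t (k - 1))) has_integral (t k - t (k - 1)) * omega (1 - \<nu>) (t n - t (k - 1))) {t (k - 1)<..<t k}"
      using const by (simp only: has_integral_Icc_iff_Ioo)
    moreover have "(w has_integral integral {t (k - 1)..t k} w) {t (k - 1)<..<t k}"
      using integrable_integral[OF has_integral_integrable[OF w]] by (simp only: has_integral_Icc_iff_Ioo)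
    ultimately have "(t k - t (k - 1)) * omega (1 - \<nu>) (t n - t (k - 1)) \<le> integral {t (k - 1)..t k} w"
    proof (rule has_integral_le)
      fix s assume s: "s \<in> {t (k - 1)<..<t k}"
      show "omega (1 - \<nu>) (t n - t (k - 1)) \<le> w s"
        unfolding w_def using s tk by (intro omega_antimono \<nu>) auto
    qed
    then show ?thesis by (simp add: mult.commute)
  qed
  then show "omega (1 - \<nu>) (t n - t (k - 1)) \<le> L1_weight \<nu> t n (n - k)"
    unfolding A using tk by (simp add: pos_le_divide_eq)
  show "L1_weight \<nu> t n (n - k) \<le> omega (1 - \<nu>) (t n - t k)" if "k < n"
  proof -
    have ktn: "t k < t n" using mesh_strict[of n] mesh_mono[of k "n - 1"] that by fastforce
    have "integral {t (k - 1)..t k} w \<le> (t k - t (k - 1)) * omega (1 - \<nu>) (t n - t k)"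
    proof (rule has_integral_le[OF integrable_integral[OF has_integral_integrable[OF w]] const])
      fix s assume s: "s \<in> {t (k - 1)..t k}"
      show "w s \<le> omega (1 - \<nu>) (t n - t k)"
        unfolding w_def using s ktn by (intro omega_antimono \<nu>) auto
    qed
    then show ?thesis unfolding A using tk by (simp add: pos_divide_le_eq mult.commute)
  qed
qed

lemma sum_abel_increments:
  fixes W :: "nat \<Rightarrow> 'a::real_vector" and A :: "nat \<Rightarrow> real"
  assumes "W 0 = 0" "1 \<le> n"
  shows "(\<Sum>k = 1..n. A k *\<^sub>R (W k - W (k - 1))) = A n *\<^sub>R W n - (\<Sum>k = 1..<n. (A (Suc k) - A k) *\<^sub>R W k)"
  using assms(2)
proof (induction n rule: dec_induct)
  case base
  then show ?case using assms(1) by simp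
next
  case (step n)
  then show ?case by (simp add: algebra_simps)
qed

text \<open>Summation by parts writes the discrete derivative as \<open>A n * W n\<close> minus a
  combination of earlier values with nonnegative coefficients of total mass \<open>A n - A 1\<close>.
  Testing with \<open>W n\<close> and induction bound \<open>A n * norm (W n)\<close> by the bound for the
  data plus \<open>A n - A 1\<close> times the claimed bound \<open>X\<close>; as \<open>A 1\<close> is at
  least \<open>omega (1 - \<nu>) (t n)\<close>, the data term is at most \<open>A 1 * X\<close>.\<close>

lemma L1_stability:
  fixes W :: "nat \<Rightarrow> 'a::real_inner"
  assumes \<nu>: "0 < \<nu>" "\<nu> < 1" and M: "0 \<le> M" and W0: "W 0 = 0"
    and eq: "\<And>n. n \<in> {1..N} \<Longrightarrow>
      inner (W n) (\<Sum>k = 1..n. L1_weight \<nu> t n (n - k) *\<^sub>R (W k - W (k - 1))) \<le> norm (W n) * (M * t n powr (- \<nu>))"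
    and n: "n \<in> {1..N}"
  shows "norm (W n) \<le> M * Gamma (1 - \<nu>)"
  using n
proof (induction n rule: less_induct)
  case (less n)
  have n: "1 \<le> n" "n \<le> N" using less.prems by auto
  have G: "0 < Gamma (1 - \<nu>)" using \<nu> by (intro Gamma_real_pos) auto
  define X where "X = M * Gamma (1 - \<nu>)"
  define A where "A = (\<lambda>k. L1_weight \<nu> t n (n - k))"
  have tn: "0 < t n" by (rule mesh_pos[OF n(1)])
  have low: "omega (1 - \<nu>) (t n) \<le> A 1"
    using L1_weight_bounds(1)[OF \<nu>, of 1 n] n by (simp add: A_def)
  have w0: "0 < omega (1 - \<nu>) (t n)" using tn G by (simp add: omega_def)
  have mono: "A k \<le> A (Suc k)" if "k \<in> {1..<n}" for k
    unfolding A_def using that L1_weight_bounds[OF \<nu>, of "Suc k" n] L1_weight_bounds[OF \<nu>, of k n] by auto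
  have tel: "(\<Sum>k = 1..<n. A (Suc k) - A k) = A n - A 1"
    using sum_Suc_diff'[of 1 n A] n by simp
  have Apos: "0 < A n"
  proof -
    have "0 \<le> (\<Sum>k = 1..<n. A (Suc k) - A k)" using mono by (intro sum_nonneg) auto
    then show ?thesis using tel low w0 by linarith
  qed
  show ?case
  proof (cases "W n = 0")
    case True
    then show ?thesis using M G by simp
  next
    case False
    then have Wn: "0 < norm (W n)" by simp
    have "inner (W n) (\<Sum>k = 1..n. A k *\<^sub>R (W k - W (k - 1))) =
        A n * (norm (W n))\<^sup>2 - (\<Sum>k = 1..<n. (A (Suc k) - A k) * inner (W n) (W k))"
      by (simp only: sum_abel_increments[where W = W and n = n, OF W0 n(1)] inner_diff_right inner_scaleR_right inner_sum_right power2_norm_eq_inner)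
    moreover have "inner (W n) (\<Sum>k = 1..n. A k *\<^sub>R (W k - W (k - 1))) \<le> norm (W n) * (M * t n powr (- \<nu>))"
      unfolding A_def by (rule eq[OF less.prems])
    moreover have "(\<Sum>k = 1..<n. (A (Suc k) - A k) * inner (W n) (W k)) \<le> (\<Sum>k = 1..<n. (A (Suc k) - A k) * (norm (W n) * X))"
    proof (rule sum_mono)
      fix k assume k: "k \<in> {1..<n}"
      have "inner (W n) (W k) \<le> norm (W n) * norm (W k)" by (rule norm_cauchy_schwarz)
      also have "\<dots> \<le> norm (W n) * X" unfolding X_def using k n by (intro mult_left_mono less.IH) auto
      finally show "(A (Suc k) - A k) * inner (W n) (W k) \<le> (A (Suc k) - A k) * (norm (W n) * X)"
        using mono[OF k] by (intro mult_left_mono) auto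
    qed
    moreover have "(\<Sum>k = 1..<n. (A (Suc k) - A k) * (norm (W n) * X)) = (A n - A 1) * (norm (W n) * X)"
      using tel by (simp flip: sum_distrib_right)
    ultimately have "A n * (norm (W n))\<^sup>2 \<le> norm (W n) * (M * t n powr (- \<nu>)) + (A n - A 1) * (norm (W n) * X)"
      by linarith
    then have "norm (W n) * (A n * norm (W n)) \<le> norm (W n) * (M * t n powr (- \<nu>) + (A n - A 1) * X)"
      by (simp add: power2_eq_square algebra_simps)
    then have "A n * norm (W n) \<le> M * t n powr (- \<nu>) + (A n - A 1) * X"
      using Wn by (simp only: mult_le_cancel_left_pos)
    moreover have "M * t n powr (- \<nu>) \<le> A 1 * X"
    proof -
      have "M * t n powr (- \<nu>) = omega (1 - \<nu>) (t n) * X" using G by (simp add: omega_def X_def)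
      also have "\<dots> \<le> A 1 * X" using low M G by (intro mult_right_mono) (auto simp: X_def)
      finally show ?thesis .
    qed
    ultimately have "A n * norm (W n) \<le> A n * X" by (simp add: algebra_simps)
    then show ?thesis using Apos by (simp add: X_def)
  qed
qed

text \<open>The vector \<open>W\<close> combines the two errors so that the coupling terms cancel in the
  inner product with \<open>W\<close>; only the truncation errors remain.\<close>

lemma mode_error:
  assumes \<nu>: "1 / 2 < \<nu>" "\<nu> < 1" and lam: "0 < lam" and C: "0 < C"
    and mode: "oscillator_mode \<nu> C lam y y1 y2 v v1 v2"
    and q1: "q1 = min (r * (1 - \<nu>)) (2 - \<nu>)" and q3: "q3 = min (r * (1 - \<nu> / 2)) (2 - \<nu>)"
    and zero: "U 0 = 0" "V 0 = 0"
    and V: "\<And>n. n \<in> {1..N} \<Longrightarrow> V n = (\<Sum>k = 1..n. L1_weight \<nu> t n (n - k) * (U k - U (k - 1)))"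
    and eq: "\<And>n. n \<in> {1..N} \<Longrightarrow>
      (\<Sum>k = 1..n. L1_weight \<nu> t n (n - k) * (V k - V (k - 1))) + lam * U n = a * omega (2 - 2 * \<nu>) (t n)"
    and n: "n \<in> {1..N}"
  shows "(a * v (t n) - V n)\<^sup>2 + lam * (a * y (t n) - U n)\<^sup>2 \<le>
    (\<bar>a\<bar> * C * Gamma (1 - \<nu>) * (truncation_const T r \<nu> (1 - \<nu>) * real N powr (- q1)
       + lam powr (1 / 4) * truncation_const T r \<nu> (1 - \<nu> / 2) * real N powr (- q3)))\<^sup>2"
proof -
  define W where "W = (\<lambda>n. (a * v (t n) - V n, sqrt lam * (a * y (t n) - U n)))"
  define L where "L = (\<lambda>(w :: nat \<Rightarrow> real) n. \<Sum>k = 1..n. L1_weight \<nu> t n (n - k) * (w k - w (k - 1)))"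
  define Rv where "Rv = (\<lambda>n. L (\<lambda>k. v (t k)) n - (omega (2 - 2 * \<nu>) (t n) - lam * y (t n)))"
  define Ry where "Ry = (\<lambda>n. L (\<lambda>k. y (t k)) n - v (t n))"
  define B where "B = \<bar>a\<bar> * C * (truncation_const T r \<nu> (1 - \<nu>) * real N powr (- q1)
       + lam powr (1 / 4) * truncation_const T r \<nu> (1 - \<nu> / 2) * real N powr (- q3))"
  have mode': "continuous_on {0..} y" "continuous_on {0..} v" "y 0 = 0" "v 0 = 0"
    "\<And>s. 0 < s \<Longrightarrow> (y has_real_derivative y1 s) (at s)" "\<And>s. 0 < s \<Longrightarrow> (y1 has_real_derivative y2 s) (at s)"
    "\<And>s. 0 < s \<Longrightarrow> (v has_real_derivative v1 s) (at s)" "\<And>s. 0 < s \<Longrightarrow> (v1 has_real_derivative v2 s) (at s)"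
    "\<And>s. 0 < s \<Longrightarrow> \<bar>y2 s\<bar> \<le> C * lam powr (- (1 / 4)) * s powr (- (1 + \<nu> / 2))"
    "\<And>s. 0 < s \<Longrightarrow> \<bar>v2 s\<bar> \<le> C * s powr (- (1 + \<nu>))"
    "\<And>t. 0 < t \<Longrightarrow> has_bochner_integral lborel (\<lambda>s. frac_kernel (1 - \<nu>) (t - s) * (if 0 < s then y1 s else 0)) (v t)"
    "\<And>t. 0 < t \<Longrightarrow> has_bochner_integral lborel (\<lambda>s. frac_kernel (1 - \<nu>) (t - s) * (if 0 < s then v1 s else 0))
              (omega (2 - 2 * \<nu>) t - lam * y t)"
    using mode unfolding oscillator_mode_def by auto
  have e1: "- (1 + \<nu>) = (1 - \<nu>) - 2" and e2: "- (1 + \<nu> / 2) = (1 - \<nu> / 2) - 2" by simp_all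
  have Rv: "\<bar>Rv n\<bar> \<le> C * truncation_const T r \<nu> (1 - \<nu>) * t n powr (- \<nu>) * real N powr (- q1)" if n: "n \<in> {1..N}" for n
    unfolding Rv_def L_def
    by (rule L1_truncation[OF _ _ _ _ _ _ mode'(2,7,8) mode'(10)[unfolded e1] mode'(12) q1])
      (use \<nu> n mesh_pos in auto)
  have Ry: "\<bar>Ry n\<bar> \<le> C * lam powr (- (1 / 4)) * truncation_const T r \<nu> (1 - \<nu> / 2) * t n powr (- \<nu>) * real N powr (- q3)" if n: "n \<in> {1..N}" for n
    unfolding Ry_def L_def
    by (rule L1_truncation[OF _ _ _ _ _ _ mode'(1,5,6) mode'(9)[unfolded e2] mode'(11) q3])
      (use \<nu> n mesh_pos in auto)
  have "norm (W n) \<le> B * Gamma (1 - \<nu>)"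
  proof (rule L1_stability[OF _ _ _ _ _ n])
    show "0 \<le> B"
    proof -
      have "0 \<le> truncation_const T r \<nu> s" if "0 < s" "s < 1" for s
        using that \<nu> r by (intro truncation_const_nonneg) auto
      then show ?thesis unfolding B_def using C \<nu> by (intro mult_nonneg_nonneg add_nonneg_nonneg) auto
    qed
    show "W 0 = 0" using zero mode'(3,4) by (simp add: W_def zero_prod_def)
    fix n assume n: "n \<in> {1..N}"
    have "(\<Sum>k = 1..n. L1_weight \<nu> t n (n - k) *\<^sub>R (W k - W (k - 1)))
       = (a * L (\<lambda>k. v (t k)) n - L V n, sqrt lam * (a * L (\<lambda>k. y (t k)) n - L U n))"
      unfolding L_def
      by (rule prod_eqI) (simp_all add: W_def fst_sum snd_sum sum_distrib_left sum_subtractf algebra_simps flip: sum_subtractf)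
    also have "L V n = a * omega (2 - 2 * \<nu>) (t n) - lam * U n" using eq[OF n] by (simp add: L_def)
    also have "L U n = V n" using V[OF n] by (simp add: L_def)
    finally have "inner (W n) (\<Sum>k = 1..n. L1_weight \<nu> t n (n - k) *\<^sub>R (W k - W (k - 1)))
       = inner (W n) (a * L (\<lambda>k. v (t k)) n - (a * omega (2 - 2 * \<nu>) (t n) - lam * U n), sqrt lam * (a * L (\<lambda>k. y (t k)) n - V n))"
      by (simp only:)
    also have "\<dots> = inner (W n) (a * Rv n, sqrt lam * (a * Ry n))"
    proof -
      have l: "sqrt lam * sqrt lam = lam" using lam by simp
      have skew: "inner (a * vn - Vn, s * (a * yn - uN)) (a * Lv - (a * om - lam * uN), s * (a * Ly - Vn))
        - inner (a * vn - Vn, s * (a * yn - uN)) (a * (Lv - (om - lam * yn)), s * (a * (Ly - vn)))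
        = (s * s - lam) * ((a * yn - uN) * (a * vn - Vn))" for s vn yn uN Vn Lv Ly om :: real
        by (simp add: algebra_simps)
      \<comment> \<open>The two cross terms carry the factor \<open>s * s - lam\<close>, which
        vanishes.\<close>
      from skew[where s = "sqrt lam"] show ?thesis unfolding l W_def Rv_def Ry_def by simp
    qed
    also have "\<dots> \<le> norm (W n) * norm (a * Rv n, sqrt lam * (a * Ry n))" by (rule norm_cauchy_schwarz)
    also have "\<dots> \<le> norm (W n) * (B * t n powr (- \<nu>))"
    proof (rule mult_left_mono)
      have "norm (a * Rv n, sqrt lam * (a * Ry n)) \<le> \<bar>a * Rv n\<bar> + \<bar>sqrt lam * (a * Ry n)\<bar>"
        using norm_triangle_ineq[of "(a * Rv n, 0)" "(0, sqrt lam * (a * Ry n))"] by (simp add: norm_Pair)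
      also have "\<dots> = \<bar>a\<bar> * (\<bar>Rv n\<bar> + sqrt lam * \<bar>Ry n\<bar>)" using lam by (simp add: abs_mult algebra_simps)
      also have "\<dots> \<le> \<bar>a\<bar> * (C * truncation_const T r \<nu> (1 - \<nu>) * t n powr (- \<nu>) * real N powr (- q1)
          + sqrt lam * (C * lam powr (- (1 / 4)) * truncation_const T r \<nu> (1 - \<nu> / 2) * t n powr (- \<nu>) * real N powr (- q3)))"
        using Rv[OF n] Ry[OF n] lam by (intro mult_left_mono add_mono) auto
      also have "sqrt lam * (C * lam powr (- (1 / 4)) * truncation_const T r \<nu> (1 - \<nu> / 2) * t n powr (- \<nu>) * real N powr (- q3))
        = C * (sqrt lam * lam powr (- (1 / 4))) * truncation_const T r \<nu> (1 - \<nu> / 2) * t n powr (- \<nu>) * real N powr (- q3)"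
        by simp
      also have "sqrt lam * lam powr (- (1 / 4)) = lam powr (1 / 4)"
        using lam by (simp add: powr_half_sqrt[symmetric] flip: powr_add)
      also have "\<bar>a\<bar> * (C * truncation_const T r \<nu> (1 - \<nu>) * t n powr (- \<nu>) * real N powr (- q1)
          + C * lam powr (1 / 4) * truncation_const T r \<nu> (1 - \<nu> / 2) * t n powr (- \<nu>) * real N powr (- q3)) = B * t n powr (- \<nu>)"
        by (simp add: B_def algebra_simps)
      finally show "norm (a * Rv n, sqrt lam * (a * Ry n)) \<le> B * t n powr (- \<nu>)" .
    qed simp
    finally show "inner (W n) (\<Sum>k = 1..n. L1_weight \<nu> t n (n - k) *\<^sub>R (W k - W (k - 1))) \<le> norm (W n) * (B * t n powr (- \<nu>))" .
  qed (use \<nu> in auto)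
  then have "(norm (W n))\<^sup>2 \<le> (B * Gamma (1 - \<nu>))\<^sup>2" by (intro power_mono) auto
  moreover have "(norm (W n))\<^sup>2 = (a * v (t n) - V n)\<^sup>2 + lam * (a * y (t n) - U n)\<^sup>2"
    using lam by (simp add: W_def norm_Pair power_mult_distrib)
  ultimately show ?thesis by (simp add: B_def mult_ac)
qed

end

section \<open>Inner products in L2 and Green's identity\<close>

lemma L2_mult_integrable:
  assumes "f \<in> L2_space M" "g \<in> L2_space M"
  shows "integrable M (\<lambda>x. f x * g x)"
proof (rule Bochner_Integration.integrable_bound)
  show "integrable M (\<lambda>x. (f x)\<^sup>2 + (g x)\<^sup>2)" using assms by (auto simp: L2_space_def)
  show "(\<lambda>x. f x * g x) \<in> borel_measurable M" using assms by (auto simp: L2_space_def)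
  have "\<bar>f x * g x\<bar> \<le> (f x)\<^sup>2 + (g x)\<^sup>2" for x
  proof -
    have "2 * (\<bar>f x\<bar> * \<bar>g x\<bar>) \<le> (f x)\<^sup>2 + (g x)\<^sup>2"
      using sum_squares_bound[of "\<bar>f x\<bar>" "\<bar>g x\<bar>"] by simp
    moreover have "0 \<le> \<bar>f x\<bar> * \<bar>g x\<bar>" by simp
    ultimately show ?thesis unfolding abs_mult by linarith
  qed
  then show "AE x in M. norm (f x * g x) \<le> norm ((f x)\<^sup>2 + (g x)\<^sup>2)" by simp
qed

lemma L2_add: "f \<in> L2_space M \<Longrightarrow> g \<in> L2_space M \<Longrightarrow> (\<lambda>x. f x + g x) \<in> L2_space M"
  using L2_mult_integrable[of f M g] by (auto simp: L2_space_def power2_sum mult.assoc)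

lemma L2_scale: "f \<in> L2_space M \<Longrightarrow> (\<lambda>x. c * f x) \<in> L2_space M"
  by (auto simp: L2_space_def power_mult_distrib)

lemma L2_diff: "f \<in> L2_space M \<Longrightarrow> g \<in> L2_space M \<Longrightarrow> (\<lambda>x. f x - g x) \<in> L2_space M"
  using L2_add[OF _ L2_scale[of g M "-1"], of f] by simp

lemma L2_zero: "(\<lambda>x. 0) \<in> L2_space M"
  by (auto simp: L2_space_def)

lemma L2_sum: "(\<And>k. k \<in> A \<Longrightarrow> f k \<in> L2_space M) \<Longrightarrow> (\<lambda>x. \<Sum>k\<in>A. f k x) \<in> L2_space M"
  by (induction A rule: infinite_finite_induct) (auto intro: L2_add L2_zero)

lemma L2_cong:
  assumes "\<And>x. x \<in> space M \<Longrightarrow> f x = g x"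
  shows "f \<in> L2_space M \<longleftrightarrow> g \<in> L2_space M"
proof -
  have "integrable M (\<lambda>x. (f x)\<^sup>2) \<longleftrightarrow> integrable M (\<lambda>x. (g x)\<^sup>2)"
    using assms by (intro Bochner_Integration.integrable_cong) auto
  moreover have "f \<in> borel_measurable M \<longleftrightarrow> g \<in> borel_measurable M"
    using assms by (intro measurable_cong) auto
  ultimately show ?thesis by (simp add: L2_space_def)
qed

lemma L2_inner_commute: "L2_inner M f g = L2_inner M g f"
  by (simp add: L2_inner_def mult.commute)

lemma L2_inner_add_left: "f \<in> L2_space M \<Longrightarrow> g \<in> L2_space M \<Longrightarrow> h \<in> L2_space M \<Longrightarrow>
    L2_inner M (\<lambda>x. f x + g x) h = L2_inner M f h + L2_inner M g h"
  by (simp add: L2_inner_def distrib_right L2_mult_integrable)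

lemma L2_inner_diff_left: "f \<in> L2_space M \<Longrightarrow> g \<in> L2_space M \<Longrightarrow> h \<in> L2_space M \<Longrightarrow>
    L2_inner M (\<lambda>x. f x - g x) h = L2_inner M f h - L2_inner M g h"
  by (simp add: L2_inner_def left_diff_distrib L2_mult_integrable)

lemma L2_inner_scale_left: "L2_inner M (\<lambda>x. c * f x) h = c * L2_inner M f h"
  by (simp add: L2_inner_def mult.assoc)

lemma L2_inner_sum_left:
  assumes "\<And>k. k \<in> A \<Longrightarrow> f k \<in> L2_space M" "h \<in> L2_space M"
  shows "L2_inner M (\<lambda>x. \<Sum>k\<in>A. f k x) h = (\<Sum>k\<in>A. L2_inner M (f k) h)"
proof -
  have zero: "L2_inner M (\<lambda>x. 0) h = 0" by (simp add: L2_inner_def)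
  show ?thesis
    using assms by (induction A rule: infinite_finite_induct) (auto simp: L2_inner_add_left L2_sum zero)
qed

lemma L2_inner_cong: "(\<And>x. x \<in> space M \<Longrightarrow> f x = g x) \<Longrightarrow> L2_inner M f h = L2_inner M g h"
  unfolding L2_inner_def by (intro Bochner_Integration.integral_cong) auto

lemma L2_inner_cong_AE:
  assumes "AE x in M. f x = g x" "f \<in> L2_space M" "g \<in> L2_space M" "h \<in> L2_space M"
  shows "L2_inner M f h = L2_inner M g h"
  unfolding L2_inner_def using assms
  by (intro integral_cong_AE) (auto simp: L2_space_def elim: eventually_mono)

lemma L2_norm_nonneg: "0 \<le> L2_norm M f"
  by (simp add: L2_norm_def)

lemma L2_norm_power2: "(L2_norm M f)\<^sup>2 = L2_inner M f f"
proof -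
  have "0 \<le> (\<integral>x. (f x)\<^sup>2 \<partial>M)" by (intro integral_nonneg_AE) auto
  then show ?thesis by (simp add: L2_norm_def L2_inner_def power2_eq_square)
qed

lemma L2_Cauchy_Schwarz:
  assumes f: "f \<in> L2_space M" and g: "g \<in> L2_space M"
  shows "\<bar>L2_inner M f g\<bar> \<le> L2_norm M f * L2_norm M g"
proof -
  define F G I where "F = L2_inner M f f" and "G = L2_inner M g g" and "I = L2_inner M f g"
  have nn: "0 \<le> F" "0 \<le> G" unfolding F_def G_def L2_norm_power2[symmetric] by simp_all
  have quad: "0 \<le> F + 2 * s * I + s\<^sup>2 * G" for s
  proof -
    define h where "h = (\<lambda>x. f x + s * g x)"
    have sg: "(\<lambda>x. s * g x) \<in> L2_space M" by (rule L2_scale[OF g])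
    have h: "h \<in> L2_space M" unfolding h_def by (rule L2_add[OF f sg])
    have e: "L2_inner M h k = L2_inner M f k + s * L2_inner M g k" if "k \<in> L2_space M" for k
      unfolding h_def L2_inner_add_left[OF f sg that] L2_inner_scale_left ..
    have "0 \<le> (L2_norm M h)\<^sup>2" by simp
    also have "\<dots> = L2_inner M f h + s * L2_inner M g h" unfolding L2_norm_power2 by (rule e[OF h])
    also have "L2_inner M f h = F + s * I"
      unfolding L2_inner_commute[of M f h] e[OF f] F_def I_def L2_inner_commute[of M g f] ..
    also have "L2_inner M g h = I + s * G"
      unfolding L2_inner_commute[of M g h] e[OF g] G_def I_def ..
    also have "F + s * I + s * (I + s * G) = F + 2 * s * I + s\<^sup>2 * G"
      by (simp add: power2_eq_square algebra_simps)
    finally show ?thesis .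
  qed
  have "I\<^sup>2 \<le> F * G"
  proof (cases "G = 0")
    case True
    have "I = 0"
    proof (rule ccontr)
      assume "I \<noteq> 0"
      then have "2 * (- (F + 1) / (2 * I)) * I = - (F + 1)" by simp
      then show False using quad[of "- (F + 1) / (2 * I)"] True by simp
    qed
    then show ?thesis using True by simp
  next
    case False
    then have "0 < G" using nn by simp
    then show ?thesis using quad[of "- I / G"] by (simp add: power2_eq_square field_simps)
  qed
  then have "sqrt (I\<^sup>2) \<le> sqrt (F * G)" by (rule real_sqrt_le_mono)
  then have "\<bar>I\<bar> \<le> sqrt F * sqrt G" by (simp add: real_sqrt_mult)
  moreover have "sqrt F = L2_norm M f" "sqrt G = L2_norm M g"
    unfolding F_def G_def L2_norm_power2[symmetric] by (simp_all add: L2_norm_nonneg)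
  ultimately show ?thesis by (simp add: I_def)
qed

lemma L2_inner_tendsto:
  assumes lim: "((\<lambda>s. L2_norm M (\<lambda>x. u s x - w x)) \<longlongrightarrow> 0) F" and u: "\<forall>\<^sub>F s in F. u s \<in> L2_space M"
    and w: "w \<in> L2_space M" and h: "h \<in> L2_space M"
  shows "((\<lambda>s. L2_inner M (u s) h) \<longlongrightarrow> L2_inner M w h) F"
proof -
  have "((\<lambda>s. L2_inner M (u s) h - L2_inner M w h) \<longlongrightarrow> 0) F"
  proof (rule Lim_null_comparison)
    show "\<forall>\<^sub>F s in F. norm (L2_inner M (u s) h - L2_inner M w h) \<le> L2_norm M (\<lambda>x. u s x - w x) * L2_norm M h"
      using u
    proof eventually_elim
      case (elim s)
      then show ?case using L2_Cauchy_Schwarz[OF L2_diff[OF elim w] h] L2_inner_diff_left[OF elim w h] by simp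
    qed
    show "((\<lambda>s. L2_norm M (\<lambda>x. u s x - w x) * L2_norm M h) \<longlongrightarrow> 0) F"
      using tendsto_mult_left_zero[OF lim] .
  qed
  then show ?thesis by (simp add: LIM_zero_iff)
qed

text \<open>Taking a coefficient is continuous on L2, so it commutes with derivatives in time.\<close>

lemma has_L2_derivative_inner:
  assumes d: "has_L2_derivative M u d t S" and t: "t \<in> S" and h: "h \<in> L2_space M"
  shows "((\<lambda>s. L2_inner M (u s) h) has_real_derivative L2_inner M d h) (at t within S)"
proof -
  have dL: "d \<in> L2_space M" and uL: "\<And>s. s \<in> S \<Longrightarrow> u s \<in> L2_space M"
    and lim: "((\<lambda>s. L2_norm M (\<lambda>x. (u s x - u t x) / (s - t) - d x)) \<longlongrightarrow> 0) (at t within S)"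
    using d by (auto simp: has_L2_derivative_def)
  have q: "(\<lambda>x. (u s x - u t x) / (s - t)) \<in> L2_space M" if "s \<in> S" for s
    using L2_scale[OF L2_diff[OF uL[OF that] uL[OF t]], of "1 / (s - t)"] by simp
  have "((\<lambda>s. L2_inner M (\<lambda>x. (u s x - u t x) / (s - t)) h) \<longlongrightarrow> L2_inner M d h) (at t within S)"
    using q by (intro L2_inner_tendsto[OF lim _ dL h]) (auto simp: eventually_at_filter)
  moreover have "\<forall>\<^sub>F s in at t within S. L2_inner M (\<lambda>x. (u s x - u t x) / (s - t)) h = (L2_inner M (u s) h - L2_inner M (u t) h) / (s - t)"
  proof -
    have "L2_inner M (\<lambda>x. (u s x - u t x) / (s - t)) h = (L2_inner M (u s) h - L2_inner M (u t) h) / (s - t)" if "s \<in> S" for s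
      using L2_inner_scale_left[of M "1 / (s - t)" "\<lambda>x. u s x - u t x" h] L2_inner_diff_left[OF uL[OF that] uL[OF t] h] by simp
    then show ?thesis by (auto simp: eventually_at_filter)
  qed
  ultimately show ?thesis
    unfolding has_field_derivative_iff by (rule Lim_transform_eventually)
qed

lemma L2_continuous_on_inner:
  assumes "L2_continuous_on M S u" "h \<in> L2_space M"
  shows "continuous_on S (\<lambda>t. L2_inner M (u t) h)"
  unfolding continuous_on_def
proof
  fix t assume "t \<in> S"
  then show "((\<lambda>t. L2_inner M (u t) h) \<longlongrightarrow> L2_inner M (u t) h) (at t within S)"
    using assms by (intro L2_inner_tendsto) (auto simp: L2_continuous_on_def eventually_at_filter)
qed

lemma continuous_on_L2_interval:
  fixes f :: "real \<Rightarrow> real"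
  assumes "continuous_on {a..b} f"
  shows "f \<in> L2_space (interval_measure_on a b)"
proof -
  have "f \<in> borel_measurable (lebesgue_on {a<..<b})"
    by (intro continuous_imp_measurable_on_sets_lebesgue continuous_on_subset[OF assms]) auto
  moreover have "integrable (lebesgue_on {a<..<b}) (\<lambda>x. (f x)\<^sup>2)"
  proof -
    have "(\<lambda>x. (f x)\<^sup>2) absolutely_integrable_on {a..b}"
      using assms by (intro absolutely_integrable_continuous_real continuous_intros)
    then have "(\<lambda>x. (f x)\<^sup>2) absolutely_integrable_on {a<..<b}"
      by (rule set_integrable_subset) auto
    then show ?thesis by (simp add: absolutely_integrable_imp_integrable)
  qed
  ultimately show ?thesis by (simp add: L2_space_def)
qed

lemma L2_inner_interval:
  fixes f g :: "real \<Rightarrow> real"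
  assumes "f \<in> L2_space (interval_measure_on a b)" "g \<in> L2_space (interval_measure_on a b)"
  shows "((\<lambda>x. f x * g x) has_integral L2_inner (interval_measure_on a b) f g) {a..b}"
    and "(\<lambda>x. f x * g x) absolutely_integrable_on {a<..<b}"
proof -
  have i: "integrable (lebesgue_on {a<..<b}) (\<lambda>x. f x * g x)" by (rule L2_mult_integrable[OF assms])
  then show "(\<lambda>x. f x * g x) absolutely_integrable_on {a<..<b}"
    by (simp add: integrable_restrict_space set_integrable_def)
  have "((\<lambda>x. f x * g x) has_integral L2_inner (interval_measure_on a b) f g) {a<..<b}"
    unfolding L2_inner_def by (rule has_integral_integral_lebesgue_on[OF i]) auto
  then show "((\<lambda>x. f x * g x) has_integral L2_inner (interval_measure_on a b) f g) {a..b}"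
    by (simp add: has_integral_Icc_iff_Ioo)
qed

lemma L2_interval_integrable:
  assumes "z \<in> L2_space (interval_measure_on a b)"
  shows "z absolutely_integrable_on {a..b}"
proof -
  have "(\<lambda>x. 1) \<in> L2_space (interval_measure_on a b)" by (intro continuous_on_L2_interval continuous_intros)
  from L2_inner_interval(2)[OF assms this] have "z absolutely_integrable_on {a<..<b}" by simp
  then show ?thesis
  proof (rule absolutely_integrable_spike_set)
    have "negligible {a, b}" by simp
    then show "negligible {x \<in> {a<..<b} - {a..b}. z x \<noteq> 0}" "negligible {x \<in> {a..b} - {a<..<b}. z x \<noteq> 0}"
      by (rule negligible_subset, force)+
  qed
qed

lemma dirichlet_laplacian_deriv:
  assumes "dirichlet_laplacian a b w z" "a < b"
  shows "\<exists>w'. (\<forall>x\<in>{a..b}. (w has_real_derivative w' x) (at x within {a..b}) \<and> (z has_integral (w' x - w' a)) {a..x})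
    \<and> continuous_on {a..b} w' \<and> continuous_on {a..b} w"
proof -
  obtain w' where "\<forall>x\<in>{a..b}. (w has_real_derivative w' x) (at x within {a..b}) \<and>
      (z has_integral (w' x - w' a)) {a..x}"
    using assms(1) unfolding dirichlet_laplacian_def by blast
  then have d: "\<And>x. x \<in> {a..b} \<Longrightarrow> (w has_real_derivative w' x) (at x within {a..b})"
    and i: "\<And>x. x \<in> {a..b} \<Longrightarrow> (z has_integral (w' x - w' a)) {a..x}" by blast+
  have "z integrable_on {a..b}" using i[of b] assms(2) by auto
  then have "continuous_on {a..b} (\<lambda>x. w' a + integral {a..x} z)"
    by (intro continuous_intros indefinite_integral_continuous_1)
  moreover have "w' a + integral {a..x} z = w' x" if "x \<in> {a..b}" for x
    using i[OF that] by (simp add: integral_unique)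
  ultimately have c': "continuous_on {a..b} w'" by (rule continuous_on_eq)
  have c: "continuous_on {a..b} w" by (rule DERIV_continuous_on[OF d])
  show ?thesis by (intro exI[of _ w'] conjI ballI d i c' c)
qed

text \<open>Integration by parts when \<open>p\<close> is only absolutely continuous, so that the product
  \<open>p * w\<close> need not be differentiable. The combination \<open>Q\<close> of the product with
  both integrals is nevertheless differentiable with derivative 0: over a short interval the remainder is
  at most its length times an increment of the continuous function \<open>Z\<close>.\<close>

lemma green_identity:
  assumes ab: "a < b" and z: "z absolutely_integrable_on {a..b}"
    and zi: "\<And>x. x \<in> {a..b} \<Longrightarrow> (z has_integral (p x - p a)) {a..x}"
    and d: "\<And>x. x \<in> {a..b} \<Longrightarrow> (w has_real_derivative w' x) (at x within {a..b})"
    and p: "continuous_on {a..b} p" and w': "continuous_on {a..b} w'"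
    and zw: "(\<lambda>x. z x * w x) integrable_on {a..b}"
    and bc: "w a = 0" "w b = 0"
  shows "integral {a..b} (\<lambda>x. z x * w x) = - integral {a..b} (\<lambda>x. p x * w' x)"
proof -
  define Z where "Z = (\<lambda>t. integral {a..t} (\<lambda>x. \<bar>z x\<bar>))"
  define P where "P = (\<lambda>t. integral {a..t} (\<lambda>x. z x * w x))"
  define Q where "Q = (\<lambda>t. P t - p t * w t + integral {a..t} (\<lambda>x. p x * w' x))"
  have z_int: "z integrable_on {a..b}" and za_int: "(\<lambda>x. \<bar>z x\<bar>) integrable_on {a..b}"
    using z by (auto simp: absolutely_integrable_on_def)
  have contZ: "continuous_on {a..b} Z"
    unfolding Z_def by (rule indefinite_integral_continuous_1[OF za_int])
  obtain C where C: "0 < C" "\<And>x. x \<in> {a..b} \<Longrightarrow> \<bar>w' x\<bar> \<le> C"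
  proof -
    have "bounded (w' ` {a..b})" by (intro compact_imp_bounded compact_continuous_image w') auto
    then obtain C where C: "\<forall>y\<in>w' ` {a..b}. norm y \<le> C" unfolding bounded_iff by blast
    have "\<bar>w' x\<bar> \<le> max C 1" if "x \<in> {a..b}" for x using C that by (auto intro: max.coboundedI1)
    then show ?thesis by (intro that[of "max C 1"]) auto
  qed
  have lip: "\<bar>w x - w y\<bar> \<le> C * \<bar>x - y\<bar>" if "x \<in> {a..b}" "y \<in> {a..b}" for x y
    using field_differentiable_bound[of "{a..b}" w w' C x y] d C that by auto
  have rem: "\<bar>(P v - P u) - (p v - p u) * w s\<bar> \<le> C * (v - u) * (Z v - Z u)"
    if uv: "a \<le> u" "u \<le> v" "v \<le> b" and s: "s \<in> {u..v}" for u v s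
  proof -
    have sub: "{u..v} \<subseteq> {a..b}" "{a..v} \<subseteq> {a..b}" using uv by auto
    have diff: "integral {a..v} f - integral {a..u} f = integral {u..v} f" if "f integrable_on {a..b}" for f :: "real \<Rightarrow> real"
      using Henstock_Kurzweil_Integration.integral_combine[OF uv(1,2) integrable_on_subinterval[OF that sub(2)]] by simp
    have pz: "p v - p u = integral {u..v} z"
      using diff[OF z_int] zi[of u] zi[of v] uv by (simp add: integral_unique)
    have zs: "(\<lambda>x. z x * w s) integrable_on {u..v}"
      using integrable_on_subinterval[OF z_int sub(1)] by (rule integrable_on_mult_left)
    have zw': "(\<lambda>x. z x * w x) integrable_on {u..v}" by (rule integrable_on_subinterval[OF zw sub(1)])
    have "(P v - P u) - (p v - p u) * w s = integral {u..v} (\<lambda>x. z x * w x - z x * w s)"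
      unfolding P_def diff[OF zw] pz using zs zw' by (simp add: Henstock_Kurzweil_Integration.integral_diff)
    also have "\<bar>\<dots>\<bar> \<le> integral {u..v} (\<lambda>x. C * (v - u) * \<bar>z x\<bar>)"
    proof -
      have "norm (integral {u..v} (\<lambda>x. z x * w x - z x * w s)) \<le> integral {u..v} (\<lambda>x. C * (v - u) * \<bar>z x\<bar>)"
      proof (rule Henstock_Kurzweil_Integration.integral_norm_bound_integral)
        show "(\<lambda>x. z x * w x - z x * w s) integrable_on {u..v}" by (rule integrable_diff[OF zw' zs])
        show "(\<lambda>x. C * (v - u) * \<bar>z x\<bar>) integrable_on {u..v}"
          using integrable_on_subinterval[OF za_int sub(1)] by (rule integrable_on_mult_right)
        fix x assume x: "x \<in> {u..v}"
        have "\<bar>w x - w s\<bar> \<le> C * \<bar>x - s\<bar>" using x s sub by (intro lip) auto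
        also have "\<dots> \<le> C * (v - u)" using x s C by (intro mult_left_mono) auto
        finally have "\<bar>z x\<bar> * \<bar>w x - w s\<bar> \<le> \<bar>z x\<bar> * (C * (v - u))" by (intro mult_left_mono) auto
        moreover have "z x * w x - z x * w s = z x * (w x - w s)" by (simp add: algebra_simps)
        ultimately show "norm (z x * w x - z x * w s) \<le> C * (v - u) * \<bar>z x\<bar>" by (simp add: abs_mult mult_ac)
      qed
      then show ?thesis by simp
    qed
    also have "\<dots> = C * (v - u) * (Z v - Z u)" unfolding Z_def diff[OF za_int] by simp
    finally show ?thesis .
  qed
  have Q': "(Q has_real_derivative 0) (at t within {a..b})" if t: "t \<in> {a..b}" for t
  proof -
    define R where "R = (\<lambda>s. (P s - P t) - (p s * w s - p t * w t) + p t * (w s - w t))"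
    have R: "\<bar>R s\<bar> \<le> C * \<bar>s - t\<bar> * \<bar>Z s - Z t\<bar>" if "s \<in> {a..b}" for s
    proof -
      have "R s = (P s - P t) - (p s - p t) * w s" by (simp add: R_def algebra_simps)
      moreover have "\<bar>(P s - P t) - (p s - p t) * w s\<bar> \<le> C * \<bar>s - t\<bar> * \<bar>Z s - Z t\<bar>"
      proof (cases "t \<le> s")
        case True
        have le: "C * (s - t) * (Z s - Z t) \<le> C * \<bar>s - t\<bar> * \<bar>Z s - Z t\<bar>"
          using abs_ge_self[of "C * (s - t) * (Z s - Z t)"] C by (simp add: abs_mult)
        have "\<bar>(P s - P t) - (p s - p t) * w s\<bar> \<le> C * (s - t) * (Z s - Z t)"
          using rem[of t s s] True t that by auto
        then show ?thesis using le by linarith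
      next
        case False
        have le: "C * (t - s) * (Z t - Z s) \<le> C * \<bar>s - t\<bar> * \<bar>Z s - Z t\<bar>"
          using abs_ge_self[of "C * (t - s) * (Z t - Z s)"] C by (simp add: abs_mult abs_minus_commute)
        have "\<bar>(P s - P t) - (p s - p t) * w s\<bar> = \<bar>(P t - P s) - (p t - p s) * w s\<bar>"
        proof -
          have "(P s - P t) - (p s - p t) * w s = - ((P t - P s) - (p t - p s) * w s)" by (simp add: algebra_simps)
          then show ?thesis by (simp only: abs_minus_cancel)
        qed
        also have "\<dots> \<le> C * (t - s) * (Z t - Z s)" using rem[of s t s] False t that by auto
        finally show ?thesis using le by linarith
      qed
      ultimately show ?thesis by simp
    qed
    have lim0: "((\<lambda>s. R s / (s - t)) \<longlongrightarrow> 0) (at t within {a..b})"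
    proof (rule Lim_null_comparison)
      have "norm (R s / (s - t)) \<le> C * \<bar>Z s - Z t\<bar>" if "s \<in> {a..b}" "s \<noteq> t" for s
        using R[OF that(1)] that(2) by (simp add: abs_divide pos_divide_le_eq mult_ac)
      then show "\<forall>\<^sub>F s in at t within {a..b}. norm (R s / (s - t)) \<le> C * \<bar>Z s - Z t\<bar>"
        by (auto simp: eventually_at_filter)
      have "(Z \<longlongrightarrow> Z t) (at t within {a..b})" using contZ t by (simp add: continuous_on_def)
      then have "((\<lambda>s. C * \<bar>Z s - Z t\<bar>) \<longlongrightarrow> C * \<bar>Z t - Z t\<bar>) (at t within {a..b})" by (intro tendsto_intros)
      then show "((\<lambda>s. C * \<bar>Z s - Z t\<bar>) \<longlongrightarrow> 0) (at t within {a..b})" by simp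
    qed
    have "((\<lambda>s. R s / (s - t) - p t * ((w s - w t) / (s - t))) \<longlongrightarrow> 0 - p t * w' t) (at t within {a..b})"
      using d[OF t] unfolding has_field_derivative_iff by (intro tendsto_intros lim0)
    moreover have "\<forall>\<^sub>F s in at t within {a..b}. R s / (s - t) - p t * ((w s - w t) / (s - t)) = ((P s - p s * w s) - (P t - p t * w t)) / (s - t)"
    proof (intro always_eventually allI)
      fix s
      have "R s - p t * (w s - w t) = (P s - p s * w s) - (P t - p t * w t)" by (simp add: R_def)
      then show "R s / (s - t) - p t * ((w s - w t) / (s - t)) = ((P s - p s * w s) - (P t - p t * w t)) / (s - t)"
        by (simp flip: diff_divide_distrib)
    qed
    ultimately have "((\<lambda>s. P s - p s * w s) has_real_derivative 0 - p t * w' t) (at t within {a..b})"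
      unfolding has_field_derivative_iff by (rule Lim_transform_eventually)
    moreover have "((\<lambda>t. integral {a..t} (\<lambda>x. p x * w' x)) has_real_derivative p t * w' t) (at t within {a..b})"
      by (intro integral_has_real_derivative t continuous_intros p w')
    ultimately have "(Q has_real_derivative (0 - p t * w' t) + p t * w' t) (at t within {a..b})"
      unfolding Q_def by (rule DERIV_add)
    then show ?thesis by simp
  qed
  have "Q b = Q a"
    using has_field_derivative_zero_constant[of "{a..b}" Q] Q' ab by (metis atLeastAtMost_iff convex_real_interval(5) less_imp_le order_refl)
  then show ?thesis using bc by (simp add: Q_def P_def)
qed

lemma dirichlet_laplacian_L2:
  assumes "dirichlet_laplacian a b w z" "a < b"
  shows "w \<in> L2_space (interval_measure_on a b)" "z \<in> L2_space (interval_measure_on a b)"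
proof -
  show "w \<in> L2_space (interval_measure_on a b)"
    using dirichlet_laplacian_deriv[OF assms] continuous_on_L2_interval[of a b w] by blast
  show "z \<in> L2_space (interval_measure_on a b)" using assms(1) by (simp add: dirichlet_laplacian_def)
qed

lemma deriv_interval:
  assumes "\<And>x. x \<in> {a..b} \<Longrightarrow> (w has_real_derivative w' x) (at x within {a..b})"
    and "x \<in> space (interval_measure_on a b)"
  shows "deriv w x = w' x"
proof -
  have x: "a < x" "x < b" using assms(2) by auto
  then have "(w has_real_derivative w' x) (at x)"
    using assms(1)[of x] by (simp add: at_within_Icc_at)
  then show "deriv w x = w' x" by (rule DERIV_imp_deriv)
qed

lemma dirichlet_green:
  assumes w: "dirichlet_laplacian a b w z" and x: "dirichlet_laplacian a b x y" and ab: "a < b"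
  shows "L2_inner (interval_measure_on a b) z x = - L2_inner (interval_measure_on a b) (deriv w) (deriv x)"
    and "deriv w \<in> L2_space (interval_measure_on a b)"
proof -
  let ?M = "interval_measure_on a b"
  obtain w' where *: "(\<forall>x\<in>{a..b}. (w has_real_derivative w' x) (at x within {a..b}) \<and> (z has_integral (w' x - w' a)) {a..x})
    \<and> continuous_on {a..b} w' \<and> continuous_on {a..b} w"
    using dirichlet_laplacian_deriv[OF w ab] by (rule exE)
  then have dw: "\<And>x. x \<in> {a..b} \<Longrightarrow> (w has_real_derivative w' x) (at x within {a..b})"
    and zi: "\<And>x. x \<in> {a..b} \<Longrightarrow> (z has_integral (w' x - w' a)) {a..x}"
    and cw': "continuous_on {a..b} w'" and cw: "continuous_on {a..b} w" by blast+
  obtain x' where *: "(\<forall>q\<in>{a..b}. (x has_real_derivative x' q) (at q within {a..b}) \<and> (y has_integral (x' q - x' a)) {a..q})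
    \<and> continuous_on {a..b} x' \<and> continuous_on {a..b} x"
    using dirichlet_laplacian_deriv[OF x ab] by (rule exE)
  then have dx: "\<And>q. q \<in> {a..b} \<Longrightarrow> (x has_real_derivative x' q) (at q within {a..b})"
    and yi: "\<And>q. q \<in> {a..b} \<Longrightarrow> (y has_integral (x' q - x' a)) {a..q}"
    and cx': "continuous_on {a..b} x'" and cx: "continuous_on {a..b} x" by blast+
  note zL = dirichlet_laplacian_L2(2)[OF w ab] and xL = dirichlet_laplacian_L2(1)[OF x ab]
  have w'L: "w' \<in> L2_space ?M" and x'L: "x' \<in> L2_space ?M"
    using cw' cx' by (auto intro: continuous_on_L2_interval)
  have dew: "deriv w q = w' q" and dex: "deriv x q = x' q" if "q \<in> space ?M" for q
    using deriv_interval[of a b w w' q] deriv_interval[of a b x x' q] dw dx that by auto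
  show dL: "deriv w \<in> L2_space ?M"
    using L2_cong[of ?M "deriv w" w'] dew w'L by blast
  have bc: "x a = 0" "x b = 0" using x by (auto simp: dirichlet_laplacian_def)
  have zx: "((\<lambda>q. z q * x q) has_integral L2_inner ?M z x) {a..b}" by (rule L2_inner_interval(1)[OF zL xL])
  have "L2_inner ?M z x = integral {a..b} (\<lambda>q. z q * x q)" using zx by (simp add: integral_unique)
  also have "\<dots> = - integral {a..b} (\<lambda>q. w' q * x' q)"
    by (rule green_identity[OF ab L2_interval_integrable[OF zL] zi dx cw' cx' has_integral_integrable[OF zx] bc])
  also have "integral {a..b} (\<lambda>q. w' q * x' q) = L2_inner ?M w' x'"
    using L2_inner_interval(1)[OF w'L x'L] by (rule integral_unique)
  also have "L2_inner ?M w' x' = L2_inner ?M (deriv w) (deriv x)"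
    unfolding L2_inner_def using dew dex by (intro Bochner_Integration.integral_cong) auto
  finally show "L2_inner ?M z x = - L2_inner ?M (deriv w) (deriv x)" .
qed

lemma dirichlet_symmetric:
  assumes "dirichlet_laplacian a b w z" "dirichlet_laplacian a b x y" "a < b"
  shows "L2_inner (interval_measure_on a b) z x = L2_inner (interval_measure_on a b) w y"
proof -
  let ?M = "interval_measure_on a b"
  have "L2_inner ?M z x = - L2_inner ?M (deriv w) (deriv x)" by (rule dirichlet_green(1)[OF assms])
  also have "L2_inner ?M (deriv w) (deriv x) = L2_inner ?M (deriv x) (deriv w)" by (rule L2_inner_commute)
  also have "- L2_inner ?M (deriv x) (deriv w) = L2_inner ?M y w"
    by (rule dirichlet_green(1)[OF assms(2,1,3), symmetric])
  also have "\<dots> = L2_inner ?M w y" by (rule L2_inner_commute)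
  finally show ?thesis .
qed

section \<open>Expansion in Dirichlet eigenfunctions\<close>

lemma dirichlet_laplacian_diff:
  assumes "dirichlet_laplacian a b w z" "dirichlet_laplacian a b x y"
  shows "dirichlet_laplacian a b (\<lambda>q. w q - x q) (\<lambda>q. z q - y q)"
proof -
  obtain w' where w': "\<forall>q\<in>{a..b}. (w has_real_derivative w' q) (at q within {a..b}) \<and>
      (z has_integral (w' q - w' a)) {a..q}"
    using assms(1) unfolding dirichlet_laplacian_def by blast
  obtain x' where x': "\<forall>q\<in>{a..b}. (x has_real_derivative x' q) (at q within {a..b}) \<and>
      (y has_integral (x' q - x' a)) {a..q}"
    using assms(2) unfolding dirichlet_laplacian_def by blast
  have "\<forall>q\<in>{a..b}. ((\<lambda>q. w q - x q) has_real_derivative w' q - x' q) (at q within {a..b}) \<and>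
      ((\<lambda>q. z q - y q) has_integral ((w' q - x' q) - (w' a - x' a))) {a..q}"
  proof (intro ballI conjI)
    fix q assume q: "q \<in> {a..b}"
    show "((\<lambda>q. w q - x q) has_real_derivative w' q - x' q) (at q within {a..b})"
      using w' x' q by (intro DERIV_diff) auto
    have "((\<lambda>q. z q - y q) has_integral ((w' q - w' a) - (x' q - x' a))) {a..q}"
      using w' x' q by (intro has_integral_diff) auto
    then show "((\<lambda>q. z q - y q) has_integral ((w' q - x' q) - (w' a - x' a))) {a..q}"
      by (simp add: algebra_simps)
  qed
  then have "\<exists>d. \<forall>q\<in>{a..b}. ((\<lambda>q. w q - x q) has_real_derivative d q) (at q within {a..b}) \<and>
      ((\<lambda>q. z q - y q) has_integral (d q - d a)) {a..q}"
    by (intro exI[of _ "\<lambda>q. w' q - x' q"])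
  moreover have "(\<lambda>q. z q - y q) \<in> L2_space (interval_measure_on a b)"
    using assms unfolding dirichlet_laplacian_def by (intro L2_diff) auto
  ultimately show ?thesis using assms unfolding dirichlet_laplacian_def by auto
qed

text \<open>As \<open>w\<close> vanishes at \<open>a\<close>, its value at \<open>x\<close> is the inner
  product of the derivative with the indicator \<open>i\<close> of \<open>[a,x]\<close>.\<close>

lemma poincare_inequality:
  assumes w: "dirichlet_laplacian a b w z" and ab: "a < b"
  shows "L2_norm (interval_measure_on a b) w \<le> (b - a) * L2_norm (interval_measure_on a b) (deriv w)"
proof -
  let ?M = "interval_measure_on a b"
  obtain w' where *: "(\<forall>x\<in>{a..b}. (w has_real_derivative w' x) (at x within {a..b}) \<and> (z has_integral (w' x - w' a)) {a..x})
    \<and> continuous_on {a..b} w' \<and> continuous_on {a..b} w"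
    using dirichlet_laplacian_deriv[OF w ab] by (rule exE)
  then have dw: "\<And>x. x \<in> {a..b} \<Longrightarrow> (w has_real_derivative w' x) (at x within {a..b})"
    and zi: "\<And>x. x \<in> {a..b} \<Longrightarrow> (z has_integral (w' x - w' a)) {a..x}"
    and cw': "continuous_on {a..b} w'" and cw: "continuous_on {a..b} w" by blast+
  have wL: "w \<in> L2_space ?M" and w'L: "w' \<in> L2_space ?M" and oneL: "(\<lambda>x. 1) \<in> L2_space ?M"
    using cw cw' by (auto intro: continuous_on_L2_interval)
  have norm_eq: "L2_norm ?M w' = L2_norm ?M (deriv w)"
  proof -
    have "deriv w q = w' q" if "q \<in> space ?M" for q
      by (rule deriv_interval[of a b w w' q, OF dw that])
    then have "(\<integral>q. (w' q)\<^sup>2 \<partial>?M) = (\<integral>q. (deriv w q)\<^sup>2 \<partial>?M)"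
      by (intro Bochner_Integration.integral_cong) auto
    then show ?thesis by (simp only: L2_norm_def)
  qed
  have one: "((\<lambda>x. 1) has_integral (b - a)) {a..b}"
    using has_integral_const_real[of "1::real" a b] ab by simp
  have point: "\<bar>w x\<bar> \<le> L2_norm ?M w' * sqrt (b - a)" if x: "x \<in> {a..b}" for x
  proof -
    define i where "i = (\<lambda>q. if q \<in> {a..x} then 1 else 0 :: real)"
    have im: "i \<in> borel_measurable ?M"
      unfolding i_def by (rule measurable_restrict_space1, rule measurable_completion) measurable
    have iL: "i \<in> L2_space ?M"
    proof -
      have "integrable ?M (\<lambda>q. 1 :: real)" using oneL by (simp add: L2_space_def)
      then have "integrable ?M i"
        by (rule Bochner_Integration.integrable_bound[OF _ im]) (simp add: i_def)
      moreover have "(\<lambda>q. (i q)\<^sup>2) = i" by (simp add: i_def fun_eq_iff)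
      ultimately have "integrable ?M (\<lambda>q. (i q)\<^sup>2)" by simp
      then show ?thesis using im by (simp add: L2_space_def)
    qed
    have "(w' has_integral (w x - w a)) {a..x}"
    proof (rule fundamental_theorem_of_calculus)
      fix q assume q: "q \<in> {a..x}"
      then have "(w has_real_derivative w' q) (at q within {a..x})"
        using x by (intro DERIV_subset[OF dw]) auto
      then show "(w has_vector_derivative w' q) (at q within {a..x})"
        by (simp add: has_real_derivative_iff_has_vector_derivative)
    qed (use x in auto)
    then have "((\<lambda>q. if q \<in> {a..x} then w' q else 0) has_integral (w x - w a)) {a..b}"
      using x by (subst has_integral_restrict) auto
    moreover have "(\<lambda>q. if q \<in> {a..x} then w' q else 0) = (\<lambda>q. w' q * i q)" by (auto simp: i_def)
    ultimately have "w x - w a = L2_inner ?M w' i"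
      using L2_inner_interval(1)[OF w'L iL] by (metis has_integral_unique)
    moreover have "w a = 0" using w by (simp add: dirichlet_laplacian_def)
    ultimately have "\<bar>w x\<bar> \<le> L2_norm ?M w' * L2_norm ?M i" using L2_Cauchy_Schwarz[OF w'L iL] by simp
    also have "L2_norm ?M i \<le> sqrt (b - a)"
    proof -
      have "L2_inner ?M i i \<le> b - a"
        by (rule has_integral_le[OF L2_inner_interval(1)[OF iL iL] one]) (auto simp: i_def)
      then have "(L2_norm ?M i)\<^sup>2 \<le> b - a" by (simp add: L2_norm_power2)
      then show ?thesis by (simp add: real_le_rsqrt)
    qed
    finally show ?thesis by (simp add: L2_norm_nonneg mult_left_mono)
  qed
  have "L2_inner ?M w w \<le> (L2_norm ?M w' * sqrt (b - a))\<^sup>2 * (b - a)"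
  proof (rule has_integral_le[OF L2_inner_interval(1)[OF wL wL]])
    show "((\<lambda>x. (L2_norm ?M w' * sqrt (b - a))\<^sup>2) has_integral (L2_norm ?M w' * sqrt (b - a))\<^sup>2 * (b - a)) {a..b}"
      using has_integral_mult_right[OF one, of "(L2_norm ?M w' * sqrt (b - a))\<^sup>2"] by simp
    fix x assume "x \<in> {a..b}"
    then have "\<bar>w x\<bar>\<^sup>2 \<le> (L2_norm ?M w' * sqrt (b - a))\<^sup>2" by (intro power_mono point) auto
    then show "w x * w x \<le> (L2_norm ?M w' * sqrt (b - a))\<^sup>2" by (simp add: power2_eq_square)
  qed
  also have "\<dots> = ((b - a) * L2_norm ?M w')\<^sup>2"
    using ab by (simp add: power_mult_distrib power2_eq_square)
  finally have "(L2_norm ?M w)\<^sup>2 \<le> ((b - a) * L2_norm ?M w')\<^sup>2" by (simp add: L2_norm_power2)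
  then have "L2_norm ?M w \<le> (b - a) * L2_norm ?M w'"
    by (rule power2_le_imp_le) (use ab in \<open>simp add: L2_norm_nonneg\<close>)
  then show ?thesis by (simp add: norm_eq)
qed

locale eigensystem =
  fixes a b :: real and lam :: "nat \<Rightarrow> real" and \<phi> :: "nat \<Rightarrow> real \<Rightarrow> real"
  assumes ab: "a < b" and eig: "dirichlet_eigensystem a b lam \<phi>"
begin

abbreviation "M \<equiv> interval_measure_on a b"

lemma eigenfunction: "dirichlet_laplacian a b (\<phi> k) (\<lambda>x. - lam k * \<phi> k x)"
  and orthonormal: "L2_inner M (\<phi> j) (\<phi> k) = (if j = k then 1 else 0)"
  and complete: "f \<in> L2_space M \<Longrightarrow> (\<lambda>n. L2_norm M (\<lambda>x. f x - (\<Sum>k<n. L2_inner M f (\<phi> k) * \<phi> k x))) \<longlonglongrightarrow> 0"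
  using eig by (auto simp: dirichlet_eigensystem_def Let_def)

lemma \<phi>_L2: "\<phi> k \<in> L2_space M"
  by (rule dirichlet_laplacian_L2(1)[OF eigenfunction ab])

text \<open>By Green's identity an eigenvalue is the squared norm of the gradient of a unit vector, and
  the Poincare inequality bounds that below.\<close>

lemma eigenvalue_lower_bound: "1 / (b - a)\<^sup>2 \<le> lam k"
proof -
  have "- lam k = L2_inner M (\<lambda>x. - lam k * \<phi> k x) (\<phi> k)"
    unfolding L2_inner_scale_left by (simp add: orthonormal)
  also have "\<dots> = - (L2_norm M (deriv (\<phi> k)))\<^sup>2"
    unfolding L2_norm_power2 by (rule dirichlet_green(1)[OF eigenfunction eigenfunction ab])
  finally have lam: "lam k = (L2_norm M (deriv (\<phi> k)))\<^sup>2" by simp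
  have "L2_norm M (\<phi> k) = 1"
    using L2_norm_power2[of M "\<phi> k"] L2_norm_nonneg[of M "\<phi> k"] by (simp add: orthonormal power2_eq_1_iff)
  then have "1 \<le> (b - a) * L2_norm M (deriv (\<phi> k))"
    using poincare_inequality[OF eigenfunction ab, of k] by simp
  then have "1\<^sup>2 \<le> ((b - a) * L2_norm M (deriv (\<phi> k)))\<^sup>2" by (intro power_mono) auto
  then have "1 \<le> (b - a)\<^sup>2 * lam k" by (simp add: power_mult_distrib lam)
  then show ?thesis using ab by (simp add: pos_divide_le_eq mult.commute)
qed

lemma eigenvalue_pos: "0 < lam k"
proof -
  have "0 < 1 / (b - a)\<^sup>2" using ab by simp
  then show ?thesis using eigenvalue_lower_bound[of k] by linarith
qed

lemma expansion_inner:
  assumes w: "w \<in> L2_space M" and h: "h \<in> L2_space M"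
    and lim: "(\<lambda>n. L2_norm M (\<lambda>x. w x - (\<Sum>k<n. c k * \<phi> k x))) \<longlonglongrightarrow> 0"
  shows "(\<lambda>n. \<Sum>k<n. c k * L2_inner M (\<phi> k) h) \<longlonglongrightarrow> L2_inner M w h"
proof -
  have P: "(\<lambda>x. \<Sum>k<n. c k * \<phi> k x) \<in> L2_space M" for n
    by (rule L2_sum) (rule L2_scale[OF \<phi>_L2])
  have sw: "L2_norm M (\<lambda>x. w x - (\<Sum>k<n. c k * \<phi> k x)) = L2_norm M (\<lambda>x. (\<Sum>k<n. c k * \<phi> k x) - w x)" for n
    by (simp add: L2_norm_def power2_commute)
  have "(\<lambda>n. L2_inner M (\<lambda>x. \<Sum>k<n. c k * \<phi> k x) h) \<longlonglongrightarrow> L2_inner M w h"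
    by (rule L2_inner_tendsto[OF lim[unfolded sw] _ w h]) (simp add: P)
  moreover have "L2_inner M (\<lambda>x. \<Sum>k<n. c k * \<phi> k x) h = (\<Sum>k<n. c k * L2_inner M (\<phi> k) h)" for n
    using L2_inner_sum_left[of "{..<n}" "\<lambda>k x. c k * \<phi> k x" M h] L2_scale[OF \<phi>_L2] h
    by (simp add: L2_inner_scale_left)
  ultimately show ?thesis by simp
qed

lemma parseval:
  assumes "f \<in> L2_space M" "h \<in> L2_space M"
  shows "(\<lambda>n. \<Sum>k<n. L2_inner M f (\<phi> k) * L2_inner M h (\<phi> k)) \<longlonglongrightarrow> L2_inner M f h"
  using expansion_inner[OF assms complete[OF assms(1)]] by (simp only: L2_inner_commute[of M h])

lemma bessel:
  assumes "f \<in> L2_space M"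
  shows "(\<Sum>k<n. (L2_inner M f (\<phi> k))\<^sup>2) \<le> (L2_norm M f)\<^sup>2"
proof (rule incseq_le)
  show "incseq (\<lambda>n. \<Sum>k<n. (L2_inner M f (\<phi> k))\<^sup>2)" by (intro incseq_SucI) simp
  show "(\<lambda>n. \<Sum>k<n. (L2_inner M f (\<phi> k))\<^sup>2) \<longlonglongrightarrow> (L2_norm M f)\<^sup>2"
    unfolding L2_norm_power2 power2_eq_square[of "L2_inner M f _"] by (rule parseval[OF assms assms])
qed

lemma expansion_coefficient:
  assumes w: "w \<in> L2_space M"
    and lim: "(\<lambda>n. L2_norm M (\<lambda>x. w x - (\<Sum>k<n. c k * \<phi> k x))) \<longlonglongrightarrow> 0"
  shows "L2_inner M w (\<phi> j) = c j"
proof -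
  have "(\<lambda>n. \<Sum>k<n. c k * L2_inner M (\<phi> k) (\<phi> j)) \<longlonglongrightarrow> L2_inner M w (\<phi> j)"
    by (rule expansion_inner[OF w \<phi>_L2 lim])
  moreover have "(\<lambda>n. \<Sum>k<n. c k * L2_inner M (\<phi> k) (\<phi> j)) \<longlonglongrightarrow> c j"
  proof (rule tendsto_eventually)
    have "(\<Sum>k<n. c k * L2_inner M (\<phi> k) (\<phi> j)) = c j" if "j < n" for n
    proof -
      have "(\<Sum>k<n. c k * L2_inner M (\<phi> k) (\<phi> j)) = (\<Sum>k<n. if k = j then c j else 0)"
        by (intro sum.cong) (auto simp: orthonormal)
      then show ?thesis using that by simp
    qed
    then show "\<forall>\<^sub>F n in sequentially. (\<Sum>k<n. c k * L2_inner M (\<phi> k) (\<phi> j)) = c j"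
      by (intro eventually_mono[OF eventually_gt_at_top[of j]]) auto
  qed
  ultimately show ?thesis by (rule LIMSEQ_unique)
qed

lemma laplacian_coefficient:
  assumes "dirichlet_laplacian a b w z"
  shows "L2_inner M z (\<phi> k) = - lam k * L2_inner M w (\<phi> k)"
  using dirichlet_symmetric[OF assms eigenfunction ab, of k] L2_inner_scale_left[of M "- lam k" "\<phi> k" w]
    L2_inner_commute[of M w "\<lambda>x. - lam k * \<phi> k x"] L2_inner_commute[of M w "\<phi> k"]
  by metis

text \<open>Green's identity writes the squared norm of the gradient as the inner product of \<open>-
  z\<close> with \<open>w\<close>, where \<open>z\<close> is the Laplacian of \<open>w\<close>; Parseval's
  identity and symmetry do the rest.\<close>

lemma gradient_parseval:
  assumes "dirichlet_laplacian a b w z"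
  shows "(\<lambda>n. \<Sum>k<n. lam k * (L2_inner M w (\<phi> k))\<^sup>2) \<longlonglongrightarrow> (L2_norm M (deriv w))\<^sup>2"
proof -
  have "(\<lambda>n. - (\<Sum>k<n. L2_inner M z (\<phi> k) * L2_inner M w (\<phi> k))) \<longlonglongrightarrow> - L2_inner M z w"
    using dirichlet_laplacian_L2[OF assms ab] by (intro tendsto_minus parseval)
  moreover have "- (\<Sum>k<n. L2_inner M z (\<phi> k) * L2_inner M w (\<phi> k)) = (\<Sum>k<n. lam k * (L2_inner M w (\<phi> k))\<^sup>2)" for n
    by (simp add: laplacian_coefficient[OF assms] sum_negf[symmetric] power2_eq_square mult.assoc)
  moreover have "- L2_inner M z w = (L2_norm M (deriv w))\<^sup>2"
    using dirichlet_green(1)[OF assms assms ab] by (simp add: L2_norm_power2)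
  ultimately show ?thesis by simp
qed

end

section \<open>Volterra form of the Caputo equation\<close>

lemma has_bochner_integral_lebesgue_on_iff:
  fixes h k :: "real \<Rightarrow> real"
  assumes S: "S \<in> sets borel" and k: "k \<in> borel_measurable borel" and eq: "\<And>s. k s = indicator S s * h s"
  shows "has_bochner_integral (lebesgue_on S) h I \<longleftrightarrow> has_bochner_integral lborel k I"
proof -
  have kk: "(\<lambda>s. indicator S s *\<^sub>R h s) = k" by (simp add: eq fun_eq_iff)
  have SL: "S \<inter> space lebesgue \<in> sets lebesgue" using S by simp
  have "integrable (lebesgue_on S) h \<longleftrightarrow> integrable lborel k"
    unfolding integrable_restrict_space[OF SL] kk using k by (intro integrable_completion) simp
  moreover have "integral\<^sup>L (lebesgue_on S) h = integral\<^sup>L lborel k"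
    unfolding integral_restrict_space[OF SL] kk using k by (intro integral_completion) simp
  ultimately show ?thesis by (simp add: has_bochner_integral_iff)
qed

text \<open>Fractional integrals are taken over the whole line while a solution is given on [0,T] only.
  Freezing its values outside keeps it continuous and, as it vanishes at 0, causal; integrals up to a time
  in [0,T] do not see the difference.\<close>

definition stopped :: "real \<Rightarrow> (real \<Rightarrow> real) \<Rightarrow> real \<Rightarrow> real" where
  "stopped T f s = f (max 0 (min s T))"

lemma stopped_nonpos: "0 < T \<Longrightarrow> f 0 = 0 \<Longrightarrow> s \<le> 0 \<Longrightarrow> stopped T f s = 0"
  by (simp add: stopped_def max_def)

lemma stopped_eq: "0 \<le> s \<Longrightarrow> s \<le> T \<Longrightarrow> stopped T f s = f s"
  by (simp add: stopped_def)

lemma stopped_continuous: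
  assumes "0 < T" "continuous_on {0..T} f"
  shows "continuous_on UNIV (stopped T f)"
  unfolding stopped_def
  by (rule continuous_on_compose2[OF assms(2)]) (use assms(1) in \<open>auto intro!: continuous_intros\<close>)

lemma stopped_measurable: "0 < T \<Longrightarrow> continuous_on {0..T} f \<Longrightarrow> stopped T f \<in> borel_measurable borel"
  by (intro borel_measurable_continuous_onI stopped_continuous)

lemma stopped_bound:
  assumes "0 < T" "continuous_on {0..T} f" "f 0 = 0"
  shows "\<exists>B\<ge>0. \<forall>s. \<bar>stopped T f s\<bar> \<le> B * frac_kernel 1 s"
proof -
  have "bounded (f ` {0..T})" by (intro compact_imp_bounded compact_continuous_image assms) auto
  then obtain B where B: "\<forall>x\<in>f ` {0..T}. norm x \<le> B" unfolding bounded_iff by blast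
  have "f 0 \<in> f ` {0..T}" using assms(1) by simp
  then have B0: "0 \<le> B" using B by fastforce
  have "\<bar>stopped T f s\<bar> \<le> B * frac_kernel 1 s" for s
  proof (cases "0 < s")
    case True
    have "max 0 (min s T) \<in> {0..T}" using assms(1) by auto
    then show ?thesis using B True by (auto simp: stopped_def frac_kernel_def omega_def)
  qed (use assms stopped_nonpos in \<open>auto simp: frac_kernel_def\<close>)
  then show ?thesis using B0 by blast
qed

lemma frac_int_local:
  assumes "\<And>s. s < t \<Longrightarrow> f s = g s"
  shows "frac_int b f t = frac_int b g t"
proof -
  have eq: "frac_kernel b (t - s) * f s = frac_kernel b (t - s) * g s" for s
    using assms[of s] by (auto simp: frac_kernel_def)
  show ?thesis unfolding frac_int_def by (rule Bochner_Integration.integral_cong[OF refl eq])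
qed

lemma frac_int_scale: "frac_int b (\<lambda>s. c * f s) t = c * frac_int b f t"
proof -
  have eq: "frac_kernel b (t - s) * (c * f s) = c * (frac_kernel b (t - s) * f s)" for s by simp
  show ?thesis unfolding frac_int_def eq by (rule integral_mult_right_zero)
qed

text \<open>The derivative formula is the fundamental theorem of calculus after splitting one order of
  integration off by the semigroup law.\<close>

lemma frac_int_stopped:
  assumes T: "0 < T" and f: "continuous_on {0..T} f" "f 0 = 0" and b: "0 < b"
  shows "continuous_on {0..} (frac_int b (stopped T f))"
    and "\<And>t. t \<le> 0 \<Longrightarrow> frac_int b (stopped T f) t = 0"
    and "\<And>t. 1 < b \<Longrightarrow> 0 < t \<Longrightarrow> (frac_int b (stopped T f) has_real_derivative frac_int (b - 1) (stopped T f) t) (at t)"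
    and "\<And>t. integrable lborel (\<lambda>s. frac_kernel b (t - s) * stopped T f s)"
proof -
  obtain B where B: "0 \<le> B" "\<And>s. \<bar>stopped T f s\<bar> \<le> B * frac_kernel 1 s"
    using stopped_bound[OF T f] by blast
  note m = stopped_measurable[OF T f(1)]
  have zero: "stopped T f s = 0" if "s \<le> 0" for s by (rule stopped_nonpos[where f = f, OF T f(2) that])
  have cont: "continuous_on {0..} (frac_int c (stopped T f))" if "0 < c" for c
    by (rule frac_int_continuous[OF that m continuous_on_subset[OF stopped_continuous[OF T f(1)]]]) (use zero in auto)
  show "continuous_on {0..} (frac_int b (stopped T f))" by (rule cont[OF b])
  show z: "frac_int b (stopped T f) t = 0" if "t \<le> 0" for t by (rule frac_int_nonpos[OF zero that])
  show "integrable lborel (\<lambda>s. frac_kernel b (t - s) * stopped T f s)" for t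
    by (rule frac_int_bound(2)[OF b B(2) m])
  show "(frac_int b (stopped T f) has_real_derivative frac_int (b - 1) (stopped T f) t) (at t)" if b1: "1 < b" and t: "0 < t" for t
  proof -
    define h where "h = frac_int (b - 1) (stopped T f)"
    have "frac_int 1 h s = frac_int b (stopped T f) s" for s
      unfolding h_def using frac_int_semigroup(1)[of 1 "b - 1" "stopped T f" s] b1 m frac_int_bound(2)[OF b B(2) m, of s] by simp
    then have "frac_int b (stopped T f) = frac_int 1 h" by (simp add: fun_eq_iff)
    moreover have ch: "continuous_on {0..} h" unfolding h_def using b1 by (intro cont) simp
    moreover have "(frac_int 1 h has_real_derivative h t) (at t)"
    proof (rule frac_int_one_deriv[of h "t + 1"])
      show "h s = 0" if "s \<le> 0" for s unfolding h_def by (rule frac_int_nonpos[OF zero that])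
      show "set_integrable lborel {0..t + 1} h"
        by (rule borel_integrable_atLeastAtMost'[OF continuous_on_subset[OF ch]]) auto
      show "isCont h t" by (rule continuous_on_interior[OF ch]) (use t in simp)
    qed (use t in auto)
    ultimately show ?thesis by (simp add: h_def)
  qed
qed

text \<open>A pointwise limit of difference quotients of a measurable function. Measurability for the
  Borel sets is what the convolution arguments need, whereas the definition of the Caputo derivative
  supplies it for Lebesgue sets only.\<close>

lemma derivative_measurable:
  fixes y1 y2 :: "real \<Rightarrow> real"
  assumes c: "continuous_on {0..t} y1" and d: "\<And>s. s \<in> {0<..<t} \<Longrightarrow> (y1 has_real_derivative y2 s) (at s)"
  shows "(\<lambda>s. if s \<in> {0<..<t} then y2 s else 0) \<in> borel_measurable borel"
proof (rule borel_measurable_LIMSEQ_real)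
  define Y where "Y = (\<lambda>s. indicator {0..t} s *\<^sub>R y1 s)"
  have [measurable]: "Y \<in> borel_measurable borel"
    unfolding Y_def using c by (intro borel_measurable_continuous_on_indicator) auto
  define h where "h = (\<lambda>n. inverse (real (Suc n)))"
  show "(\<lambda>s. indicator {0<..<t} s * ((Y (s + h n) - Y s) / h n)) \<in> borel_measurable borel" for n
    by measurable
  fix s :: real
  show "(\<lambda>n. indicator {0<..<t} s * ((Y (s + h n) - Y s) / h n)) \<longlonglongrightarrow> (if s \<in> {0<..<t} then y2 s else 0)"
  proof (cases "s \<in> {0<..<t}")
    case True
    have h0: "h \<longlonglongrightarrow> 0" unfolding h_def by (rule LIMSEQ_inverse_real_of_nat)
    have hpos: "0 < h n" for n by (simp add: h_def)
    have "((\<lambda>x. (y1 (s + x) - y1 s) / x) \<longlongrightarrow> y2 s) (at 0)" using d[OF True] by (simp add: DERIV_def)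
    moreover have "filterlim h (at 0) sequentially"
      using h0 hpos by (auto simp: filterlim_at intro!: always_eventually less_imp_neq[THEN not_sym])
    ultimately have "(\<lambda>n. (y1 (s + h n) - y1 s) / h n) \<longlonglongrightarrow> y2 s" by (rule filterlim_compose)
    moreover have "\<forall>\<^sub>F n in sequentially. (y1 (s + h n) - y1 s) / h n = indicator {0<..<t} s * ((Y (s + h n) - Y s) / h n)"
    proof -
      have "\<forall>\<^sub>F n in sequentially. h n < t - s" using order_tendstoD(2)[OF h0, of "t - s"] True by simp
      then show ?thesis
      proof eventually_elim
        case (elim n)
        then show ?case using True hpos[of n] by (simp add: Y_def)
      qed
    qed
    ultimately have "(\<lambda>n. indicator {0<..<t} s * ((Y (s + h n) - Y s) / h n)) \<longlonglongrightarrow> y2 s"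
      by (rule Lim_transform_eventually)
    then show ?thesis using True by simp
  qed auto
qed

lemma derivative_unique_left:
  fixes y :: "real \<Rightarrow> real"
  assumes "(y has_real_derivative d) (at t within {0..t})" "(y has_real_derivative e) (at t)" "0 < t"
  shows "d = e"
proof -
  have "at t within {0..t} = at_left t" using assms(3) by (simp add: at_within_Icc_at_left)
  moreover have "(y has_real_derivative e) (at t within {0..t})"
    using assms(2) by (rule has_field_derivative_at_within)
  ultimately show ?thesis
    using assms(1) unfolding has_field_derivative_iff
    by (intro tendsto_unique[of "at_left t" "\<lambda>s. (y s - y t) / (s - t)"]) (auto simp: trivial_limit_at_left_real)
qed

lemma derivative_unique_right:
  fixes y :: "real \<Rightarrow> real"
  assumes "(y has_real_derivative d) (at 0 within {0..t})" "(y has_real_derivative e) (at 0 within {0..T})" "0 < t" "t \<le> T"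
  shows "d = e"
proof -
  have "at 0 within {0..t} = at_right (0::real)" using assms(3) by (simp add: at_within_Icc_at_right)
  moreover have "(y has_real_derivative e) (at 0 within {0..t})"
    using assms by (intro DERIV_subset[OF assms(2)]) auto
  ultimately show ?thesis
    using assms(1) unfolding has_field_derivative_iff
    by (intro tendsto_unique[of "at_right 0" "\<lambda>s. (y s - y 0) / (s - 0)"]) (auto simp: trivial_limit_at_right_real)
qed

text \<open>Applying the integral of order \<open>\<alpha> - 1\<close> to the equation turns its left
  side, by the semigroup law, into the integral of \<open>y''\<close>, that is \<open>y' t - y' 0\<close>.
  Hence \<open>y'\<close> equals \<open>a0\<close> minus a fractional integral of \<open>y\<close>, and
  integrating once more gives the claim. The derivatives in the hypothesis may depend on \<open>t\<close>;
  uniqueness of derivatives identifies them.\<close>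

lemma caputo_volterra:
  fixes y :: "real \<Rightarrow> real"
  assumes T: "0 < T" and \<alpha>: "1 < \<alpha>" "\<alpha> < 2" and y: "continuous_on {0..T} y" "y 0 = 0"
    and init: "(y has_real_derivative a0) (at 0 within {0..T})"
    and caputo: "\<And>t. t \<in> {0<..<T} \<Longrightarrow> \<exists>y1 y2. (\<forall>s\<in>{0..t}. (y has_real_derivative y1 s) (at s within {0..t})) \<and>
      continuous_on {0..t} y1 \<and> (\<forall>s\<in>{0<..<t}. (y1 has_real_derivative y2 s) (at s within {0..t})) \<and>
      has_bochner_integral (lebesgue_on {0<..<t}) (\<lambda>s. 1 / Gamma (2 - \<alpha>) * (t - s) powr (1 - \<alpha>) * y2 s) (- lam * y t)"
    and t: "t \<in> {0..T}"
  shows "y t + lam * frac_int \<alpha> (stopped T y) t = a0 * t"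
proof -
  have interior: "(g has_real_derivative d) (at s)"
    if "(g has_real_derivative d) (at s within {0..r})" "0 < s" "s < r" for g d s r
    using that by (simp add: at_within_Icc_at)
  have G: "0 < Gamma (2 - \<alpha>)" using \<alpha> by (intro Gamma_real_pos) auto
  have key: "\<exists>d. (y has_real_derivative d) (at t0 within {0..t0}) \<and> d = a0 - lam * frac_int (\<alpha> - 1) (stopped T y) t0"
    if t0: "t0 \<in> {0<..<T}" for t0
  proof -
    obtain y1 y2 where y1: "\<forall>s\<in>{0..t0}. (y has_real_derivative y1 s) (at s within {0..t0})"
      and c1: "continuous_on {0..t0} y1" and y2: "\<forall>s\<in>{0<..<t0}. (y1 has_real_derivative y2 s) (at s within {0..t0})"
      and int: "has_bochner_integral (lebesgue_on {0<..<t0}) (\<lambda>s. 1 / Gamma (2 - \<alpha>) * (t0 - s) powr (1 - \<alpha>) * y2 s) (- lam * y t0)"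
      using caputo[OF t0] by blast
    have y2': "(y1 has_real_derivative y2 s) (at s)" if "s \<in> {0<..<t0}" for s
      using y2 that by (intro interior[of y1 "y2 s" s t0]) auto
    define f where "f = (\<lambda>s. if s \<in> {0<..<t0} then y2 s else 0)"
    have fm [measurable]: "f \<in> borel_measurable borel"
      unfolding f_def by (rule derivative_measurable[OF c1 y2'])
    have lb: "has_bochner_integral lborel (\<lambda>s. frac_kernel (2 - \<alpha>) (r - s) * f s) (- lam * y r)" if r: "0 < r" "r \<le> t0" for r
    proof -
      have r': "r \<in> {0<..<T}" using r t0 by auto
      obtain z1 z2 where z1: "\<forall>s\<in>{0..r}. (y has_real_derivative z1 s) (at s within {0..r})"
        and z2: "\<forall>s\<in>{0<..<r}. (z1 has_real_derivative z2 s) (at s within {0..r})"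
        and zint: "has_bochner_integral (lebesgue_on {0<..<r}) (\<lambda>s. 1 / Gamma (2 - \<alpha>) * (r - s) powr (1 - \<alpha>) * z2 s) (- lam * y r)"
        using caputo[OF r'] by blast
      have z1y1: "z1 s = y1 s" if "s \<in> {0<..<r}" for s
      proof (rule DERIV_unique)
        show "(y has_real_derivative z1 s) (at s)" using z1 that by (intro interior[of y "z1 s" s r]) auto
        show "(y has_real_derivative y1 s) (at s)" using y1 that r by (intro interior[of y "y1 s" s t0]) auto
      qed
      have z2y2: "z2 s = y2 s" if s: "s \<in> {0<..<r}" for s
      proof (rule DERIV_unique)
        show "(z1 has_real_derivative z2 s) (at s)" using z2 s by (intro interior[of z1 "z2 s" s r]) auto
        show "(z1 has_real_derivative y2 s) (at s)"
        proof (rule has_field_derivative_transform_within_open)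
          show "(y1 has_real_derivative y2 s) (at s)" using s r by (intro y2') auto
          show "y1 q = z1 q" if "q \<in> {0<..<r}" for q using z1y1[OF that] by simp
        qed (use s in auto)
      qed
      have eq: "frac_kernel (2 - \<alpha>) (r - s) * f s = indicator {0<..<r} s * (1 / Gamma (2 - \<alpha>) * (r - s) powr (1 - \<alpha>) * z2 s)" for s
        using z2y2[of s] r by (auto simp: frac_kernel_def omega_def f_def indicator_def)
      have km: "(\<lambda>s. frac_kernel (2 - \<alpha>) (r - s) * f s) \<in> borel_measurable borel" by measurable
      show ?thesis
        by (rule iffD1[OF has_bochner_integral_lebesgue_on_iff[OF _ km eq] zint]) simp
    qed
    have fz: "f s = 0" if "s \<le> 0" for s using that by (simp add: f_def)
    \<comment> \<open>The kernel is bounded below on the bounded interval, so integrability against it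
      implies integrability.\<close>
    have fint: "integrable lborel f"
    proof (rule Bochner_Integration.integrable_bound)
      define k where "k = t0 powr (1 - \<alpha>) / Gamma (2 - \<alpha>)"
      have k: "0 < k" using t0 G by (simp add: k_def)
      show "integrable lborel (\<lambda>s. (1 / k) * (frac_kernel (2 - \<alpha>) (t0 - s) * f s))"
        using lb[of t0] t0 by (intro integrable_mult_right) (simp add: has_bochner_integral_iff)
      have "norm (f s) \<le> norm ((1 / k) * (frac_kernel (2 - \<alpha>) (t0 - s) * f s))" for s
      proof (cases "s \<in> {0<..<t0}")
        case True
        have "t0 powr (1 - \<alpha>) \<le> (t0 - s) powr (1 - \<alpha>)" using True \<alpha> by (intro powr_mono2') auto
        then have "k \<le> frac_kernel (2 - \<alpha>) (t0 - s)"
          using True G by (simp add: k_def frac_kernel_def omega_def divide_right_mono)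
        then have "k * \<bar>f s\<bar> \<le> frac_kernel (2 - \<alpha>) (t0 - s) * \<bar>f s\<bar>" by (intro mult_right_mono) auto
        then show ?thesis using k frac_kernel_nonneg[of "2 - \<alpha>" "t0 - s"] \<alpha>
          by (simp add: abs_mult pos_le_divide_eq mult.commute)
      qed (auto simp: f_def)
      then show "AE s in lborel. norm (f s) \<le> norm ((1 / k) * (frac_kernel (2 - \<alpha>) (t0 - s) * f s))" by simp
    qed measurable
    have k1: "(\<lambda>s. frac_kernel 1 (t0 - s) * f s) = f"
      by (auto simp: frac_kernel_def omega_def f_def fun_eq_iff)
    have semi: "frac_int (\<alpha> - 1) (frac_int (2 - \<alpha>) f) t0 = frac_int 1 f t0"
      using frac_int_semigroup(1)[of "\<alpha> - 1" "2 - \<alpha>" f t0] \<alpha> fint by (simp add: k1)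
    have "frac_int (\<alpha> - 1) (frac_int (2 - \<alpha>) f) t0 = frac_int (\<alpha> - 1) (\<lambda>r. - lam * stopped T y r) t0"
    proof (rule frac_int_local)
      fix r assume r: "r < t0"
      show "frac_int (2 - \<alpha>) f r = - lam * stopped T y r"
      proof (cases "r \<le> 0")
        case True
        then show ?thesis using frac_int_nonpos[OF fz True] stopped_nonpos[where f = y, OF T y(2) True] by simp
      next
        case False
        then have "stopped T y r = y r" using r t0 by (intro stopped_eq) auto
        then show ?thesis using lb[of r] False r by (simp add: frac_int_def has_bochner_integral_iff)
      qed
    qed
    also have "\<dots> = - lam * frac_int (\<alpha> - 1) (stopped T y) t0" by (rule frac_int_scale)
    finally have e1: "frac_int 1 f t0 = - lam * frac_int (\<alpha> - 1) (stopped T y) t0" using semi by simp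
    have "set_integrable lborel {0..t0} f"
      unfolding set_integrable_def by (rule integrable_mult_indicator[OF _ fint]) simp
    then have "frac_int 1 f t0 = integral {0..t0} f" using t0 by (intro frac_int_one_eq_integral[OF fz]) auto
    also have "(f has_integral (y1 t0 - y1 0)) {0..t0}"
    proof (rule fundamental_theorem_of_calculus_interior[OF _ c1])
      fix x assume x: "x \<in> {0<..<t0}"
      then show "(y1 has_vector_derivative f x) (at x)"
        using y2'[OF x] by (simp add: f_def has_real_derivative_iff_has_vector_derivative)
    qed (use t0 in auto)
    then have "integral {0..t0} f = y1 t0 - y1 0" by (rule integral_unique)
    finally have e2: "frac_int 1 f t0 = y1 t0 - y1 0" .
    have "y1 0 = a0"
      by (rule derivative_unique_right[OF _ init]) (use y1 t0 in auto)
    then have "y1 t0 = a0 - lam * frac_int (\<alpha> - 1) (stopped T y) t0" using e1 e2 by simp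
    moreover have "(y has_real_derivative y1 t0) (at t0 within {0..t0})" using y1 t0 by simp
    ultimately show ?thesis by blast
  qed
  have deriv: "(y has_real_derivative a0 - lam * frac_int (\<alpha> - 1) (stopped T y) s) (at s)" if s: "s \<in> {0<..<T}" for s
  proof -
    have "(s + T) / 2 \<in> {0<..<T}" using s by auto
    from caputo[OF this] obtain z where "\<forall>q\<in>{0..(s + T) / 2}. (y has_real_derivative z q) (at q within {0..(s + T) / 2})"
      by blast
    then have z: "(y has_real_derivative z s) (at s)" using s by (intro interior[of y "z s" s "(s + T) / 2"]) auto
    obtain d where d: "(y has_real_derivative d) (at s within {0..s})" "d = a0 - lam * frac_int (\<alpha> - 1) (stopped T y) s"
      using key[OF s] by blast
    have "d = z s" by (rule derivative_unique_left[OF d(1) z]) (use s in simp)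
    then show ?thesis using z d(2) by simp
  qed
  define g where "g = (\<lambda>t. y t + lam * frac_int \<alpha> (stopped T y) t - a0 * t)"
  have \<alpha>0: "0 < \<alpha>" using \<alpha> by simp
  note F = frac_int_stopped[OF T y \<alpha>0]
  have "g t = g 0"
  proof (cases "t = 0")
    case False
    show ?thesis
    proof (rule DERIV_isconst_end[of 0 t g])
      show "continuous_on {0..t} g" unfolding g_def using t
        by (intro continuous_intros continuous_on_subset[OF y(1)] continuous_on_subset[OF F(1)]) auto
      fix x assume x: "0 < x" "x < t"
      have "(g has_real_derivative (a0 - lam * frac_int (\<alpha> - 1) (stopped T y) x) + lam * frac_int (\<alpha> - 1) (stopped T y) x - a0 * 1) (at x)"
        unfolding g_def using x t
        by (intro DERIV_diff DERIV_add DERIV_cmult deriv F(3) \<alpha>(1) DERIV_ident) auto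
      then show "DERIV g x :> 0" by simp
    qed (use t False in auto)
  qed simp
  then show ?thesis using F(2)[of 0] y(2) by (simp add: g_def)
qed

text \<open>For orders above 1 the kernel is bounded on [0,T]. Iterating the equation for the difference
  therefore gains a factor \<open>t^n / fact n\<close>.\<close>

lemma volterra_unique:
  fixes y Y :: "real \<Rightarrow> real"
  assumes T: "0 < T" and \<alpha>: "1 < \<alpha>" and lam: "0 < lam"
    and y: "continuous_on {0..T} y" "y 0 = 0" and Y: "continuous_on {0..T} Y" "Y 0 = 0"
    and eq: "\<And>t. t \<in> {0..T} \<Longrightarrow> y t + lam * frac_int \<alpha> (stopped T y) t = Y t + lam * frac_int \<alpha> (stopped T Y) t"
    and t: "t \<in> {0..T}"
  shows "y t = Y t"
proof -
  have \<alpha>0: "0 < \<alpha>" using \<alpha> by simp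
  define d where "d = (\<lambda>s. stopped T y s - stopped T Y s)"
  obtain B1 where B1: "0 \<le> B1" "\<And>s. \<bar>stopped T y s\<bar> \<le> B1 * frac_kernel 1 s" using stopped_bound[OF T y] by blast
  obtain B2 where B2: "0 \<le> B2" "\<And>s. \<bar>stopped T Y s\<bar> \<le> B2 * frac_kernel 1 s" using stopped_bound[OF T Y] by blast
  define B where "B = B1 + B2"
  define c where "c = lam * omega \<alpha> T"
  have B0: "0 \<le> B" using B1 B2 by (simp add: B_def)
  have c0: "0 \<le> c" using lam omega_nonneg[OF \<alpha>0, of T] by (simp add: c_def)
  have int: "integrable lborel (\<lambda>s. frac_kernel \<alpha> (t - s) * d s)" for t
    unfolding d_def by (rule frac_int_diff(2)[OF frac_int_stopped(4)[OF T y \<alpha>0] frac_int_stopped(4)[OF T Y \<alpha>0]])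
  have deq: "d t = - lam * frac_int \<alpha> d t" if "t \<in> {0..T}" for t
  proof -
    have "frac_int \<alpha> d t = frac_int \<alpha> (stopped T y) t - frac_int \<alpha> (stopped T Y) t"
      unfolding d_def by (rule frac_int_diff(1)[OF frac_int_stopped(4)[OF T y \<alpha>0] frac_int_stopped(4)[OF T Y \<alpha>0]])
    then have l: "lam * frac_int \<alpha> d t = lam * frac_int \<alpha> (stopped T y) t - lam * frac_int \<alpha> (stopped T Y) t"
      by (simp add: right_diff_distrib)
    have "d t = y t - Y t" using that by (simp add: d_def stopped_eq)
    then show ?thesis using eq[OF that] l by simp
  qed
  have bound: "\<bar>d t\<bar> \<le> B * c ^ n * frac_kernel (real n + 1) t" if "t \<le> T" for n t
    using that
  proof (induction n arbitrary: t)
    case 0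
    have "\<bar>d t\<bar> \<le> \<bar>stopped T y t\<bar> + \<bar>stopped T Y t\<bar>" by (simp add: d_def)
    then show ?case using B1(2)[of t] B2(2)[of t] by (simp add: B_def algebra_simps)
  next
    case (Suc n)
    show ?case
    proof (cases "t \<le> 0")
      case True
      then show ?thesis using stopped_nonpos[where f = y, OF T y(2) True] stopped_nonpos[where f = Y, OF T Y(2) True] by (simp add: d_def frac_kernel_def)
    next
      case False
      have k: "has_bochner_integral lborel (\<lambda>s. omega \<alpha> T * (B * c ^ n) * (frac_kernel 1 (t - s) * frac_kernel (real n + 1) (s - 0)))
          (omega \<alpha> T * (B * c ^ n) * frac_kernel (1 + (real n + 1)) (t - 0))"
        by (intro has_bochner_integral_mult_right frac_kernel_convolution) auto
      have le: "norm (frac_kernel \<alpha> (t - s) * d s) \<le> omega \<alpha> T * (B * c ^ n) * (frac_kernel 1 (t - s) * frac_kernel (real n + 1) (s - 0))" for s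
      proof (cases "0 < s \<and> s < t")
        case True
        have "frac_kernel \<alpha> (t - s) \<le> omega \<alpha> T"
          using True Suc.prems \<alpha> Gamma_real_pos[OF \<alpha>0] unfolding frac_kernel_def omega_def
          by (auto intro!: divide_right_mono powr_mono2)
        moreover have "\<bar>d s\<bar> \<le> B * c ^ n * frac_kernel (real n + 1) s" using Suc True by auto
        ultimately have "frac_kernel \<alpha> (t - s) * \<bar>d s\<bar> \<le> omega \<alpha> T * (B * c ^ n * frac_kernel (real n + 1) s)"
          using omega_nonneg[OF \<alpha>0, of T] by (intro mult_mono) auto
        then show ?thesis
          using True frac_kernel_nonneg[OF \<alpha>0, of "t - s"] by (simp add: abs_mult frac_kernel_def[of 1] omega_def[of 1] mult.assoc)
      next
        case False
        then have "frac_kernel \<alpha> (t - s) * d s = 0"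
          using stopped_nonpos[where f = y, OF T y(2), of s] stopped_nonpos[where f = Y, OF T Y(2), of s] by (auto simp: d_def frac_kernel_def)
        moreover have "0 \<le> omega \<alpha> T * (B * c ^ n) * (frac_kernel 1 (t - s) * frac_kernel (real n + 1) (s - 0))"
          using omega_nonneg[OF \<alpha>0, of T] B0 c0 by (intro mult_nonneg_nonneg frac_kernel_nonneg) auto
        ultimately show ?thesis by (simp only: norm_zero)
      qed
      have "\<bar>frac_int \<alpha> d t\<bar> \<le> (\<integral>s. norm (frac_kernel \<alpha> (t - s) * d s) \<partial>lborel)"
        unfolding frac_int_def using integral_norm_bound[of lborel "\<lambda>s. frac_kernel \<alpha> (t - s) * d s"] by simp
      also have "\<dots> \<le> (\<integral>s. omega \<alpha> T * (B * c ^ n) * (frac_kernel 1 (t - s) * frac_kernel (real n + 1) (s - 0)) \<partial>lborel)"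
        by (intro integral_mono integrable_norm int le) (use k in \<open>simp only: has_bochner_integral_iff\<close>)
      also have "\<dots> = omega \<alpha> T * (B * c ^ n) * frac_kernel (1 + (real n + 1)) (t - 0)"
        using k by (simp only: has_bochner_integral_iff)
      finally have "lam * \<bar>frac_int \<alpha> d t\<bar> \<le> lam * (omega \<alpha> T * (B * c ^ n) * frac_kernel (1 + (real n + 1)) (t - 0))"
        using lam by (intro mult_left_mono) auto
      moreover have "\<bar>d t\<bar> = lam * \<bar>frac_int \<alpha> d t\<bar>" using deq[of t] False Suc.prems lam by (simp add: abs_mult)
      moreover have "lam * (omega \<alpha> T * (B * c ^ n) * frac_kernel (1 + (real n + 1)) (t - 0)) = B * c ^ Suc n * frac_kernel (real (Suc n) + 1) t"
        by (simp add: c_def mult_ac add_ac)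
      ultimately show ?thesis by (simp only:)
    qed
  qed
  have "d t = 0"
  proof (cases "t = 0")
    case True
    then show ?thesis using y Y T by (simp add: d_def stopped_eq)
  next
    case False
    then have t0: "0 < t" using t by simp
    have "\<bar>d t\<bar> \<le> B * (inverse (fact n) * (c * t) ^ n)" for n
    proof -
      have "frac_kernel (real n + 1) t = t ^ n / fact n"
        using t0 Gamma_fact[of n, where ?'a = real] by (simp add: frac_kernel_def omega_def powr_realpow add.commute)
      then show ?thesis using bound[of t n] t by (simp add: power_mult_distrib divide_inverse mult_ac)
    qed
    moreover have "(\<lambda>n. B * (inverse (fact n) * (c * t) ^ n)) \<longlonglongrightarrow> B * 0"
      by (intro tendsto_mult_left summable_LIMSEQ_zero summable_exp)
    ultimately have "\<bar>d t\<bar> \<le> B * 0" by (intro LIMSEQ_le_const[of _ "B * 0" "\<bar>d t\<bar>"]) auto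
    then show ?thesis by simp
  qed
  then show ?thesis using t by (simp add: d_def stopped_eq)
qed

section \<open>Modes of the solution and of the scheme\<close>

context eigensystem
begin

lemma oscillator_mode_volterra:
  assumes mode: "oscillator_mode \<nu> C l y y1 y2 v v1 v2" and T: "0 < T" and t: "t \<in> {0..T}" and \<nu>: "0 < \<nu>"
  shows "c * y t + l * frac_int (2 * \<nu>) (stopped T (\<lambda>t. c * y t)) t = c * t"
proof -
  have z: "\<And>s. s \<le> 0 \<Longrightarrow> y s = 0" and eq: "\<And>t. 0 < t \<Longrightarrow> y t + l * frac_int (2 * \<nu>) y t = t"
    using mode unfolding oscillator_mode_def by blast+
  have "frac_int (2 * \<nu>) (stopped T (\<lambda>t. c * y t)) t = frac_int (2 * \<nu>) (\<lambda>s. c * y s) t"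
  proof (rule frac_int_local)
    fix s assume s: "s < t"
    show "stopped T (\<lambda>t. c * y t) s = c * y s"
    proof (cases "s \<le> 0")
      case True
      then show ?thesis using T z[of s] z[of 0] by (simp add: stopped_def max_def)
    qed (use s t in \<open>simp add: stopped_eq\<close>)
  qed
  also have "\<dots> = c * frac_int (2 * \<nu>) y t" by (rule frac_int_scale)
  finally have e: "frac_int (2 * \<nu>) (stopped T (\<lambda>t. c * y t)) t = c * frac_int (2 * \<nu>) y t" .
  show ?thesis
  proof (cases "t = 0")
    case True
    moreover have "frac_int (2 * \<nu>) y 0 = 0" by (rule frac_int_nonpos[OF z]) auto
    ultimately show ?thesis using e z[of 0] by simp
  next
    case False
    then have "c * (y t + l * frac_int (2 * \<nu>) y t) = c * t" using eq[of t] t by simp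
    then show ?thesis unfolding e by (simp add: algebra_simps)
  qed
qed

text \<open>The coefficient of a strong solution and the exact mode satisfy the same Volterra
  equation.\<close>

lemma solution_mode:
  assumes \<nu>: "1 / 2 < \<nu>" "\<nu> < 1" and T: "0 < T"
    and mode: "oscillator_mode \<nu> C (lam k) y y1 y2 v v1 v2"
    and sol: "frac_wave_solution a b (2 * \<nu>) T (\<lambda>t x. 0) (\<lambda>x. 0) a1 u"
    and t: "t \<in> {0..T}"
  shows "L2_inner M (u t) (\<phi> k) = L2_inner M a1 (\<phi> k) * y t"
proof -
  define Y where "Y = (\<lambda>t. L2_inner M (u t) (\<phi> k))"
  define c where "c = L2_inner M a1 (\<phi> k)"
  have cont: "L2_continuous_on M {0..T} u" and init: "AE x in M. u 0 x = 0"
    and init': "has_L2_derivative M u a1 0 {0..T}"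
    and eq: "\<forall>t\<in>{0<..<T}. \<exists>w z. has_caputo_high M (2 * \<nu>) u t w \<and> dirichlet_laplacian a b (u t) z \<and> (AE x in M. w x - z x = 0)"
    using sol unfolding frac_wave_solution_def Let_def by blast+
  have ymode: "continuous_on {0..} y" "y 0 = 0" using mode unfolding oscillator_mode_def by auto
  have Yc: "continuous_on {0..T} Y" unfolding Y_def by (rule L2_continuous_on_inner[OF cont \<phi>_L2])
  have u0: "u 0 \<in> L2_space M" using cont T by (simp add: L2_continuous_on_def)
  have "L2_inner M (u 0) (\<phi> k) = L2_inner M (\<lambda>x. 0) (\<phi> k)"
    by (rule L2_inner_cong_AE[OF init u0 L2_zero \<phi>_L2])
  then have Y0: "Y 0 = 0" by (simp add: Y_def L2_inner_def)
  have Yi: "(Y has_real_derivative c) (at 0 within {0..T})"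
    unfolding Y_def c_def using T by (intro has_L2_derivative_inner[OF init' _ \<phi>_L2]) simp
  have volt: "Y t + lam k * frac_int (2 * \<nu>) (stopped T Y) t = c * t" if t: "t \<in> {0..T}" for t
  proof (rule caputo_volterra[OF T _ _ Yc Y0 Yi _ t])
    fix r assume r: "r \<in> {0<..<T}"
    obtain w z where high: "has_caputo_high M (2 * \<nu>) u r w" and z: "dirichlet_laplacian a b (u r) z" and wz: "AE x in M. w x - z x = 0"
      using eq r by blast
    obtain u1 u2 where d1: "\<forall>s\<in>{0..r}. has_L2_derivative M u (u1 s) s {0..r}"
      and c1: "L2_continuous_on M {0..r} u1" and d2: "\<forall>s\<in>{0<..<r}. has_L2_derivative M u1 (u2 s) s {0..r}"
      and int: "has_L2_integral M (\<lambda>s x. 1 / Gamma (2 - 2 * \<nu>) * (r - s) powr (1 - 2 * \<nu>) * u2 s x) w {0<..<r}"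
      using high unfolding has_caputo_high_def by blast
    have wL: "w \<in> L2_space M" and bi: "has_bochner_integral (lebesgue_on {0<..<r})
        (\<lambda>s. L2_inner M (\<lambda>x. 1 / Gamma (2 - 2 * \<nu>) * (r - s) powr (1 - 2 * \<nu>) * u2 s x) (\<phi> k)) (L2_inner M w (\<phi> k))"
      using int \<phi>_L2 unfolding has_L2_integral_def by blast+
    have "AE x in M. w x = z x" using wz by (rule eventually_mono) simp
    then have "L2_inner M w (\<phi> k) = L2_inner M z (\<phi> k)"
      by (rule L2_inner_cong_AE[OF _ wL dirichlet_laplacian_L2(2)[OF z ab] \<phi>_L2])
    then have wY: "L2_inner M w (\<phi> k) = - lam k * Y r" by (simp add: Y_def laplacian_coefficient[OF z])
    show "\<exists>y1 y2. (\<forall>s\<in>{0..r}. (Y has_real_derivative y1 s) (at s within {0..r})) \<and>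
      continuous_on {0..r} y1 \<and> (\<forall>s\<in>{0<..<r}. (y1 has_real_derivative y2 s) (at s within {0..r})) \<and>
      has_bochner_integral (lebesgue_on {0<..<r}) (\<lambda>s. 1 / Gamma (2 - 2 * \<nu>) * (r - s) powr (1 - 2 * \<nu>) * y2 s) (- lam k * Y r)"
    proof (intro exI conjI ballI)
      show "(Y has_real_derivative L2_inner M (u1 s) (\<phi> k)) (at s within {0..r})" if "s \<in> {0..r}" for s
        unfolding Y_def using d1 that by (intro has_L2_derivative_inner[OF _ that \<phi>_L2]) blast
      show "continuous_on {0..r} (\<lambda>s. L2_inner M (u1 s) (\<phi> k))" by (rule L2_continuous_on_inner[OF c1 \<phi>_L2])
      show "((\<lambda>s. L2_inner M (u1 s) (\<phi> k)) has_real_derivative L2_inner M (u2 s) (\<phi> k)) (at s within {0..r})" if s: "s \<in> {0<..<r}" for s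
      proof (rule has_L2_derivative_inner[OF _ _ \<phi>_L2])
        show "has_L2_derivative M u1 (u2 s) s {0..r}" using d2 s by blast
      qed (use s in auto)
      show "has_bochner_integral (lebesgue_on {0<..<r}) (\<lambda>s. 1 / Gamma (2 - 2 * \<nu>) * (r - s) powr (1 - 2 * \<nu>) * L2_inner M (u2 s) (\<phi> k)) (- lam k * Y r)"
        using bi unfolding wY L2_inner_scale_left .
    qed
  qed (use \<nu> in auto)
  have "Y t = c * y t"
  proof (rule volterra_unique[OF T _ eigenvalue_pos Yc Y0 _ _ _ t])
    show "continuous_on {0..T} (\<lambda>t. c * y t)"
      by (intro continuous_intros continuous_on_subset[OF ymode(1)]) auto
    show "c * y 0 = 0" using ymode(2) by simp
    fix s assume s: "s \<in> {0..T}"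
    show "Y s + lam k * frac_int (2 * \<nu>) (stopped T Y) s = c * y s + lam k * frac_int (2 * \<nu>) (stopped T (\<lambda>t. c * y t)) s"
      using volt[OF s] oscillator_mode_volterra[OF mode T s, of c] \<nu> by simp
  qed (use \<nu> in auto)
  then show ?thesis by (simp add: Y_def c_def)
qed

text \<open>The coefficient of the derivative of \<open>u\<close> is \<open>y1\<close> times that of
  \<open>a1\<close>, since both are derivatives of the same function; the integral against the kernel then
  carries over.\<close>

lemma caputo_low_mode:
  assumes \<nu>: "1 / 2 < \<nu>" "\<nu> < 1" and T: "0 < T"
    and mode: "oscillator_mode \<nu> C (lam k) y y1 y2 v v1 v2"
    and sol: "frac_wave_solution a b (2 * \<nu>) T (\<lambda>t x. 0) (\<lambda>x. 0) a1 u"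
    and t: "t \<in> {0<..T}" and low: "has_caputo_low M \<nu> u t w"
  shows "L2_inner M w (\<phi> k) = L2_inner M a1 (\<phi> k) * v t"
proof -
  define c where "c = L2_inner M a1 (\<phi> k)"
  obtain u1 where d1: "\<forall>s\<in>{0<..<t}. has_L2_derivative M u (u1 s) s {0..t}"
    and int: "has_L2_integral M (\<lambda>s x. 1 / Gamma (1 - \<nu>) * (t - s) powr (- \<nu>) * u1 s x) w {0<..<t}"
    using low unfolding has_caputo_low_def by blast
  have bi: "has_bochner_integral (lebesgue_on {0<..<t})
      (\<lambda>s. L2_inner M (\<lambda>x. 1 / Gamma (1 - \<nu>) * (t - s) powr (- \<nu>) * u1 s x) (\<phi> k)) (L2_inner M w (\<phi> k))"
    using int \<phi>_L2 unfolding has_L2_integral_def by blast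
  have yd: "\<And>s. 0 < s \<Longrightarrow> (y has_real_derivative y1 s) (at s)"
    and vt: "has_bochner_integral lborel (\<lambda>s. frac_kernel (1 - \<nu>) (t - s) * (if 0 < s then y1 s else 0)) (v t)"
    using mode t unfolding oscillator_mode_def by auto
  have u1: "L2_inner M (u1 s) (\<phi> k) = c * y1 s" if s: "s \<in> {0<..<t}" for s
  proof (rule DERIV_unique)
    have "((\<lambda>s. L2_inner M (u s) (\<phi> k)) has_real_derivative L2_inner M (u1 s) (\<phi> k)) (at s within {0..t})"
    proof (rule has_L2_derivative_inner[OF _ _ \<phi>_L2])
      show "has_L2_derivative M u (u1 s) s {0..t}" using d1 s by blast
    qed (use s in auto)
    then show "((\<lambda>s. L2_inner M (u s) (\<phi> k)) has_real_derivative L2_inner M (u1 s) (\<phi> k)) (at s)"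
      using s by (simp add: at_within_Icc_at)
    show "((\<lambda>s. L2_inner M (u s) (\<phi> k)) has_real_derivative c * y1 s) (at s)"
    proof (rule has_field_derivative_transform_within_open)
      show "((\<lambda>s. c * y s) has_real_derivative c * y1 s) (at s)" using s by (intro DERIV_cmult yd) auto
      fix r assume "r \<in> {0<..<t}"
      then have "r \<in> {0..T}" using t by auto
      then show "c * y r = L2_inner M (u r) (\<phi> k)"
        unfolding c_def using solution_mode[OF \<nu> T mode sol, of r] by simp
    qed (use s in auto)
  qed
  define K where "K = (\<lambda>s. c * (frac_kernel (1 - \<nu>) (t - s) * (if 0 < s then y1 s else 0)))"
  have K: "has_bochner_integral lborel K (c * v t)"
    unfolding K_def by (rule has_bochner_integral_mult_right[OF vt])
  have Km: "K \<in> borel_measurable borel"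
    using K borel_measurable_has_bochner_integral by fastforce
  have eq: "K s = indicator {0<..<t} s * L2_inner M (\<lambda>x. 1 / Gamma (1 - \<nu>) * (t - s) powr (- \<nu>) * u1 s x) (\<phi> k)" for s
    unfolding L2_inner_scale_left using u1[of s] by (cases "s \<in> {0<..<t}") (auto simp: K_def frac_kernel_def omega_def)
  have "has_bochner_integral lborel K (L2_inner M w (\<phi> k))"
    by (rule iffD1[OF has_bochner_integral_lebesgue_on_iff[OF _ Km eq] bi]) simp
  then have "L2_inner M w (\<phi> k) = c * v t" using K by (rule has_bochner_integral_eq)
  then show ?thesis by (simp add: c_def)
qed

lemma L1_derivative_inner:
  assumes w: "\<And>j. j \<le> n \<Longrightarrow> w j \<in> L2_space M" and h: "h \<in> L2_space M"
  shows "L1_derivative \<nu> t w n \<in> L2_space M"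
    and "L2_inner M (L1_derivative \<nu> t w n) h
      = (\<Sum>k = 1..n. L1_weight \<nu> t n (n - k) * (L2_inner M (w k) h - L2_inner M (w (k - 1)) h))"
proof -
  have eq: "L1_derivative \<nu> t w n = (\<lambda>x. \<Sum>k = 1..n. L1_weight \<nu> t n (n - k) * (w k x - w (k - 1) x))"
    by (simp add: L1_derivative_def fun_eq_iff)
  have d: "(\<lambda>x. w k x - w (k - 1) x) \<in> L2_space M" if "k \<in> {1..n}" for k
    using that by (intro L2_diff w) auto
  have s: "(\<lambda>x. L1_weight \<nu> t n (n - k) * (w k x - w (k - 1) x)) \<in> L2_space M" if "k \<in> {1..n}" for k
    by (rule L2_scale[OF d[OF that]])
  show "L1_derivative \<nu> t w n \<in> L2_space M" unfolding eq by (rule L2_sum[OF s])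
  have "L2_inner M (L1_derivative \<nu> t w n) h = (\<Sum>k = 1..n. L2_inner M (\<lambda>x. L1_weight \<nu> t n (n - k) * (w k x - w (k - 1) x)) h)"
    unfolding eq by (rule L2_inner_sum_left[OF s h])
  also have "\<dots> = (\<Sum>k = 1..n. L1_weight \<nu> t n (n - k) * (L2_inner M (w k) h - L2_inner M (w (k - 1)) h))"
  proof (rule sum.cong[OF refl])
    fix k assume k: "k \<in> {1..n}"
    then have "w k \<in> L2_space M" "w (k - 1) \<in> L2_space M" by (auto intro: w)
    then show "L2_inner M (\<lambda>x. L1_weight \<nu> t n (n - k) * (w k x - w (k - 1) x)) h
        = L1_weight \<nu> t n (n - k) * (L2_inner M (w k) h - L2_inner M (w (k - 1)) h)"
      unfolding L2_inner_scale_left using h by (simp add: L2_inner_diff_left)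
  qed
  finally show "L2_inner M (L1_derivative \<nu> t w n) h
      = (\<Sum>k = 1..n. L1_weight \<nu> t n (n - k) * (L2_inner M (w k) h - L2_inner M (w (k - 1)) h))" .
qed

lemma scheme_L2:
  assumes sch: "L1_scheme a b \<alpha> \<nu> N t a1 U V" and n: "n \<le> N"
  shows "U n \<in> L2_space M" "V n \<in> L2_space M"
proof -
  have zero: "U 0 x = 0" "V 0 x = 0" if "x \<in> space M" for x
    using sch that unfolding L1_scheme_def by auto
  have U: "U j \<in> L2_space M" if "j \<le> N" for j
  proof (cases "j = 0")
    case True
    then show ?thesis using L2_cong[of M "U 0" "\<lambda>x. 0"] zero L2_zero by simp
  next
    case False
    then have "j \<in> {1..N}" using that by simp
    then obtain z where "dirichlet_laplacian a b (U j) z" using sch unfolding L1_scheme_def by blast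
    then show ?thesis by (rule dirichlet_laplacian_L2(1)[OF _ ab])
  qed
  show "U n \<in> L2_space M" by (rule U[OF n])
  show "V n \<in> L2_space M"
  proof (cases "n = 0")
    case True
    then show ?thesis using L2_cong[of M "V 0" "\<lambda>x. 0"] zero L2_zero by simp
  next
    case False
    then have "n \<in> {1..N}" using n by simp
    then have "\<forall>x\<in>{a<..<b}. V n x = L1_derivative \<nu> t U n x" using sch unfolding L1_scheme_def by blast
    then have eq: "V n x = L1_derivative \<nu> t U n x" if "x \<in> space M" for x using that by simp
    have "L1_derivative \<nu> t U n \<in> L2_space M"
      by (rule L1_derivative_inner(1)[OF _ \<phi>_L2[of 0]]) (use U n in auto)
    moreover have "V n \<in> L2_space M \<longleftrightarrow> L1_derivative \<nu> t U n \<in> L2_space M" by (rule L2_cong[OF eq])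
    ultimately show ?thesis by simp
  qed
qed

lemma scheme_mode:
  assumes sch: "L1_scheme a b \<alpha> \<nu> N t a1 U V" and a1: "a1 \<in> L2_space M"
  fixes k :: nat
  defines "Uk \<equiv> \<lambda>n. L2_inner M (U n) (\<phi> k)" and "Vk \<equiv> \<lambda>n. L2_inner M (V n) (\<phi> k)"
  shows "Uk 0 = 0" "Vk 0 = 0"
    and "\<And>n. n \<in> {1..N} \<Longrightarrow> Vk n = (\<Sum>k = 1..n. L1_weight \<nu> t n (n - k) * (Uk k - Uk (k - 1)))"
    and "\<And>n. n \<in> {1..N} \<Longrightarrow>
      (\<Sum>k = 1..n. L1_weight \<nu> t n (n - k) * (Vk k - Vk (k - 1))) + lam k * Uk n = L2_inner M a1 (\<phi> k) * omega (2 - \<alpha>) (t n)"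
proof -
  note L2 = scheme_L2[OF sch]
  have zero: "U 0 x = 0" "V 0 x = 0" if "x \<in> space M" for x
    using sch that unfolding L1_scheme_def by auto
  have z: "L2_inner M (\<lambda>x. 0) (\<phi> k) = 0" by (simp add: L2_inner_def)
  show "Uk 0 = 0" unfolding Uk_def using L2_inner_cong[of M "U 0" "\<lambda>x. 0" "\<phi> k"] zero z by simp
  show "Vk 0 = 0" unfolding Vk_def using L2_inner_cong[of M "V 0" "\<lambda>x. 0" "\<phi> k"] zero z by simp
  fix n assume n: "n \<in> {1..N}"
  have le: "j \<le> N" if "j \<le> n" for j using n that by simp
  have "\<forall>x\<in>{a<..<b}. V n x = L1_derivative \<nu> t U n x" using sch n unfolding L1_scheme_def by blast
  then have "V n x = L1_derivative \<nu> t U n x" if "x \<in> space M" for x using that by simp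
  then have "Vk n = L2_inner M (L1_derivative \<nu> t U n) (\<phi> k)" unfolding Vk_def by (rule L2_inner_cong)
  also have "\<dots> = (\<Sum>k = 1..n. L1_weight \<nu> t n (n - k) * (Uk k - Uk (k - 1)))"
    unfolding Uk_def by (rule L1_derivative_inner(2)[OF L2(1)[OF le] \<phi>_L2])
  finally show "Vk n = (\<Sum>k = 1..n. L1_weight \<nu> t n (n - k) * (Uk k - Uk (k - 1)))" .
  obtain z where z: "dirichlet_laplacian a b (U n) z"
    and ae: "AE x in M. L1_derivative \<nu> t V n x - z x = a1 x * omega (2 - \<alpha>) (t n)"
    using sch n unfolding L1_scheme_def by blast
  note LV = L1_derivative_inner[where n = n and w = V and h = "\<phi> k" and \<nu> = \<nu> and t = t, OF L2(2)[OF le] \<phi>_L2]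
  note zL = dirichlet_laplacian_L2(2)[OF z ab]
  have ae': "AE x in M. L1_derivative \<nu> t V n x - z x = omega (2 - \<alpha>) (t n) * a1 x"
    using ae by (simp add: mult.commute)
  have "L2_inner M (\<lambda>x. L1_derivative \<nu> t V n x - z x) (\<phi> k) = L2_inner M (\<lambda>x. omega (2 - \<alpha>) (t n) * a1 x) (\<phi> k)"
    by (rule L2_inner_cong_AE[OF ae' L2_diff[OF LV(1) zL] L2_scale[OF a1] \<phi>_L2])
  then have "L2_inner M (L1_derivative \<nu> t V n) (\<phi> k) - L2_inner M z (\<phi> k) = omega (2 - \<alpha>) (t n) * L2_inner M a1 (\<phi> k)"
    unfolding L2_inner_scale_left L2_inner_diff_left[OF LV(1) zL \<phi>_L2, simplified] .
  moreover have "L2_inner M (L1_derivative \<nu> t V n) (\<phi> k) = (\<Sum>k = 1..n. L1_weight \<nu> t n (n - k) * (Vk k - Vk (k - 1)))"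
    unfolding Vk_def by (rule L1_derivative_inner(2)[OF L2(2)[OF le] \<phi>_L2])
  moreover have "L2_inner M z (\<phi> k) = - (lam k * Uk n)"
    unfolding Uk_def laplacian_coefficient[OF z] by simp
  ultimately show "(\<Sum>k = 1..n. L1_weight \<nu> t n (n - k) * (Vk k - Vk (k - 1))) + lam k * Uk n = L2_inner M a1 (\<phi> k) * omega (2 - \<alpha>) (t n)"
    unfolding mult.commute[of "L2_inner M a1 (\<phi> k)"] by linarith
qed

end

section \<open>The error estimate\<close>

text \<open>On \<open>m \<le> l\<close> the factors 1 and \<open>l powr (1 / 4)\<close> are dominated by
  \<open>l powr p\<close>, at the price of negative powers of \<open>m\<close>.\<close>

lemma spectral_weight_bound:
  fixes A B K X Y l m p c :: real
  assumes m: "0 < m" "m \<le> l" and p: "1 / 4 \<le> p" and nonneg: "0 \<le> A" "0 \<le> B" "0 \<le> K" "0 \<le> X" "0 \<le> Y"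
  shows "\<bar>c\<bar> * K * (A * X + l powr (1 / 4) * B * Y)
    \<le> K * (A * m powr (- p) + B * m powr (1 / 4 - p)) * (X + Y) * (l powr p * \<bar>c\<bar>)"
proof -
  have "m powr p \<le> l powr p" using m p by (intro powr_mono2) auto
  then have "m powr (- p) * m powr p \<le> m powr (- p) * l powr p" by (rule mult_left_mono) simp
  then have 1: "1 \<le> m powr (- p) * l powr p" using m by (simp add: powr_add[symmetric])
  have "l powr (1 / 4 - p) \<le> m powr (1 / 4 - p)" using m p by (intro powr_mono2') auto
  then have "l powr (1 / 4 - p) * l powr p \<le> m powr (1 / 4 - p) * l powr p" by (rule mult_right_mono) simp
  then have 2: "l powr (1 / 4) \<le> m powr (1 / 4 - p) * l powr p" using m by (simp add: powr_add[symmetric])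
  have "A * X \<le> A * (X + Y) * (m powr (- p) * l powr p)"
  proof -
    have "A * X * 1 \<le> A * (X + Y) * (m powr (- p) * l powr p)"
      using nonneg 1 by (intro mult_mono mult_nonneg_nonneg) auto
    then show ?thesis by simp
  qed
  moreover have "l powr (1 / 4) * (B * Y) \<le> (m powr (1 / 4 - p) * l powr p) * (B * (X + Y))"
    using nonneg 2 by (intro mult_mono mult_nonneg_nonneg) auto
  ultimately have "A * X + l powr (1 / 4) * B * Y
      \<le> (A * m powr (- p) + B * m powr (1 / 4 - p)) * (X + Y) * l powr p"
    by (simp add: algebra_simps)
  then have "\<bar>c\<bar> * K * (A * X + l powr (1 / 4) * B * Y)
      \<le> \<bar>c\<bar> * K * ((A * m powr (- p) + B * m powr (1 / 4 - p)) * (X + Y) * l powr p)"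
    using nonneg by (intro mult_left_mono) auto
  then show ?thesis by (simp add: mult_ac)
qed

text \<open>A bound in every mode implies the bound in norm: the squares are added with the identities of
  Parseval, and Bessel applies to the right-hand side.\<close>

lemma (in eigensystem) norms_from_modes:
  assumes e: "e \<in> L2_space M" and d: "dirichlet_laplacian a b d z" and g: "g \<in> L2_space M" and D: "0 \<le> D"
    and modes: "\<And>k. (L2_inner M e (\<phi> k))\<^sup>2 + lam k * (L2_inner M d (\<phi> k))\<^sup>2 \<le> (D * L2_inner M g (\<phi> k))\<^sup>2"
  shows "L2_norm M e + L2_norm M (deriv d) \<le> 2 * D * L2_norm M g"
proof -
  have "(\<lambda>n. \<Sum>k<n. L2_inner M e (\<phi> k) * L2_inner M e (\<phi> k)) \<longlonglongrightarrow> (L2_norm M e)\<^sup>2"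
    unfolding L2_norm_power2 by (rule parseval[OF e e])
  then have lim: "(\<lambda>n. (\<Sum>k<n. L2_inner M e (\<phi> k) * L2_inner M e (\<phi> k)) + (\<Sum>k<n. lam k * (L2_inner M d (\<phi> k))\<^sup>2))
      \<longlonglongrightarrow> (L2_norm M e)\<^sup>2 + (L2_norm M (deriv d))\<^sup>2"
    by (rule tendsto_add[OF _ gradient_parseval[OF d]])
  have "(\<Sum>k<n. L2_inner M e (\<phi> k) * L2_inner M e (\<phi> k)) + (\<Sum>k<n. lam k * (L2_inner M d (\<phi> k))\<^sup>2)
      \<le> (D * L2_norm M g)\<^sup>2" for n
  proof -
    have "(\<Sum>k<n. L2_inner M e (\<phi> k) * L2_inner M e (\<phi> k)) + (\<Sum>k<n. lam k * (L2_inner M d (\<phi> k))\<^sup>2)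
        = (\<Sum>k<n. (L2_inner M e (\<phi> k))\<^sup>2 + lam k * (L2_inner M d (\<phi> k))\<^sup>2)"
      by (simp add: sum.distrib power2_eq_square)
    also have "\<dots> \<le> (\<Sum>k<n. (D * L2_inner M g (\<phi> k))\<^sup>2)" by (rule sum_mono[OF modes])
    also have "\<dots> = D\<^sup>2 * (\<Sum>k<n. (L2_inner M g (\<phi> k))\<^sup>2)" by (simp add: power_mult_distrib sum_distrib_left)
    also have "\<dots> \<le> D\<^sup>2 * (L2_norm M g)\<^sup>2" by (intro mult_left_mono bessel[OF g]) simp
    finally show ?thesis by (simp add: power_mult_distrib)
  qed
  then have sq: "(L2_norm M e)\<^sup>2 + (L2_norm M (deriv d))\<^sup>2 \<le> (D * L2_norm M g)\<^sup>2"
    by (intro LIMSEQ_le_const2[OF lim]) blast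
  have Dg: "0 \<le> D * L2_norm M g" using D L2_norm_nonneg[of M g] by simp
  have "(L2_norm M e)\<^sup>2 \<le> (D * L2_norm M g)\<^sup>2" using sq zero_le_power2[of "L2_norm M (deriv d)"] by linarith
  then have "L2_norm M e \<le> D * L2_norm M g" by (rule power2_le_imp_le[OF _ Dg])
  moreover have "(L2_norm M (deriv d))\<^sup>2 \<le> (D * L2_norm M g)\<^sup>2" using sq zero_le_power2[of "L2_norm M e"] by linarith
  then have "L2_norm M (deriv d) \<le> D * L2_norm M g" by (rule power2_le_imp_le[OF _ Dg])
  ultimately show ?thesis by linarith
qed

theorem theorem5:
  fixes a b \<alpha> \<nu> T r \<gamma> \<epsilon> q1 q3 :: real
    and lam :: "nat \<Rightarrow> real" and \<phi> :: "nat \<Rightarrow> real \<Rightarrow> real"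
  assumes "a < b"
    and "1 < \<alpha>" "\<alpha> < 2" and "\<nu> = \<alpha> / 2"
    and "0 < T" and "1 \<le> r"
    and "1 / 4 < \<gamma>" "\<gamma> \<le> 1" and "0 < \<epsilon>" "\<epsilon> < 1"
    and "dirichlet_eigensystem a b lam \<phi>"
    and "q1 = min (r * (1 - \<nu>)) (2 - \<nu>)"
    and "q3 = min (r * (1 - \<nu> / 2)) (2 - \<nu>)"
  shows "\<exists>C>0. \<forall>(N::nat) a1 g u v U V.
    1 \<le> N \<longrightarrow>
    a1 \<in> frac_laplacian_domain a b lam \<phi> (\<gamma> + \<epsilon>) \<longrightarrow>
    frac_laplacian a b lam \<phi> (\<gamma> + \<epsilon>) a1 g \<longrightarrow>
    frac_wave_solution a b \<alpha> T (\<lambda>t x. 0) (\<lambda>x. 0) a1 u \<longrightarrow>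
    (\<forall>t\<in>{0<..T}. has_caputo_low (interval_measure_on a b) \<nu> u t (v t)) \<longrightarrow>
    L1_scheme a b \<alpha> \<nu> N (graded_mesh T N r) a1 U V \<longrightarrow>
    (\<forall>n\<in>{1..N}.
       L2_norm (interval_measure_on a b) (\<lambda>x. v (graded_mesh T N r n) x - V n x)
       + L2_norm (interval_measure_on a b) (deriv (\<lambda>x. u (graded_mesh T N r n) x - U n x))
       \<le> C * (real N powr (- q1) + real N powr (- q3)) * L2_norm (interval_measure_on a b) g)"
proof -
  have \<alpha>: "\<alpha> = 2 * \<nu>" and \<nu>: "1 / 2 < \<nu>" "\<nu> < 1" using assms(2,3,4) by auto
  note T = assms(5) and r = assms(6) and ab = assms(1) and q1 = assms(12) and q3 = assms(13)
  interpret eigensystem a b lam \<phi> by unfold_locales (fact assms(1) assms(11))+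
  obtain C0 where C0: "0 < C0"
    and osc: "\<forall>l>0. \<exists>y y1 y2 v v1 v2. oscillator_mode \<nu> C0 l y y1 y2 v v1 v2"
    using oscillator_modes[OF \<nu>] by blast
  define p where "p = \<gamma> + \<epsilon>"
  \<comment> \<open>The lower bound of the spectrum; through it the constant depends on the
    interval.\<close>
  define m where "m = 1 / (b - a)\<^sup>2"
  define A where "A = truncation_const T r \<nu> (1 - \<nu>)"
  define B where "B = truncation_const T r \<nu> (1 - \<nu> / 2)"
  define K where "K = C0 * Gamma (1 - \<nu>)"
  define D where "D = K * (A * m powr (- p) + B * m powr (1 / 4 - p))"
  have p: "1 / 4 \<le> p" using assms(7,9) by (simp add: p_def)
  have m: "0 < m" using ab by (simp add: m_def)
  have AB: "0 \<le> A" "0 \<le> B" unfolding A_def B_def by (rule truncation_const_nonneg; use \<nu> T r in simp)+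
  have G: "0 \<le> Gamma (1 - \<nu>)" using \<nu> by (intro Gamma_real_nonneg) simp
  have K: "0 \<le> K" unfolding K_def using C0 G by simp
  have D: "0 \<le> D" unfolding D_def using K AB by simp
  show ?thesis
  proof (intro exI[of _ "2 * D + 1"] conjI allI impI ballI)
    show "0 < 2 * D + 1" using D by simp
    fix N :: nat and a1 g :: "real \<Rightarrow> real" and u v :: "real \<Rightarrow> real \<Rightarrow> real" and U V :: "nat \<Rightarrow> real \<Rightarrow> real" and n :: nat
    assume N: "1 \<le> N" and dom: "a1 \<in> frac_laplacian_domain a b lam \<phi> (\<gamma> + \<epsilon>)"
      and g: "frac_laplacian a b lam \<phi> (\<gamma> + \<epsilon>) a1 g"
      and sol: "frac_wave_solution a b \<alpha> T (\<lambda>t x. 0) (\<lambda>x. 0) a1 u"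
      and v: "\<forall>t\<in>{0<..T}. has_caputo_low M \<nu> u t (v t)"
      and sch: "L1_scheme a b \<alpha> \<nu> N (graded_mesh T N r) a1 U V" and n: "n \<in> {1..N}"
    interpret mesh: graded_time_mesh T r N by unfold_locales (fact T r N)+
    define t where "t = graded_mesh T N r n"
    define R where "R = real N powr (- q1) + real N powr (- q3)"
    have tn: "t \<in> {0<..T}" unfolding t_def using n mesh.mesh_pos[of n] mesh.mesh_le_T[of n] by simp
    have a1: "a1 \<in> L2_space M" using dom by (simp add: frac_laplacian_domain_def)
    have gL: "g \<in> L2_space M"
      and glim: "(\<lambda>n. L2_norm M (\<lambda>x. g x - (\<Sum>k<n. lam k powr p * L2_inner M a1 (\<phi> k) * \<phi> k x))) \<longlonglongrightarrow> 0"
      using g unfolding frac_laplacian_def Let_def p_def by blast+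
    have gk: "L2_inner M g (\<phi> k) = lam k powr p * L2_inner M a1 (\<phi> k)" for k
      by (rule expansion_coefficient[OF gL glim])
    have low: "has_caputo_low M \<nu> u t (v t)" using v tn by blast
    then have vL: "v t \<in> L2_space M" unfolding has_caputo_low_def has_L2_integral_def by blast
    obtain z where z: "dirichlet_laplacian a b (u t) z"
      using sol tn unfolding frac_wave_solution_def Let_def by blast
    obtain z' where z': "dirichlet_laplacian a b (U n) z'" using sch n unfolding L1_scheme_def by blast
    have nN: "n \<le> N" using n by simp
    note UV = scheme_L2[OF sch nN]
    note uL = dirichlet_laplacian_L2(1)[OF z ab]
    have "L2_norm M (\<lambda>x. v t x - V n x) + L2_norm M (deriv (\<lambda>x. u t x - U n x)) \<le> 2 * (D * R) * L2_norm M g"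
    proof (rule norms_from_modes[OF L2_diff[OF vL UV(2)] dirichlet_laplacian_diff[OF z z'] gL])
      show "0 \<le> D * R" using D by (simp add: R_def)
      fix k
      define c where "c = L2_inner M a1 (\<phi> k)"
      obtain y y1 y2 w w1 w2 where mode: "oscillator_mode \<nu> C0 (lam k) y y1 y2 w w1 w2"
        using osc eigenvalue_pos[of k] by blast
      have uk: "L2_inner M (u t) (\<phi> k) = c * y t"
        unfolding c_def using tn by (intro solution_mode[OF \<nu> T mode sol[unfolded \<alpha>]]) auto
      have vk: "L2_inner M (v t) (\<phi> k) = c * w t"
        unfolding c_def by (rule caputo_low_mode[OF \<nu> T mode sol[unfolded \<alpha>] tn low])
      have "(L2_inner M (\<lambda>x. v t x - V n x) (\<phi> k))\<^sup>2 + lam k * (L2_inner M (\<lambda>x. u t x - U n x) (\<phi> k))\<^sup>2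
          = (c * w t - L2_inner M (V n) (\<phi> k))\<^sup>2 + lam k * (c * y t - L2_inner M (U n) (\<phi> k))\<^sup>2"
        by (simp only: L2_inner_diff_left[OF vL UV(2) \<phi>_L2] L2_inner_diff_left[OF uL UV(1) \<phi>_L2] uk vk)
      also have "\<dots> \<le> (\<bar>c\<bar> * C0 * Gamma (1 - \<nu>) * (A * real N powr (- q1) + lam k powr (1 / 4) * B * real N powr (- q3)))\<^sup>2"
        unfolding A_def B_def t_def c_def
        by (rule mesh.mode_error[OF \<nu> eigenvalue_pos C0 mode q1 q3 scheme_mode[OF sch[unfolded \<alpha>] a1] n])
      also have "\<dots> \<le> (D * R * (lam k powr p * \<bar>c\<bar>))\<^sup>2"
      proof (rule power_mono)
        show "\<bar>c\<bar> * C0 * Gamma (1 - \<nu>) * (A * real N powr (- q1) + lam k powr (1 / 4) * B * real N powr (- q3))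
            \<le> D * R * (lam k powr p * \<bar>c\<bar>)"
          using spectral_weight_bound[OF m eigenvalue_lower_bound[of k, folded m_def] p AB K, of "real N powr (- q1)" "real N powr (- q3)" c]
          by (simp add: D_def R_def K_def mult.assoc)
        show "0 \<le> \<bar>c\<bar> * C0 * Gamma (1 - \<nu>) * (A * real N powr (- q1) + lam k powr (1 / 4) * B * real N powr (- q3))"
          using C0 G AB by (intro mult_nonneg_nonneg add_nonneg_nonneg) auto
      qed
      also have "\<dots> = (D * R * L2_inner M g (\<phi> k))\<^sup>2"
        unfolding gk c_def by (simp add: power_mult_distrib)
      finally show "(L2_inner M (\<lambda>x. v t x - V n x) (\<phi> k))\<^sup>2 + lam k * (L2_inner M (\<lambda>x. u t x - U n x) (\<phi> k))\<^sup>2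
          \<le> (D * R * L2_inner M g (\<phi> k))\<^sup>2" .
    qed
    also have "\<dots> = 2 * D * (R * L2_norm M g)" by simp
    also have "\<dots> \<le> (2 * D + 1) * (R * L2_norm M g)"
      using L2_norm_nonneg[of M g] by (intro mult_right_mono mult_nonneg_nonneg) (auto simp: R_def)
    finally show "L2_norm M (\<lambda>x. v (graded_mesh T N r n) x - V n x) + L2_norm M (deriv (\<lambda>x. u (graded_mesh T N r n) x - U n x))
        \<le> (2 * D + 1) * (real N powr (- q1) + real N powr (- q3)) * L2_norm M g"
      unfolding t_def R_def by (simp only: mult.assoc)
  qed
qed

end
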